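(* For every $\mathsf{A} \in \mathcal{K}(\mathit{GL}_d(\mathbb{R}))$, $$\liminf_{\mathsf{B} \to \mathsf{A}} \check{\varrho}(\mathsf{B}) = \check{\varrho}\left(\wedge^{\ell(\mathsf{A})} \mathsf{A}\right)^{1/\ell(\mathsf{A})},$$ where $\ell(\mathsf{A})$ is the smallest index of domination for $\mathsf{A}$, and the lower limit is taken over $\mathsf{B}\in\mathcal{K}(\mathit{GL}_d(\mathbb{R}))$ with respect to the Hausdorff metric.
   Context: $\mathcal{K}(\mathit{GL}_d(\mathbb{R}))$ is the set of all nonempty compact subsets of $\mathit{GL}_d(\mathbb{R})$, equipped with the Hausdorff metric $d_H(\mathsf{A},\mathsf{B}) = \max\{\sup_{A\in\mathsf{A}}\inf_{B\in\mathsf{B}}\|A-B\|, \sup_{B\in\mathsf{B}}\inf_{A\in\mathsf{A}}\|A-B\|\}$, where $\|\cdot\|$ is the Euclidean operator norm. For a nonempty compact set $\mathsf{S}$ of linear endomorphisms of a finite-dimensional real vector space, the lower spectral radius is $$\check{\varrho}(\mathsf{S}) := \lim_{n\to\infty} \inf\{\|A_n\cdots A_1\|^{1/n} : A_1,\dots,A_n \in \mathsf{S}\} = \inf_{n\ge 1} \inf\{\|A_n\cdots A_1\|^{1/n} : A_1,\dots,A_n \in \mathsf{S}\},$$ independent of the operator norm. $\wedge^k A$ is the $k$th exterior power of $A$, acting on $\wedge^k\mathbb{R}^d$, and $\wedge^k\mathsf{A} := \{\wedge^k A : A\in\mathsf{A}\}$. Let $\sigma_1(A)\ge \cdots \ge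 \sigma_d(A)$ denote the singular values of $A$. For $1\le k<d$, $\mathsf{A}\in\mathcal{K}(\mathit{GL}_d(\mathbb{R}))$ is $k$-dominated (equivalently, $k$ is an index of domination for $\mathsf{A}$) if one of the following equivalent conditions holds: (a) there exist $C>1$, $\tau\in(0,1)$ such that $\sigma_{k+1}(A_n\cdots A_1)/\sigma_k(A_n\cdots A_1) \le C\tau^n$ for all $n\ge1$ and $A_1,\dots,A_n\in\mathsf{A}$; (b) there exists a set $\mathcal{C}\subset\mathbb{R}^d\setminus\{0\}$, relatively closed in $\mathbb{R}^d\setminus\{0\}$, closed under multiplication by nonzero scalars, such that $\bigcup_{A\in\mathsf{A}}A(\mathcal{C})$ is contained in the interior of $\mathcal{C}$, some $k$-dimensional subspace of $\mathbb{R}^d$ is contained in $\mathcal{C}\cup\{0\}$, and some $(d-k)$-dimensional subspace of $\mathbb{R}^d$ does not intersect $\mathcal{C}$. By convention every $\mathsf{A}\in\mathcal{K}(\mathit{GL}_d(\mathbb{R}))$ is $d$-dominated. Define $\ell(\mathsf{A}) := \min\{k\in\{1,\dots,d\} : \mathsf{A} \text{ is } k\text{-dominated}\}$. *)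

theory Defs
  imports
    "HOL-Analysis.Analysis"
    "HOL-Combinatorics.Permutations"
    "HOL-Computational_Algebra.Polynomial"
    "HOL-Library.Countable"
begin

section \<open>Operator norm and the Hausdorff metric\<close>

definition op_norm :: "real^'n^'m \<Rightarrow> real" where
  "op_norm A = onorm ((*v) A)"

definition compact_GL :: "(real^'n^'n) set set" where
  "compact_GL = {S. S \<noteq> {} \<and> compact S \<and> (\<forall>A\<in>S. invertible A)}"

definition hausdorff_dist :: "(real^'n^'m) set \<Rightarrow> (real^'n^'m) set \<Rightarrow> real" where
  "hausdorff_dist S T =
     max (SUP A\<in>S. INF B\<in>T. op_norm (A - B)) (SUP B\<in>T. INF A\<in>S. op_norm (A - B))"

text \<open>The locale \<^locale>\<open>Metric_space\<close> demands a nonnegative symmetric function on the whole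
  type, hence the value 0 outside \<^const>\<open>compact_GL\<close>.\<close>

definition GL_dist :: "(real^'n^'n) set \<Rightarrow> (real^'n^'n) set \<Rightarrow> real" where
  "GL_dist S T = (if S \<in> compact_GL \<and> T \<in> compact_GL then hausdorff_dist S T else 0)"

lemma op_norm_nonneg: "0 \<le> op_norm (A :: real^'n^'m)"
  unfolding op_norm_def by (rule onorm_pos_le) (rule matrix_vector_mul_bounded_linear)

lemma op_norm_eq_0: "op_norm (A :: real^'n^'m) = 0 \<longleftrightarrow> A = 0"
proof -
  have "op_norm A = 0 \<longleftrightarrow> (\<forall>x. A *v x = 0)"
    unfolding op_norm_def by (rule onorm_eq_0) (rule matrix_vector_mul_bounded_linear)
  thus ?thesis by (metis matrix_eq matrix_vector_mult_0)
qed

lemma op_norm_triangle: "op_norm (A + B :: real^'n^'m) \<le> op_norm A + op_norm B"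
  unfolding op_norm_def matrix_vector_mult_add_rdistrib
  by (rule onorm_triangle) (rule matrix_vector_mul_bounded_linear)+

lemma op_norm_minus: "op_norm (- A :: real^'n^'m) = op_norm A"
proof -
  have "(*v) (- A) = (\<lambda>x. - (A *v x))"
    by (simp add: fun_eq_iff matrix_vector_mult_def vec_eq_iff sum_negf)
  thus ?thesis by (simp add: op_norm_def onorm_neg)
qed

lemma op_norm_minus_commute: "op_norm (A - B :: real^'n^'m) = op_norm (B - A)"
  using op_norm_minus[of "A - B"] by simp

lemma op_norm_diff_triangle:
  "op_norm (A - C :: real^'n^'m) \<le> op_norm (A - B) + op_norm (B - C)"
  using op_norm_triangle[of "A - B" "B - C"] by simp

lemma op_norm_mult: "op_norm ((A :: real^'n^'m) ** (B :: real^'k^'n)) \<le> op_norm A * op_norm B"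
proof -
  have "(*v) (A ** B) = (*v) A \<circ> (*v) B" by (auto simp: matrix_vector_mul_assoc)
  thus ?thesis unfolding op_norm_def
    by (simp add: onorm_compose matrix_vector_mul_bounded_linear)
qed

lemma op_norm_le_norm:
  "op_norm (A :: real^'n^'m) \<le> real CARD('m) * real CARD('n) * norm A"
proof -
  have "\<bar>A $ i $ j\<bar> \<le> norm A" for i j
    by (meson Finite_Cartesian_Product.norm_nth_le component_le_norm_cart order_trans)
  thus ?thesis unfolding op_norm_def by (rule onorm_le_matrix_component)
qed

lemma continuous_on_op_norm: "continuous_on S (op_norm :: real^'n^'m \<Rightarrow> real)"
proof -
  define K where "K = real CARD('m) * real CARD('n)"
  have "K-lipschitz_on S (op_norm :: real^'n^'m \<Rightarrow> real)"
  proof (rule lipschitz_onI)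
    fix A B :: "real^'n^'m"
    have "op_norm A \<le> op_norm (A - B) + op_norm B" "op_norm B \<le> op_norm (B - A) + op_norm A"
      using op_norm_triangle[of "A - B" B] op_norm_triangle[of "B - A" A] by simp_all
    hence "\<bar>op_norm A - op_norm B\<bar> \<le> op_norm (A - B)"
      by (simp add: op_norm_minus_commute[of B A])
    thus "dist (op_norm A) (op_norm B) \<le> K * dist A B"
      using op_norm_le_norm[of "A - B"] by (simp add: dist_norm K_def)
  qed (simp add: K_def)
  thus ?thesis by (rule lipschitz_on_continuous_on)
qed

lemma SUP_INF_op_norm_le_iff:
  fixes S T :: "(real^'n^'m) set"
  assumes "compact S" "S \<noteq> {}" "compact T" "T \<noteq> {}"
  shows "(SUP A\<in>S. INF B\<in>T. op_norm (A - B)) \<le> r \<longleftrightarrow> (\<forall>A\<in>S. \<exists>B\<in>T. op_norm (A - B) \<le> r)"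
proof -
  have bdd: "bdd_below ((\<lambda>B. op_norm (A - B)) ` T)" for A
    by (rule bdd_belowI2[of _ 0]) (rule op_norm_nonneg)
  obtain B0 where B0: "B0 \<in> T" using assms by auto
  have "compact ((\<lambda>A. op_norm (A - B0)) ` S)"
    by (intro compact_continuous_image assms continuous_on_compose2[OF continuous_on_op_norm[of UNIV]]
          continuous_intros) auto
  then obtain K where K: "\<And>A. A \<in> S \<Longrightarrow> op_norm (A - B0) \<le> K"
    by (metis bounded_imp_bdd_above compact_imp_bounded bdd_above.unfold imageI)
  have bdda: "bdd_above ((\<lambda>A. INF B\<in>T. op_norm (A - B)) ` S)"
    by (rule bdd_aboveI2[of _ _ K]) (use cINF_lower[OF bdd B0] K in \<open>force intro: order_trans\<close>)
  have inf: "(INF B\<in>T. op_norm (A - B)) \<le> r \<longleftrightarrow> (\<exists>B\<in>T. op_norm (A - B) \<le> r)" for A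
  proof
    assume le: "(INF B\<in>T. op_norm (A - B)) \<le> r"
    have "continuous_on T (\<lambda>B. op_norm (A - B))"
      by (intro continuous_on_compose2[OF continuous_on_op_norm[of UNIV]] continuous_intros) auto
    then obtain B where B: "B \<in> T" "\<And>B'. B' \<in> T \<Longrightarrow> op_norm (A - B) \<le> op_norm (A - B')"
      using continuous_attains_inf[OF assms(3,4)] by metis
    hence "op_norm (A - B) \<le> (INF B\<in>T. op_norm (A - B))"
      using assms by (intro cINF_greatest) auto
    thus "\<exists>B\<in>T. op_norm (A - B) \<le> r" using le B by force
  next
    assume "\<exists>B\<in>T. op_norm (A - B) \<le> r"
    thus "(INF B\<in>T. op_norm (A - B)) \<le> r" by (auto intro: cINF_lower2[OF bdd])
  qed
  show ?thesis
    using cSUP_le_iff[OF assms(2) bdda] inf by simp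
qed

lemma hausdorff_dist_le_iff:
  fixes S T :: "(real^'n^'m) set"
  assumes "compact S" "S \<noteq> {}" "compact T" "T \<noteq> {}"
  shows "hausdorff_dist S T \<le> r \<longleftrightarrow>
    (\<forall>A\<in>S. \<exists>B\<in>T. op_norm (A - B) \<le> r) \<and> (\<forall>B\<in>T. \<exists>A\<in>S. op_norm (A - B) \<le> r)"
  using SUP_INF_op_norm_le_iff[OF assms, of r]
    SUP_INF_op_norm_le_iff[OF assms(3,4,1,2), of r]
  by (simp add: hausdorff_dist_def op_norm_minus_commute)

lemma hausdorff_dist_commute: "hausdorff_dist S T = hausdorff_dist T S"
  by (simp add: hausdorff_dist_def op_norm_minus_commute max.commute)

interpretation compact_GL: Metric_space compact_GL GL_dist
proof
  fix S T U :: "(real^'n^'n) set"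
  show "0 \<le> GL_dist S T"
  proof (cases "S \<in> compact_GL \<and> T \<in> compact_GL")
    case True
    then obtain A where "A \<in> S" by (auto simp: compact_GL_def)
    then obtain B where "op_norm (A - B) \<le> hausdorff_dist S T"
      using True hausdorff_dist_le_iff[of S T "hausdorff_dist S T"]
      unfolding compact_GL_def mem_Collect_eq by blast
    thus ?thesis using True op_norm_nonneg[of "A - B"] by (simp add: GL_dist_def)
  qed (auto simp: GL_dist_def)
  show "GL_dist S T = GL_dist T S"
    by (simp add: GL_dist_def hausdorff_dist_commute)
  assume S: "S \<in> compact_GL" and T: "T \<in> compact_GL"
  note iff = hausdorff_dist_le_iff[of S T]
  have zero: "op_norm (A - B) \<le> 0 \<longleftrightarrow> A = B" for A B :: "real^'n^'n"
    using op_norm_nonneg[of "A - B"] op_norm_eq_0[of "A - B"] by auto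
  show "GL_dist S T = 0 \<longleftrightarrow> S = T"
    using iff[of 0] S T \<open>0 \<le> GL_dist S T\<close> by (auto simp: GL_dist_def compact_GL_def zero)
  assume U: "U \<in> compact_GL"
  have "hausdorff_dist S U \<le> hausdorff_dist S T + hausdorff_dist T U"
  proof -
    have ST: "\<forall>A\<in>S. \<exists>B\<in>T. op_norm (A - B) \<le> hausdorff_dist S T"
         "\<forall>B\<in>T. \<exists>A\<in>S. op_norm (A - B) \<le> hausdorff_dist S T"
      using iff[of "hausdorff_dist S T"] S T by (auto simp: compact_GL_def)
    have TU: "\<forall>A\<in>T. \<exists>B\<in>U. op_norm (A - B) \<le> hausdorff_dist T U"
         "\<forall>B\<in>U. \<exists>A\<in>T. op_norm (A - B) \<le> hausdorff_dist T U"
      using hausdorff_dist_le_iff[of T U "hausdorff_dist T U"] T U by (auto simp: compact_GL_def)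
    have *: "op_norm (A - C) \<le> hausdorff_dist S T + hausdorff_dist T U"
      if "op_norm (A - B) \<le> hausdorff_dist S T" "op_norm (B - C) \<le> hausdorff_dist T U" for A B C
      using that op_norm_diff_triangle[of A C B] by simp
    have "\<forall>A\<in>S. \<exists>C\<in>U. op_norm (A - C) \<le> hausdorff_dist S T + hausdorff_dist T U"
      using ST(1) TU(1) * by metis
    moreover have "\<forall>C\<in>U. \<exists>A\<in>S. op_norm (A - C) \<le> hausdorff_dist S T + hausdorff_dist T U"
      using ST(2) TU(2) * by metis
    ultimately show ?thesis
      using hausdorff_dist_le_iff[of S U] S U by (auto simp: compact_GL_def)
  qed
  thus "GL_dist S U \<le> GL_dist S T + GL_dist T U"
    using S T U by (simp add: GL_dist_def)
qed


section \<open>Lower spectral radius\<close>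

text \<open>\<open>products n S\<close> is the set of all \<open>A\<^sub>n ** \<dots> ** A\<^sub>1\<close> with all factors in \<open>S\<close>.\<close>

primrec products :: "nat \<Rightarrow> (real^'n^'n) set \<Rightarrow> (real^'n^'n) set" where
  "products 0 S = {mat 1}"
| "products (Suc n) S = {A ** P | A P. A \<in> S \<and> P \<in> products n S}"

definition lower_spectral_radius :: "(real^'n^'n) set \<Rightarrow> real" where
  "lower_spectral_radius S = lim (\<lambda>n. INF P\<in>products n S. root n (op_norm P))"

lemma products_nonempty: "S \<noteq> {} \<Longrightarrow> products n S \<noteq> {}"
  by (induction n) auto

lemma products_mult:
  "P \<in> products m S \<Longrightarrow> Q \<in> products n S \<Longrightarrow> P ** Q \<in> products (m + n) S"
proof (induction m arbitrary: P)
  case (Suc m)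
  then obtain A P' where "A \<in> S" "P' \<in> products m S" "P = A ** P'" by auto
  thus ?case using Suc.IH[of P'] Suc.prems
    by (auto simp: matrix_mul_assoc[symmetric])
qed simp

lemma root_tendsto_Inf_of_submultiplicative:
  fixes a :: "nat \<Rightarrow> real"
  assumes nonneg: "\<And>n. 0 \<le> a n" and sub: "\<And>m n. a (m + n) \<le> a m * a n"
  shows "(\<lambda>n. root n (a n)) \<longlonglongrightarrow> (INF n\<in>{1..}. root n (a n))"
proof -
  define L where "L = (INF n\<in>{1..}. root n (a n))"
  have bdd: "bdd_below ((\<lambda>n. root n (a n)) ` {1..})"
    by (rule bdd_belowI2[of _ 0]) (simp add: nonneg)
  have L_le: "L \<le> root n (a n)" if "n \<ge> 1" for n
    unfolding L_def using that bdd by (intro cINF_lower) auto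
  have L0: "0 \<le> L" unfolding L_def by (rule cINF_greatest) (auto simp: nonneg)
  have upper: "eventually (\<lambda>n. root n (a n) < L + e) sequentially" if "e > 0" for e
  proof -
    define c where "c = L + e / 2"
    have c: "c > 0" "c < L + e" using that L0 by (auto simp: c_def)
    have "(INF n\<in>{1..}. root n (a n)) < c" using that by (simp add: c_def L_def)
    then obtain m where m: "m \<ge> 1" "root m (a m) < c"
      by (subst (asm) cINF_less_iff) (use bdd in auto)
    have am: "a m \<le> c ^ m"
      using m nonneg[of m] power_mono[of "root m (a m)" c m] by (simp add: real_root_pow_pos2)
    define K where "K = 1 + (\<Sum>r<m. a r / c ^ r)"
    have K: "K \<ge> 1" unfolding K_def using nonneg c by (auto intro!: sum_nonneg)
    have aK: "a n \<le> K * c ^ n" for n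
    proof (induction n rule: less_induct)
      case (less n)
      show ?case
      proof (cases "n < m")
        case True
        hence "a n / c ^ n \<le> (\<Sum>r<m. a r / c ^ r)"
          by (intro member_le_sum) (use nonneg c in auto)
        hence "a n / c ^ n \<le> K" by (simp add: K_def)
        thus ?thesis using c by (simp add: divide_simps)
      next
        case False
        hence "a n \<le> a m * a (n - m)" using sub[of m "n - m"] by simp
        also have "\<dots> \<le> c ^ m * (K * c ^ (n - m))"
          using less[of "n - m"] False m am nonneg c by (intro mult_mono) auto
        also have "\<dots> = K * c ^ n" using False by (simp add: power_add[symmetric])
        finally show ?thesis .
      qed
    qed
    have "(\<lambda>n. root n K * c) \<longlonglongrightarrow> 1 * c"
      using K by (intro tendsto_mult LIMSEQ_root_const tendsto_const) auto
    hence "eventually (\<lambda>n. root n K * c < L + e) sequentially"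
      using c by (auto simp: order_tendsto_iff)
    thus ?thesis using eventually_ge_at_top[of 1]
    proof eventually_elim
      case (elim n)
      have "root n (a n) \<le> root n (K * c ^ n)" using elim aK by simp
      also have "\<dots> = root n K * c" using elim c by (simp add: real_root_mult real_root_power_cancel)
      finally show ?case using elim by simp
    qed
  qed
  show ?thesis unfolding L_def[symmetric]
  proof (rule order_tendstoI)
    fix x assume "x < L"
    show "eventually (\<lambda>n. x < root n (a n)) sequentially"
      using eventually_ge_at_top[of 1]
      by eventually_elim (use L_le \<open>x < L\<close> in force)
  next
    fix x assume "L < x"
    thus "eventually (\<lambda>n. root n (a n) < x) sequentially" using upper[of "x - L"] by simp
  qed
qed

text \<open>The limit exists and equals the infimum.\<close>

lemma
  fixes S :: "(real^'n^'n) set"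
  assumes "S \<noteq> {}"
  shows lower_spectral_radius_LIMSEQ:
      "(\<lambda>n. INF P\<in>products n S. root n (op_norm P)) \<longlonglongrightarrow> lower_spectral_radius S"
    and lower_spectral_radius_eq_INF:
      "lower_spectral_radius S = (INF n\<in>{1..}. INF P\<in>products n S. root n (op_norm P))"
proof -
  define a where "a n = (INF P\<in>products n S. op_norm P)" for n
  have bdd: "bdd_below (op_norm ` X)" for X :: "(real^'n^'n) set"
    by (rule bdd_belowI2[of _ 0]) (rule op_norm_nonneg)
  note ne = products_nonempty[OF assms]
  have nonneg: "0 \<le> a n" for n
    unfolding a_def by (rule cINF_greatest[OF ne]) (rule op_norm_nonneg)
  have approx: "\<exists>P\<in>products n S. op_norm P < a n + e" if "e > 0" for n e
    using cINF_less_iff[OF ne bdd, of n "a n + e"] that by (simp add: a_def)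
  have sub: "a (m + n) \<le> a m * a n" for m n
  proof -
    have le: "a (m + n) \<le> (a m + e) * (a n + e)" if e: "e > 0" for e
    proof -
      obtain P Q where PQ: "P \<in> products m S" "op_norm P < a m + e" "Q \<in> products n S" "op_norm Q < a n + e"
        using approx[OF e, where n = m] approx[OF e, where n = n] by blast
      have "a (m + n) \<le> op_norm (P ** Q)"
        unfolding a_def by (rule cINF_lower[OF bdd products_mult]) (use PQ in auto)
      also have "\<dots> \<le> op_norm P * op_norm Q" by (rule op_norm_mult)
      also have "\<dots> \<le> (a m + e) * (a n + e)"
        using PQ op_norm_nonneg[of P] op_norm_nonneg[of Q] by (intro mult_mono) auto
      finally show ?thesis .
    qed
    have "((\<lambda>e. (a m + e) * (a n + e)) \<longlongrightarrow> (a m + 0) * (a n + 0)) (at_right 0)"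
      by (intro tendsto_intros)
    hence "a (m + n) \<le> (a m + 0) * (a n + 0)"
      by (rule tendsto_lowerbound)
        (auto simp: eventually_at_right_less intro: le eventually_mono[OF eventually_at_right_less])
    thus ?thesis by simp
  qed
  have eq: "(INF P\<in>products n S. root n (op_norm P)) = root n (a n)" if "n \<ge> 1" for n
  proof (rule antisym)
    have bdd': "bdd_below ((\<lambda>P. root n (op_norm P)) ` products n S)"
      by (rule bdd_belowI2[of _ 0]) (use that in \<open>simp add: op_norm_nonneg\<close>)
    have "(INF P\<in>products n S. root n (op_norm P)) ^ n \<le> a n"
      unfolding a_def
    proof (rule cINF_greatest[OF ne])
      fix P assume P: "P \<in> products n S"
      have "0 \<le> (INF P\<in>products n S. root n (op_norm P))"
        by (rule cINF_greatest[OF ne]) (use that in \<open>simp add: op_norm_nonneg\<close>)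
      moreover have "(INF P\<in>products n S. root n (op_norm P)) \<le> root n (op_norm P)"
        by (rule cINF_lower[OF bdd' P])
      ultimately have "(INF P\<in>products n S. root n (op_norm P)) ^ n \<le> root n (op_norm P) ^ n"
        by (intro power_mono)
      thus "(INF P\<in>products n S. root n (op_norm P)) ^ n \<le> op_norm P"
        using that op_norm_nonneg[of P] by (simp add: real_root_pow_pos2)
    qed
    moreover have "0 \<le> (INF P\<in>products n S. root n (op_norm P))"
      by (rule cINF_greatest[OF ne]) (use that in \<open>simp add: op_norm_nonneg\<close>)
    ultimately show "(INF P\<in>products n S. root n (op_norm P)) \<le> root n (a n)"
      using that by (metis Suc_le_eq One_nat_def real_root_le_iff real_root_power_cancel)
  next
    show "root n (a n) \<le> (INF P\<in>products n S. root n (op_norm P))"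
    proof (rule cINF_greatest[OF ne])
      fix P assume "P \<in> products n S"
      hence "a n \<le> op_norm P" unfolding a_def by (rule cINF_lower[OF bdd])
      thus "root n (a n) \<le> root n (op_norm P)" using that by simp
    qed
  qed
  have INF_eq: "(INF n\<in>{1..}. root n (a n)) = (INF n\<in>{1..}. INF P\<in>products n S. root n (op_norm P))"
    by (intro INF_cong) (auto simp: eq)
  have "(\<lambda>n. root n (a n)) \<longlonglongrightarrow> (INF n\<in>{1..}. root n (a n))"
    by (rule root_tendsto_Inf_of_submultiplicative[OF nonneg sub])
  hence lim: "(\<lambda>n. INF P\<in>products n S. root n (op_norm P)) \<longlonglongrightarrow>
      (INF n\<in>{1..}. INF P\<in>products n S. root n (op_norm P))"
    unfolding INF_eq by (rule Lim_transform_eventually)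
      (use eventually_ge_at_top[of 1] in \<open>eventually_elim, simp add: eq\<close>)
  show "lower_spectral_radius S = (INF n\<in>{1..}. INF P\<in>products n S. root n (op_norm P))"
    unfolding lower_spectral_radius_def by (rule limI[OF lim])
  thus "(\<lambda>n. INF P\<in>products n S. root n (op_norm P)) \<longlonglongrightarrow> lower_spectral_radius S"
    using lim by simp
qed


section \<open>Exterior powers\<close>

text \<open>The exterior algebra of \<open>real^'n\<close> is identified with \<open>real^('n set)\<close>: the standard basis
  vector \<open>axis T 1\<close> stands for \<open>e\<^bsub>t\<^sub>0\<^esub> \<and> \<dots> \<and> e\<^bsub>t\<^sub>k\<^sub>-\<^sub>1\<^esub>\<close>, where the elements \<open>t\<^sub>0, \<dots>, t\<^sub>k\<^sub>-\<^sub>1\<close> of \<open>T\<close> are listed in a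
  fixed order (which only affects the sign of the basis vector). The \<open>k\<close>th exterior power is the
  subspace spanned by the \<open>axis T 1\<close> with \<open>card T = k\<close>, and the \<open>axis T 1\<close> are orthonormal.\<close>

definition elems :: "'n::finite set \<Rightarrow> 'n list" where
  "elems T = map from_nat (sorted_list_of_set (to_nat ` T))"

text \<open>\<open>wedge k v\<close> is \<open>v\<^sub>0 \<and> \<dots> \<and> v\<^sub>k\<^sub>-\<^sub>1\<close>; its coordinates are the \<open>k \<times> k\<close> minors of the matrix with
  columns \<open>v\<^sub>0, \<dots>, v\<^sub>k\<^sub>-\<^sub>1\<close>.\<close>

definition wedge :: "nat \<Rightarrow> (nat \<Rightarrow> real^'n) \<Rightarrow> real^('n set)" where
  "wedge k v = (\<chi> T. if card T = k
     then \<Sum>p | p permutes {..<k}. of_int (sign p) * (\<Prod>i<k. v (p i) $ (elems T ! i)) else 0)"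

text \<open>\<open>ext_power k A\<close> maps \<open>e\<^bsub>t\<^sub>0\<^esub> \<and> \<dots> \<and> e\<^bsub>t\<^sub>k\<^sub>-\<^sub>1\<^esub>\<close> to \<open>A e\<^bsub>t\<^sub>0\<^esub> \<and> \<dots> \<and> A e\<^bsub>t\<^sub>k\<^sub>-\<^sub>1\<^esub>\<close>, and is extended by zero to the
  exterior powers of degree other than \<open>k\<close>; since both the \<open>k\<close>th exterior power and its orthogonal
  complement are invariant, this does not change norms of (nonempty) products.\<close>

definition ext_power :: "nat \<Rightarrow> real^'n^'n \<Rightarrow> real^('n set)^('n set)" where
  "ext_power k A = (\<chi> S T. if card T = k
     then wedge k (\<lambda>j. A *v axis (elems T ! j) 1) $ S else 0)"

lemma elems: "set (elems T) = T" "distinct (elems T)" "length (elems T) = card T"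
proof -
  have "inj_on (from_nat :: nat \<Rightarrow> 'a) (to_nat ` T)" by (auto intro!: inj_onI)
  thus "set (elems T) = T" "distinct (elems T)" "length (elems T) = card T"
    by (simp_all add: elems_def distinct_map image_image card_image)
qed

lemma ext_power_component:
  "card S = k \<Longrightarrow> card T = k \<Longrightarrow> ext_power k A $ S $ T =
     (\<Sum>p | p permutes {..<k}. of_int (sign p) * (\<Prod>i<k. A $ (elems S ! i) $ (elems T ! p i)))"
  by (simp add: ext_power_def wedge_def matrix_vector_mul_component inner_axis)

lemma wedge_axis:
  assumes "card T = k"
  shows "wedge k (\<lambda>j. axis (elems T ! j) 1) = axis T 1"
proof -
  have "(\<Sum>p | p permutes {..<k}. of_int (sign p) *
          (\<Prod>i<k. axis (elems T ! p i) (1::real) $ (elems S ! i))) = axis T 1 $ S"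
    (is "(\<Sum>p | _. ?f p) = _") if S: "card S = k" for S
  proof (cases "S = T")
    case True
    have "?f p = (if p = id then 1 else 0)" if p: "p permutes {..<k}" for p
    proof (cases "p = id")
      case False
      then obtain i where i: "p i \<noteq> i" by (auto simp: fun_eq_iff)
      hence ik: "i < k" using p by (auto simp: permutes_def)
      moreover have "p i < k" using permutes_in_image[OF p, of i] ik by simp
      ultimately have "elems T ! p i \<noteq> elems T ! i"
        using i elems[of T] assms by (simp add: nth_eq_iff_index_eq)
      hence "(\<Prod>i<k. axis (elems T ! p i) (1::real) $ (elems S ! i)) = 0"
        using ik True by (intro prod_zero bexI[of _ i]) (auto simp: axis_def)
      thus ?thesis using False by simp
    qed (simp add: True axis_def)
    hence "(\<Sum>p | p permutes {..<k}. ?f p) = (\<Sum>p | p permutes {..<k}. if p = id then 1 else 0)"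
      by (intro sum.cong) auto
    also have "\<dots> = 1" by (simp add: finite_permutations permutes_id)
    finally show ?thesis using True by (simp add: axis_def)
  next
    case False
    have "?f p = 0" if p: "p permutes {..<k}" for p
    proof -
      have "\<not> S \<subseteq> T" using False S assms card_subset_eq[of T S] by auto
      then obtain s where s: "s \<in> S" "s \<notin> T" by auto
      then obtain i where i: "i < k" "s = elems S ! i"
        using elems[of S] S by (metis in_set_conv_nth)
      have "elems T ! p i \<in> T"
        using i p elems[of T] assms by (metis lessThan_iff nth_mem permutes_in_image)
      hence "(\<Prod>i<k. axis (elems T ! p i) (1::real) $ (elems S ! i)) = 0"
        using i s by (intro prod_zero bexI[of _ i]) (auto simp: axis_def)
      thus ?thesis by simp
    qed
    hence "(\<Sum>p | p permutes {..<k}. ?f p) = 0" by (intro sum.neutral) blast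
    thus ?thesis using False by (simp add: axis_def)
  qed
  thus ?thesis using assms by (auto simp: wedge_def vec_eq_iff axis_def)
qed

theorem ext_power_wedge:
  fixes A :: "real^'n^'n"
  shows "ext_power k A *v wedge k v = wedge k (\<lambda>j. A *v v j)"
proof -
  have "(\<Sum>T\<in>UNIV. ext_power k A $ S $ T * wedge k v $ T) = wedge k (\<lambda>j. A *v v j) $ S" for S
  proof (cases "card S = k")
    case False
    thus ?thesis by (auto simp: ext_power_def wedge_def intro!: sum.neutral)
  next
    case S: True
    define E where "E = ({..<k} \<rightarrow>\<^sub>E (UNIV :: 'n set))"
    define I where "I = {f\<in>E. inj_on f {..<k}}"
    define P where "P = {p. p permutes {..<k}}"
    define J where "J = Sigma {T :: 'n set. card T = k} (\<lambda>_. P)"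
    define h where "h = (\<lambda>(T :: 'n set, q). \<lambda>i\<in>{..<k}. elems T ! q i)"
    define c where "c f = (\<Prod>i<k. A $ (elems S ! i) $ f i)" for f
    define D where "D f = (\<Sum>p\<in>P. of_int (sign p) * (\<Prod>i<k. v (p i) $ f i))" for f :: "nat \<Rightarrow> 'n"
    have finE: "finite E" and finP: "finite P"
      by (simp_all add: E_def P_def finite_PiE finite_permutations)
    have Pperm: "permutation p" if "p \<in> P" for p
      using that by (auto simp: P_def permutation_permutes)

    have D_cong: "D f = D g" if "\<And>i. i < k \<Longrightarrow> f i = g i" for f g
      unfolding D_def using that by (intro sum.cong prod.cong arg_cong2[where f = "(*)"]) auto
    have D_right: "D (\<lambda>i. f (q i)) = of_int (sign q) * D f" if q: "q \<in> P" for f q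
    proof -
      have q': "q permutes {..<k}" using q by (simp add: P_def)
      have "D (\<lambda>i. f (q i)) = (\<Sum>p\<in>P. of_int (sign (p \<circ> q)) * (\<Prod>i<k. v (p (q i)) $ f (q i)))"
        unfolding D_def P_def by (subst sum_permutations_compose_right[OF q']) simp
      also have "\<dots> = (\<Sum>p\<in>P. of_int (sign q) * (of_int (sign p) * (\<Prod>i<k. v (p i) $ f i)))"
      proof (intro sum.cong refl)
        fix p assume p: "p \<in> P"
        have "(\<Prod>i<k. v (p (q i)) $ f (q i)) = (\<Prod>i<k. v (p i) $ f i)"
          using prod.permute[OF q', of "\<lambda>i. v (p i) $ f i"] by (simp add: o_def)
        thus "of_int (sign (p \<circ> q)) * (\<Prod>i<k. v (p (q i)) $ f (q i)) =
            of_int (sign q) * (of_int (sign p) * (\<Prod>i<k. v (p i) $ f i))"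
          using sign_compose[OF Pperm[OF p] Pperm[OF q]] by simp
      qed
      finally show ?thesis by (simp add: D_def sum_distrib_left)
    qed
    have D_noninj: "D f = 0" if f: "\<not> inj_on f {..<k}" for f
    proof -
      obtain a b where ab: "a < k" "b < k" "a \<noteq> b" "f a = f b"
        using f by (auto simp: inj_on_def)
      have t: "Transposition.transpose a b \<in> P" using ab by (auto simp: P_def intro: permutes_swap_id)
      have "D f = D (\<lambda>i. f (Transposition.transpose a b i))"
        using ab by (intro D_cong) (auto simp: Transposition.transpose_def)
      also have "\<dots> = - D f" using D_right[OF t, of f] ab by (simp add: sign_swap_id)
      finally show ?thesis by simp
    qed

    have bij: "bij_betw h J I"
      unfolding bij_betw_def
    proof
      show inj: "inj_on h J"
      proof (rule inj_onI, clarify)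
        fix T q T' q' assume J: "(T, q) \<in> J" "(T', q') \<in> J" and eq: "h (T, q) = h (T', q')"
        have im: "h (T, q) ` {..<k} = T" if "(T, q) \<in> J" for T q
        proof -
          have "h (T, q) ` {..<k} = (!) (elems T) ` (q ` {..<k})"
            by (auto simp: h_def image_image)
          also have "q ` {..<k} = {..<k}" using that by (simp add: J_def P_def permutes_image)
          also have "(!) (elems T) ` {..<k} = T"
            using that elems[of T] by (auto simp: J_def set_conv_nth)
          finally show ?thesis .
        qed
        have T: "T = T'" using im[OF J(1)] im[OF J(2)] eq by simp
        have "q i = q' i" for i
        proof (cases "i < k")
          case True
          have "elems T ! q i = elems T ! q' i" using fun_cong[OF eq, of i] T True by (simp add: h_def)
          moreover have "q i < k" "q' i < k"
            using J True permutes_in_image[of q "{..<k}" i] permutes_in_image[of q' "{..<k}" i]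
            by (auto simp: J_def P_def)
          ultimately show ?thesis
            using elems[of T] J by (auto simp: J_def nth_eq_iff_index_eq)
        next
          case False
          thus ?thesis using J by (auto simp: J_def P_def permutes_def)
        qed
        thus "T = T' \<and> q = q'" using T by auto
      qed
      show "h ` J = I"
      proof (intro equalityI subsetI)
        fix f assume "f \<in> h ` J"
        then obtain T q where Tq: "card T = k" "q permutes {..<k}" "f = h (T, q)"
          by (auto simp: J_def P_def)
        have "inj_on f {..<k}"
        proof (rule inj_onI)
          fix i j assume ij: "i \<in> {..<k}" "j \<in> {..<k}" "f i = f j"
          hence "elems T ! q i = elems T ! q j" using Tq by (simp add: h_def)
          moreover have "q i < k" "q j < k" using ij permutes_in_image[OF Tq(2), of i] permutes_in_image[OF Tq(2), of j] by auto
          ultimately have "q i = q j" using elems[of T] Tq by (simp add: nth_eq_iff_index_eq)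
          thus "i = j" using Tq by (meson injD permutes_inj)
        qed
        thus "f \<in> I" using Tq by (auto simp: I_def E_def h_def)
      next
        fix f assume f: "f \<in> I"
        define T where "T = f ` {..<k}"
        have cT: "card T = k" using f by (simp add: T_def I_def card_image)
        have fT: "bij_betw f {..<k} T" using f by (simp add: T_def I_def bij_betw_def)
        have eT: "bij_betw ((!) (elems T)) {..<k} T"
          using elems[of T] cT by (intro bij_betw_nth) auto
        define q where "q i = (if i < k then the_inv_into {..<k} ((!) (elems T)) (f i) else i)" for i
        have "bij_betw (the_inv_into {..<k} ((!) (elems T)) \<circ> f) {..<k} {..<k}"
          using bij_betw_trans[OF fT bij_betw_the_inv_into[OF eT]] .
        hence "bij_betw q {..<k} {..<k}"
          by (subst bij_betw_cong[of _ q "the_inv_into {..<k} ((!) (elems T)) \<circ> f"])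
            (auto simp: q_def)
        hence "q permutes {..<k}" by (rule bij_imp_permutes) (simp add: q_def)
        moreover have "h (T, q) = f"
        proof
          fix i
          show "h (T, q) i = f i"
          proof (cases "i < k")
            case True
            hence "f i \<in> T" by (simp add: T_def)
            hence "elems T ! (the_inv_into {..<k} ((!) (elems T)) (f i)) = f i"
              using f_the_inv_into_f_bij_betw[OF eT] by blast
            thus ?thesis using True by (simp add: h_def q_def)
          next
            case False
            thus ?thesis using f by (auto simp: h_def I_def E_def PiE_def extensional_def)
          qed
        qed
        ultimately show "f \<in> h ` J" using cT by (auto simp: J_def P_def intro!: image_eqI[of _ _ "(T, q)"])
      qed
    qed

    have "wedge k (\<lambda>j. A *v v j) $ S =
        (\<Sum>p\<in>P. of_int (sign p) * (\<Prod>i<k. \<Sum>m\<in>UNIV. A $ (elems S ! i) $ m * v (p i) $ m))"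
      using S by (simp add: wedge_def P_def matrix_vector_mult_def)
    also have "\<dots> = (\<Sum>p\<in>P. of_int (sign p) *
        (\<Sum>f\<in>E. \<Prod>i<k. A $ (elems S ! i) $ f i * v (p i) $ f i))"
      unfolding E_def by (subst prod_sum_PiE) auto
    also have "\<dots> = (\<Sum>p\<in>P. \<Sum>f\<in>E. c f * (of_int (sign p) * (\<Prod>i<k. v (p i) $ f i)))"
      by (simp add: sum_distrib_left prod.distrib c_def mult_ac)
    also have "\<dots> = (\<Sum>f\<in>E. c f * D f)"
      unfolding D_def by (subst sum.swap) (simp add: sum_distrib_left)
    also have "\<dots> = (\<Sum>f\<in>I. c f * D f)"
      using finE by (intro sum.mono_neutral_right) (auto simp: I_def D_noninj)
    also have "\<dots> = (\<Sum>x\<in>J. c (h x) * D (h x))"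
      by (rule sum.reindex_bij_betw[OF bij, symmetric])
    also have "\<dots> = (\<Sum>T | card T = k. \<Sum>q\<in>P. c (h (T, q)) * D (h (T, q)))"
      unfolding J_def using finP by (subst sum.Sigma) auto
    also have "\<dots> = (\<Sum>T | card T = k. ext_power k A $ S $ T * wedge k v $ T)"
    proof (intro sum.cong refl)
      fix T :: "'n set" assume "T \<in> {T. card T = k}"
      hence T: "card T = k" by simp
      have D: "D (h (T, q)) = of_int (sign q) * wedge k v $ T" if q: "q \<in> P" for q
      proof -
        have "D (h (T, q)) = D (\<lambda>i. elems T ! q i)" by (intro D_cong) (simp add: h_def)
        also have "\<dots> = of_int (sign q) * D ((!) (elems T))" by (rule D_right[OF q])
        also have "D ((!) (elems T)) = wedge k v $ T" using T by (simp add: D_def wedge_def P_def)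
        finally show ?thesis .
      qed
      have "(\<Sum>q\<in>P. c (h (T, q)) * D (h (T, q))) =
          (\<Sum>q\<in>P. of_int (sign q) * (\<Prod>i<k. A $ (elems S ! i) $ (elems T ! q i)) * wedge k v $ T)"
        by (intro sum.cong refl) (simp add: D, simp add: c_def h_def)
      thus "(\<Sum>q\<in>P. c (h (T, q)) * D (h (T, q))) = ext_power k A $ S $ T * wedge k v $ T"
        using S T by (simp add: ext_power_component P_def sum_distrib_right)
    qed
    also have "\<dots> = (\<Sum>T\<in>UNIV. ext_power k A $ S $ T * wedge k v $ T)"
      by (intro sum.mono_neutral_left) (auto simp: ext_power_def)
    finally show ?thesis by simp
  qed
  thus ?thesis by (simp add: vec_eq_iff matrix_vector_mult_def)
qed


section \<open>Domination\<close>

definition char_polynomial :: "real^'n^'n \<Rightarrow> real poly" where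
  "char_polynomial M = det (\<chi> i j. (if i = j then [:0, 1:] else 0) - [:M $ i $ j:])"

text \<open>The singular values in decreasing order, repeated according to multiplicity.\<close>

definition singular_values :: "real^'n^'n \<Rightarrow> real list" where
  "singular_values A =
     rev (sorted_list_of_multiset (image_mset sqrt (proots (char_polynomial (transpose A ** A)))))"

definition singular_value :: "nat \<Rightarrow> real^'n^'n \<Rightarrow> real" where
  "singular_value k A = singular_values A ! (k - 1)"

definition dominated :: "nat \<Rightarrow> (real^'n^'n) set \<Rightarrow> bool" where
  "dominated k S \<longleftrightarrow> k = CARD('n) \<or>
     (1 \<le> k \<and> k < CARD('n) \<and>
      (\<exists>C>1. \<exists>\<tau>\<in>{0<..<1}. \<forall>n\<ge>1. \<forall>P\<in>products n S.
         singular_value (k + 1) P / singular_value k P \<le> C * \<tau> ^ n))"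

definition min_domination_index :: "(real^'n^'n) set \<Rightarrow> nat" where
  "min_domination_index S = Min {k \<in> {1..CARD('n)}. dominated k S}"

end

theory Submission
  imports Defs
begin

text \<open>
  Write \<open>d\<close> for the dimension, \<open>vol k X\<close> for the norm of the \<open>k\<close>th exterior power of \<open>X\<close> (the product of the \<open>k\<close> largest singular values) and \<open>gap k X\<close> for the quotient of the singular
  values number \<open>k + 1\<close> and \<open>k\<close>. Let \<open>l\<close> be the smallest index of domination of \<open>S\<close>. Two facts combine
  to the formula: the growth rate of \<open>vol l\<close> is lower semicontinuous at \<open>S\<close>, and for arbitrarily small
  perturbations of \<open>S\<close> the growth rate of the norm can be brought down to its \<open>l\<close>th root.

  The lower bound rests on almost multiplicativity of volumes. Since \<open>vol l X\<close> is at most the \<open>l\<close>th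
  power of the norm of \<open>X\<close>, it suffices to bound \<open>vol l\<close> from below along products from sets \<open>T\<close> near \<open>S\<close>. If gaps decay exponentially, the most expanded
  direction of the exterior power of \<open>X Y\<close> is exponentially close (in the length of \<open>Y\<close>) to that of \<open>Y\<close>. Hence
  appending a letter on the right changes \<open>vol l (X Y)\<close> and \<open>vol l Y\<close> by nearly the same factor, the
  errors are summable, and \<open>vol l (X Y) \<ge> c * vol l X * vol l Y\<close> with a constant \<open>c\<close> independent of the
  lengths (lemma \<open>almost_multiplicative_decay\<close>). Conversely such an inequality makes the gap
  submultiplicative up to \<open>c\<close>, so exponential decay up to a suitable finite length implies decay for
  all lengths (\<open>gaps_decay_extend\<close>). Decay up to a finite length is an open condition, so \<open>c\<close> works for
  all \<open>T\<close> near \<open>S\<close>. Then the infimum of \<open>vol l\<close> over products of one fixed length controls the growth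
  rate, and this infimum depends continuously on \<open>T\<close>
  (\<open>lower_spectral_radius_lower_semicontinuous\<close>). The index \<open>l = d\<close> needs no separate treatment: there
  \<open>vol (d + 1)\<close> and hence the gap vanish.

  The upper bound rests on the freedom that perturbations have without domination. Let
  \<open>1 \<le> k < l\<close>. As \<open>S\<close> is not \<open>k\<close>-dominated, some word has a gap that is large compared with its length.
  Along this word a vector can be tilted a little towards another one that is stretched not much
  less, and the deviation amplified a little in every step, so that small perturbations of the letters
  carry a vector of any given \<open>k\<close>-dimensional space into any given space of codimension \<open>k\<close>
  (\<open>steering\<close>). Apply this to a long product \<open>P\<close>, with the span of its \<open>k\<close> leading left singular vectors
  and the orthogonal complement of its \<open>k\<close> leading right singular vectors: the connecting word \<open>Q\<close>
  annihilates the leading coefficient of the exterior power of \<open>P Q P\<close>, and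
  \<open>vol k (P Q P) \<le> 2 * vol k Q * (vol (k - 1) P * vol (k + 1) P)\<close> (\<open>vol_sandwich\<close>), while the volumes of
  the other degrees at most get squared, up to a factor depending on \<open>Q\<close>. On the scale of logarithms per letter this replaces the
  value at \<open>k\<close> by the mean of its neighbours. Repeating it for \<open>k = 1, \<dots>, l - 1\<close> relaxes the
  profile \<open>j \<mapsto> ln (vol j)\<close> to the linear one between \<open>j = 0\<close> and \<open>j = l\<close> (\<open>relaxation\<close>), which means
  that the norm grows like the \<open>l\<close>th root of \<open>vol l\<close>. The length of \<open>Q\<close> depends on the size of the
  perturbation but not on \<open>P\<close>, so the connecting words do not contribute to the rate.
\<close>

section \<open>Singular value decomposition\<close>

text \<open>First-order condition: if \<open>f v\<close> and \<open>f w\<close> were not orthogonal, moving \<open>v\<close> slightly along \<open>w\<close> or \<open>- w\<close> would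
  increase the image by a first-order term and the length of \<open>v\<close> only by a second-order one.\<close>

lemma orthogonal_images_of_maximiser:
  fixes f :: "'a::real_inner \<Rightarrow> 'b::real_inner"
  assumes lin: "linear f" and v: "norm v = 1" and w: "orthogonal v w"
    and max: "\<And>t. norm (f (v + t *\<^sub>R w)) \<le> norm (f v) * norm (v + t *\<^sub>R w)"
  shows "orthogonal (f v) (f w)"
proof -
  define c where "c = f v \<bullet> f w"
  define K where "K = (norm (f v))\<^sup>2 * (norm w)\<^sup>2"
  have le: "2 * t * c \<le> K * t\<^sup>2" for t
  proof -
    have "(norm (f (v + t *\<^sub>R w)))\<^sup>2 \<le> (norm (f v) * norm (v + t *\<^sub>R w))\<^sup>2"
      using max by (intro power_mono) auto
    moreover have "(norm (v + t *\<^sub>R w))\<^sup>2 = 1 + t\<^sup>2 * (norm w)\<^sup>2"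
      using v w unfolding power2_norm_eq_inner
      by (simp add: inner_add orthogonal_def inner_commute norm_eq_1 power2_eq_square)
    moreover have "(norm (f (v + t *\<^sub>R w)))\<^sup>2 = (norm (f v))\<^sup>2 + 2 * t * c + t\<^sup>2 * (norm (f w))\<^sup>2"
      unfolding power2_norm_eq_inner linear_add[OF lin] linear_scale[OF lin]
      by (simp add: inner_add c_def inner_commute power2_eq_square algebra_simps)
    ultimately have "2 * t * c + t\<^sup>2 * (norm (f w))\<^sup>2 \<le> K * t\<^sup>2"
      by (simp add: K_def power_mult_distrib algebra_simps)
    moreover have "0 \<le> t\<^sup>2 * (norm (f w))\<^sup>2" by simp
    ultimately show ?thesis by linarith
  qed
  have "K \<ge> 0" by (simp add: K_def)
  \<comment> \<open>essentially the maximiser \<open>c / K\<close> of \<open>2 * t * c - K * t\<^sup>2\<close>, made safe for \<open>K = 0\<close>\<close>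
  have "2 * c\<^sup>2 * (K + 1) \<le> K * c\<^sup>2"
  proof -
    have "2 * c\<^sup>2 * (K + 1) / (K + 1)\<^sup>2 \<le> K * c\<^sup>2 / (K + 1)\<^sup>2"
      using le[of "c / (K + 1)"] \<open>K \<ge> 0\<close> by (simp add: power2_eq_square)
    thus ?thesis using \<open>K \<ge> 0\<close> by (simp add: divide_le_cancel)
  qed
  hence "c\<^sup>2 * (K + 2) \<le> 0" by (simp add: algebra_simps)
  hence "c = 0" using \<open>K \<ge> 0\<close> by (smt (verit) mult_nonneg_nonneg mult_eq_0_iff zero_le_power2 power2_eq_square)
  thus ?thesis by (simp add: orthogonal_def c_def)
qed

text \<open>The right singular vectors of \<open>f\<close>, found greedily: a unit vector \<open>v\<close> with the longest image is split
  off, and by the previous lemma all later vectors have images orthogonal to \<open>f v\<close>.\<close>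

lemma orthonormal_basis_with_orthogonal_images:
  fixes f :: "'a::euclidean_space \<Rightarrow> 'b::real_inner"
  assumes lin: "linear f" and bl: "continuous_on UNIV f" and "subspace S"
  shows "\<exists>B\<subseteq>S. finite B \<and> card B = dim S \<and> (\<forall>x\<in>B. norm x = 1) \<and> pairwise orthogonal B \<and>
    pairwise (\<lambda>x y. orthogonal (f x) (f y)) B"
  using \<open>subspace S\<close>
proof (induction "dim S" arbitrary: S)
  case 0
  thus ?case by (intro exI[of _ "{}"]) auto
next
  case (Suc n)
  have ne: "S \<inter> sphere 0 1 \<noteq> {}"
  proof -
    obtain x where "x \<in> S" "x \<noteq> 0" using Suc.hyps(2) by (metis Zero_not_Suc dim_eq_0 insert_iff subsetI)
    hence "x /\<^sub>R norm x \<in> S \<inter> sphere 0 1" using Suc.prems by (auto simp: subspace_scale)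
    thus ?thesis by blast
  qed
  have "compact (S \<inter> sphere 0 1)" using Suc.prems by (intro closed_Int_compact closed_subspace) auto
  moreover have "continuous_on (S \<inter> sphere 0 1) (\<lambda>x. norm (f x))"
    by (intro continuous_intros continuous_on_subset[OF bl]) auto
  ultimately obtain v where v: "v \<in> S" "norm v = 1"
    and vmax: "\<And>x. x \<in> S \<Longrightarrow> norm x = 1 \<Longrightarrow> norm (f x) \<le> norm (f v)"
    using continuous_attains_sup[of "S \<inter> sphere 0 1" "\<lambda>x. norm (f x)"] ne
    by (metis IntE IntI mem_sphere_0)
  have max: "norm (f x) \<le> norm (f v) * norm x" if "x \<in> S" for x
  proof (cases "x = 0")
    case True thus ?thesis using linear_0[OF lin] by simp
  next
    case False
    have "norm (f (x /\<^sub>R norm x)) \<le> norm (f v)"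
      using that Suc.prems False by (intro vmax) (auto simp: subspace_scale)
    thus ?thesis using False by (simp add: linear_scale[OF lin] field_simps)
  qed
  define S' where "S' = {y \<in> S. \<forall>x \<in> span {v}. orthogonal x y}"
  have S': "S' = {y \<in> S. orthogonal v y}"
    using v by (auto simp: S'_def span_singleton orthogonal_clauses dest: spec[of _ 1])
  have "dim S' + dim (span {v}) = dim S"
    unfolding S'_def using Suc.prems v by (intro dim_subspace_orthogonal_to_vectors span_minimal) auto
  moreover have "dim (span {v}) = 1" using v by (simp add: dim_singleton) auto
  ultimately have dim: "dim S' = n" using Suc.hyps(2) by simp
  have "subspace S'"
    using Suc.prems unfolding S' subspace_def by (auto simp: orthogonal_clauses)
  then obtain B where B: "B \<subseteq> S'" "finite B" "card B = n" "\<forall>x\<in>B. norm x = 1"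
      "pairwise orthogonal B" "pairwise (\<lambda>x y. orthogonal (f x) (f y)) B"
    using Suc.hyps(1)[of S'] dim by auto
  have "v \<notin> B" using B(1) v by (auto simp: S' orthogonal_def norm_eq_1)
  have "orthogonal (f v) (f w)" if "w \<in> B" for w
    using that B(1) v Suc.prems
    by (intro orthogonal_images_of_maximiser[OF lin] max) (auto simp: S' subspace_add subspace_scale)
  moreover have "orthogonal v w" if "w \<in> B" for w using that B(1) by (auto simp: S')
  ultimately have "pairwise orthogonal (insert v B)"
      "pairwise (\<lambda>x y. orthogonal (f x) (f y)) (insert v B)"
    using B by (auto simp: pairwise_insert orthogonal_commute)
  thus ?case using B v \<open>v \<notin> B\<close> Suc.hyps(2)
    by (intro exI[of _ "insert v B"]) (auto simp: S')
qed

text \<open>The matrices \<open>X\<close>, \<open>W\<close> and \<open>E\<close> have polynomial entries and satisfy \<open>X W = W E\<close>, so their determinants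
  can be compared in the integral domain of polynomials, where \<open>det W\<close> cancels.\<close>

lemma char_polynomial_of_diagonalised:
  fixes M V :: "real^'n^'n"
  assumes V: "orthogonal_matrix V" and eig: "\<And>i. M *v column i V = l i *\<^sub>R column i V"
  shows "char_polynomial M = (\<Prod>i\<in>UNIV. [:- l i, 1:])"
proof -
  define X where "X = (\<chi> i j. (if i = j then [:0, 1:] else 0) - [:M $ i $ j:])"
  define W where "W = (\<chi> i j. [:V $ i $ j:])"
  define W' where "W' = (\<chi> i j. [:V $ j $ i:])"
  define E where "E = (\<chi> i j. if i = j then [:- l i, 1:] else 0)"
  have sum_const: "(\<Sum>k\<in>A. [:g k:]) = [:sum g A:]" for g :: "'n \<Rightarrow> real" and A
    by (induction A rule: infinite_finite_induct) auto
  have "W' ** W = mat 1"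
  proof -
    have "(\<Sum>k\<in>UNIV. V $ k $ i * V $ k $ j) = (if i = j then 1 else 0)" for i j
      using V[unfolded orthogonal_matrix]
      by (simp add: vec_eq_iff matrix_matrix_mult_def transpose_def mat_def)
    thus ?thesis
      by (auto simp: vec_eq_iff matrix_matrix_mult_def W_def W'_def mat_def sum_const one_pCons)
  qed
  hence "det W' * det W = 1" by (metis det_mul det_I)
  hence W0: "det W \<noteq> 0" by auto
  have "X ** W = W ** E"
  proof -
    have "(\<Sum>k\<in>UNIV. M $ i $ k * V $ k $ j) = l j * V $ i $ j" for i j
      using eig[of j] by (simp add: vec_eq_iff matrix_vector_mult_def column_def)
    hence "(\<Sum>k\<in>UNIV. [:M $ i $ k:] * [:V $ k $ j:]) = [:l j * V $ i $ j:]" for i j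
      by (simp add: sum_const mult.commute)
    hence "(X ** W) $ i $ j = [:0, 1:] * [:V $ i $ j:] - [:l j * V $ i $ j:]" for i j
      by (simp only: matrix_matrix_mult_def X_def W_def vec_lambda_beta left_diff_distrib sum_subtractf)
        (simp add: if_distrib[of "\<lambda>x. x * _"] if_distrib[of "smult _"] cong: if_cong)
    moreover have "(W ** E) $ i $ j = [:V $ i $ j:] * [:- l j, 1:]" for i j
      by (simp only: matrix_matrix_mult_def E_def W_def vec_lambda_beta)
        (simp add: if_distrib[of "smult _"] cong: if_cong)
    ultimately have "(X ** W) $ i $ j = (W ** E) $ i $ j" for i j by simp
    thus ?thesis by (simp add: vec_eq_iff)
  qed
  hence "det X * det W = det W * det E" by (metis det_mul)
  hence "det X = det E" using W0 by simp
  also have "det E = (\<Prod>i\<in>UNIV. [:- l i, 1:])"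
    by (subst det_diagonal) (auto simp: E_def)
  finally show ?thesis by (simp add: char_polynomial_def X_def)
qed

text \<open>The list of singular values is defined through the characteristic polynomial. The enumeration \<open>e\<close>
  matches it with any system of orthonormal eigenvectors, indexed by the type \<open>'n\<close> in no particular
  order.\<close>

lemma singular_values_of_diagonalised:
  fixes A V :: "real^'n^'n"
  assumes V: "orthogonal_matrix V"
    and eig: "\<And>i. (transpose A ** A) *v column i V = (s i)\<^sup>2 *\<^sub>R column i V" and s: "\<And>i. 0 \<le> s i"
  shows "\<exists>e. bij_betw e {..<CARD('n)} UNIV \<and> (\<forall>i<CARD('n). s (e i) = singular_value (i + 1) A) \<and>
    (\<forall>i j. i \<le> j \<longrightarrow> j < CARD('n) \<longrightarrow> s (e j) \<le> s (e i))"
proof -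
  have m: "image_mset sqrt (proots (char_polynomial (transpose A ** A))) = image_mset s (mset_set UNIV)"
  proof -
    have "proots (char_polynomial (transpose A ** A)) = (\<Sum>i\<in>UNIV. {#(s i)\<^sup>2#})"
      unfolding char_polynomial_of_diagonalised[OF V eig] by (subst proots_prod) auto
    also have "image_mset sqrt \<dots> = (\<Sum>i\<in>UNIV. {#s i#})"
    proof -
      have "image_mset sqrt (\<Sum>i\<in>F. {#(s i)\<^sup>2#}) = (\<Sum>i\<in>F. {#s i#})" if "finite F" for F
        using that by induction (auto simp: s real_sqrt_abs abs_of_nonneg)
      thus ?thesis by simp
    qed
    also have "\<dots> = image_mset s (mset_set UNIV)"
    proof -
      have "(\<Sum>i\<in>F. {#s i#}) = image_mset s (mset_set F)" if "finite F" for F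
        using that by induction auto
      thus ?thesis by simp
    qed
    finally show ?thesis .
  qed
  obtain us :: "'n list" where us: "set us = UNIV" "distinct us" using finite_distinct_list[OF finite_class.finite_UNIV] by blast
  define ys where "ys = rev (sort_key s us)"
  have ys: "set ys = UNIV" "distinct ys" by (simp_all add: ys_def us)
  have len: "length ys = CARD('n)" using ys distinct_card by metis
  have "mset (map s us) = image_mset s (mset_set UNIV)"
    using us by (metis mset_map mset_set_set)
  hence "sort (map s us) = sorted_list_of_multiset (image_mset s (mset_set UNIV))"
    by (metis sorted_list_of_multiset_mset)
  moreover have "map s (sort_key s us) = sort (map s us)"
    by (rule properties_for_sort[symmetric]) auto
  ultimately have sv: "singular_values A = map s ys"
    unfolding singular_values_def m ys_def by (simp add: rev_map[symmetric])
  have srt: "sorted (rev (map s ys))" by (simp add: ys_def rev_map)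
  show ?thesis
  proof (intro exI[of _ "\<lambda>i. ys ! i"] conjI allI impI)
    show "bij_betw ((!) ys) {..<CARD('n)} UNIV"
      using ys len by (intro bij_betw_nth) auto
    show "s (ys ! i) = singular_value (i + 1) A" if "i < CARD('n)" for i
      using that len by (simp add: singular_value_def sv)
    show "s (ys ! j) \<le> s (ys ! i)" if "i \<le> j" "j < CARD('n)" for i j
      using that len sorted_rev_nth_mono[OF srt, of i j] by simp
  qed
qed

text \<open>A singular value decomposition whose singular vectors are the columns of \<open>U\<close> and \<open>V\<close>. The index type \<open>'n\<close>
  has no order, so \<open>e\<close> lists the indices by decreasing singular value.\<close>

definition svd :: "real^'n^'n \<Rightarrow> real^'n^'n \<Rightarrow> ('n \<Rightarrow> real) \<Rightarrow> real^'n^'n \<Rightarrow> (nat \<Rightarrow> 'n) \<Rightarrow> bool" where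
  "svd X U s V e \<longleftrightarrow> orthogonal_matrix U \<and> orthogonal_matrix V \<and>
     (\<forall>i. X *v column i V = s i *\<^sub>R column i U) \<and> (\<forall>i. 0 < s i) \<and>
     bij_betw e {..<CARD('n)} UNIV \<and> (\<forall>i<CARD('n). s (e i) = singular_value (i + 1) X) \<and>
     (\<forall>i j. i \<le> j \<longrightarrow> j < CARD('n) \<longrightarrow> s (e j) \<le> s (e i))"

lemma orthogonal_matrix_transpose_column:
  fixes U :: "real^'n^'n"
  assumes "orthogonal_matrix U"
  shows "transpose U *v column i U = axis i 1"
proof -
  have "transpose U *v (U *v axis i 1) = axis i 1"
    using assms by (simp add: orthogonal_matrix matrix_vector_mul_assoc)
  thus ?thesis by (simp add: matrix_vector_mul_component matrix_vector_mult_basis)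
qed

lemma svd_exists:
  fixes X :: "real^'n^'n"
  assumes inv: "invertible X"
  shows "\<exists>U s V e. svd X U s V e"
proof -
  obtain B where B: "finite B" "card B = DIM(real^'n)" "\<forall>x\<in>B. norm x = 1" "pairwise orthogonal B"
      "pairwise (\<lambda>x y. orthogonal (X *v x) (X *v y)) B"
    using orthonormal_basis_with_orthogonal_images[of "(*v) X" "UNIV :: (real^'n) set"]
    by (auto simp: matrix_vector_mult_linear_continuous_on)
  then obtain v where v: "bij_betw v (UNIV :: 'n set) B"
    by (metis finite_same_card_bij finite_class.finite_UNIV DIM_cart DIM_real mult.right_neutral)
  have vB: "v i \<in> B" for i using v by (auto simp: bij_betw_def)
  have vne: "v i \<noteq> v j" if "i \<noteq> j" for i j using v that by (auto simp: bij_betw_def inj_on_def)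
  define s where "s i = norm (X *v v i)" for i
  have X0: "X *v x \<noteq> 0" if "x \<noteq> 0" for x
    using inv that by (metis invertible_def matrix_left_invertible_ker)
  have spos: "s i > 0" for i unfolding s_def using B(3) vB[of i] X0[of "v i"] by force
  define V where "V = (\<chi> a i. v i $ a)"
  define U where "U = (\<chi> a i. (X *v v i) $ a / s i)"
  have colV: "column i V = v i" for i by (simp add: column_def V_def vec_eq_iff)
  have colU: "column i U = (X *v v i) /\<^sub>R s i" for i
    by (simp add: column_def U_def vec_eq_iff divide_inverse mult.commute)
  have oV: "orthogonal_matrix V"
    unfolding orthogonal_matrix_orthonormal_columns colV
    using B(3,4) vB vne by (auto simp: pairwise_def)
  have oU: "orthogonal_matrix U"
    unfolding orthogonal_matrix_orthonormal_columns colU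
  proof (intro conjI allI impI)
    show "norm ((X *v v i) /\<^sub>R s i) = 1" for i using spos[of i] by (simp add: s_def)
    show "orthogonal ((X *v v i) /\<^sub>R s i) ((X *v v j) /\<^sub>R s j)" if "i \<noteq> j" for i j
      using B(5) vB vne[OF that] by (auto simp: pairwise_def orthogonal_clauses)
  qed
  have XV: "X *v column i V = s i *\<^sub>R column i U" for i
    using spos[of i] by (simp add: colV colU)
  define D where "D = (\<chi> i j. if i = j then s i else 0)"
  have tD: "transpose D = D" by (simp add: D_def transpose_def vec_eq_iff)
  have XUV: "X ** V = U ** D"
  proof -
    have "(X ** V) *v axis i 1 = (U ** D) *v axis i 1" for i
    proof -
      have "D *v axis i 1 = s i *\<^sub>R axis i 1"
        unfolding matrix_vector_mult_basis D_def by (simp add: column_def vec_eq_iff axis_def)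
      note diag = this
      show ?thesis
        unfolding matrix_vector_mul_assoc[symmetric] diag
        using XV[of i] by (simp add: matrix_vector_mult_basis matrix_vector_mult_scaleR)
    qed
    hence "column i (X ** V) = column i (U ** D)" for i
      by (simp only: matrix_vector_mult_basis)
    thus ?thesis by (simp add: vec_eq_iff column_def)
  qed
  have eig: "(transpose X ** X) *v column i V = (s i)\<^sup>2 *\<^sub>R column i V" for i
  proof -
    have "transpose V ** transpose X = D ** transpose U"
      using arg_cong[OF XUV, of transpose] by (simp add: matrix_transpose_mul tD)
    hence "V ** (transpose V ** transpose X) = V ** (D ** transpose U)"
      by simp
    hence "transpose X = V ** (D ** transpose U)"
      using oV by (simp add: matrix_mul_assoc orthogonal_matrix_def)
    hence "(transpose X ** X) *v column i V = s i *\<^sub>R (V *v (D *v (transpose U *v column i U)))"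
      using XV[of i] by (simp add: matrix_vector_mul_assoc[symmetric] matrix_vector_mult_scaleR)
    also have "transpose U *v column i U = axis i 1"
      by (rule orthogonal_matrix_transpose_column[OF oU])
    also have "D *v axis i 1 = s i *\<^sub>R axis i 1"
      unfolding matrix_vector_mult_basis D_def by (simp add: column_def vec_eq_iff axis_def)
    finally show ?thesis
      by (simp add: matrix_vector_mult_scaleR matrix_vector_mult_basis power2_eq_square)
  qed
  obtain e where "bij_betw e {..<CARD('n)} (UNIV :: 'n set)" "\<forall>i<CARD('n). s (e i) = singular_value (i + 1) X"
    "\<forall>i j. i \<le> j \<longrightarrow> j < CARD('n) \<longrightarrow> s (e j) \<le> s (e i)"
    using singular_values_of_diagonalised[OF oV eig] spos by (metis less_imp_le)
  thus ?thesis using oU oV XV spos unfolding svd_def by blast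
qed

section \<open>Exterior powers and volume growth\<close>

text \<open>The default simplification rules turn \<open>A *v axis i 1\<close> into a column and \<open>transpose A *v x\<close> into
  \<open>x v* A\<close>, which hides the compositions to which functoriality applies.\<close>

declare transpose_matrix_vector [simp del] matrix_vector_mult_basis [simp del]

lemma matrix_eqI_axis:
  fixes A B :: "real^'n^'m"
  assumes "\<And>i. A *v axis i 1 = B *v axis i 1"
  shows "A = B"
proof -
  have "column i A = column i B" for i using assms by (metis matrix_vector_mult_basis)
  thus ?thesis by (simp add: vec_eq_iff column_def)
qed

lemma ext_power_axis:
  "ext_power k A *v axis T 1 = (if card T = k then wedge k (\<lambda>j. A *v axis (elems T ! j) 1) else 0)"
  unfolding matrix_vector_mult_basis[of "ext_power k A"] by (simp add: column_def ext_power_def vec_eq_iff)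

lemma ext_power_mult: "ext_power k (A ** B) = ext_power k A ** ext_power k (B :: real^'n^'n)"
proof (rule matrix_eqI_axis)
  fix T :: "'n set"
  show "ext_power k (A ** B) *v axis T 1 = (ext_power k A ** ext_power k B) *v axis T 1"
    by (simp add: matrix_vector_mul_assoc[symmetric] ext_power_axis ext_power_wedge)
qed

lemma ext_power_id: "ext_power k (mat 1 :: real^'n^'n) *v axis T 1 = (if card T = k then axis T 1 else 0)"
  by (simp add: ext_power_axis wedge_axis)

text \<open>In coordinates, a minor equals the minor of the transposed matrix; the sum over permutations is
  reindexed by inversion.\<close>

lemma ext_power_transpose: "ext_power k (transpose A) = transpose (ext_power k (A :: real^'n^'n))"
proof -
  have "ext_power k (transpose A) $ S $ T = ext_power k A $ T $ S" for S T
  proof (cases "card S = k \<and> card T = k")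
    case True
    hence S: "card S = k" and T: "card T = k" by auto
    let ?f = "\<lambda>p. of_int (sign p) * (\<Prod>i<k. A $ (elems T ! p i) $ (elems S ! i))"
    have "ext_power k (transpose A) $ S $ T = (\<Sum>p | p permutes {..<k}. ?f p)"
      by (simp add: ext_power_component[OF S T] transpose_def)
    also have "\<dots> = (\<Sum>p | p permutes {..<k}. ?f (inv p))"
      by (rule sum_permutations_inverse)
    also have "\<dots> = (\<Sum>p | p permutes {..<k}. of_int (sign p) * (\<Prod>i<k. A $ (elems T ! i) $ (elems S ! p i)))"
    proof (intro sum.cong refl)
      fix p assume "p \<in> {p. p permutes {..<k}}"
      hence p: "p permutes {..<k}" by simp
      have "(\<Prod>i<k. A $ (elems T ! inv p i) $ (elems S ! i)) =
          (\<Prod>i<k. A $ (elems T ! inv p (p i)) $ (elems S ! p i))"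
        by (subst prod.permute[OF p]) (simp add: o_def)
      also have "\<dots> = (\<Prod>i<k. A $ (elems T ! i) $ (elems S ! p i))"
        using p by (simp add: permutes_inverses)
      finally show "?f (inv p) = of_int (sign p) * (\<Prod>i<k. A $ (elems T ! i) $ (elems S ! p i))"
        using p by (simp add: sign_inverse permutation_permutes[THEN iffD2, of p, OF exI[of _ "{..<k}"]])
    qed
    also have "\<dots> = ext_power k A $ T $ S" by (simp add: ext_power_component[OF T S])
    finally show ?thesis .
  qed (auto simp: ext_power_def wedge_def)
  thus ?thesis by (simp add: vec_eq_iff transpose_def)
qed

lemma wedge_scaleR: "wedge k (\<lambda>j. c j *\<^sub>R v j) = (\<Prod>j<k. c j) *\<^sub>R wedge k v"
proof -
  have "(\<Prod>i<k. (c (p i) *\<^sub>R v (p i)) $ f i) = (\<Prod>j<k. c j) * (\<Prod>i<k. v (p i) $ f i)"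
    if "p permutes {..<k}" for p f
    using prod.permute[OF that, of c] by (simp add: prod.distrib o_def)
  hence "(\<Sum>p | p permutes {..<k}. of_int (sign p) * (\<Prod>i<k. (c (p i) *\<^sub>R v (p i)) $ f i)) =
      (\<Sum>p | p permutes {..<k}. (\<Prod>j<k. c j) * (of_int (sign p) * (\<Prod>i<k. v (p i) $ f i)))" for f
    by (intro sum.cong) auto
  thus ?thesis by (auto simp: wedge_def vec_eq_iff sum_distrib_left)
qed

lemma prod_elems: "card T = k \<Longrightarrow> (\<Prod>j<k. f (elems T ! j)) = (\<Prod>i\<in>T. f i)"
  by (rule prod.reindex_bij_betw) (metis bij_betw_nth elems)

abbreviation ext_col :: "nat \<Rightarrow> real^'n^'n \<Rightarrow> 'n set \<Rightarrow> real^('n set)" where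
  "ext_col k V T \<equiv> ext_power k V *v axis T 1"

lemma ext_col_wedge: "card T = k \<Longrightarrow> ext_col k V T = wedge k (\<lambda>j. column (elems T ! j) V)"
  unfolding ext_power_axis by (simp add: matrix_vector_mult_basis)

lemma ext_power_ext_col:
  fixes X :: "real^'n^'n"
  assumes "\<And>i. X *v column i V = s i *\<^sub>R column i U" and T: "card T = k"
  shows "ext_power k X *v ext_col k V T = (\<Prod>i\<in>T. s i) *\<^sub>R ext_col k U T"
  using assms by (simp add: ext_col_wedge ext_power_wedge wedge_scaleR prod_elems[OF T])

lemma inner_transpose_mult: "x \<bullet> (A *v y) = (transpose A *v x) \<bullet> y" for A :: "real^'n^'m"
  by (simp add: dot_lmul_matrix[symmetric] transpose_matrix_vector)

lemma sum_inner_ext_col: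
  fixes V :: "real^'n^'n"
  shows "(\<Sum>T\<in>UNIV. (ext_col k V T \<bullet> z)\<^sup>2) = z \<bullet> (ext_power k (V ** transpose V) *v z)"
proof -
  have "(transpose (ext_power k V) *v z) $ T = ext_col k V T \<bullet> z" for T
    by (metis cart_eq_inner_axis inner_commute inner_transpose_mult)
  hence "(\<Sum>T\<in>UNIV. (ext_col k V T \<bullet> z)\<^sup>2) =
      (transpose (ext_power k V) *v z) \<bullet> (transpose (ext_power k V) *v z)"
    by (simp add: inner_vec_def power2_eq_square)
  also have "\<dots> = z \<bullet> (ext_power k V *v (transpose (ext_power k V) *v z))"
    by (simp add: inner_transpose_mult)
  also have "\<dots> = z \<bullet> (ext_power k (V ** transpose V) *v z)"
    by (simp add: ext_power_mult ext_power_transpose matrix_vector_mul_assoc)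
  finally show ?thesis .
qed

lemma ext_col_orthonormal:
  fixes V :: "real^'n^'n"
  assumes "orthogonal_matrix V" "card T = k"
  shows "ext_col k V S \<bullet> ext_col k V T = (if S = T then 1 else 0)"
proof -
  have "ext_col k V S \<bullet> ext_col k V T = axis S 1 \<bullet> (ext_power k (transpose V ** V) *v axis T 1)"
    by (simp add: ext_power_mult ext_power_transpose inner_transpose_mult matrix_vector_mul_assoc[symmetric])
  thus ?thesis using assms by (simp add: orthogonal_matrix ext_power_id inner_axis_axis)
qed

text \<open>The exterior power of the identity is the projection onto degree \<open>k\<close>, because exterior powers are
  extended by zero to the other degrees.\<close>

lemma ext_power_id_le: "z \<bullet> (ext_power k (mat 1 :: real^'n^'n) *v z) \<le> (norm z)\<^sup>2"
proof -
  have "(ext_power k (mat 1 :: real^'n^'n) *v z) $ S = (if card S = k then z $ S else 0)" for S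
  proof -
    have "(ext_power k (mat 1 :: real^'n^'n) *v z) $ S = axis S 1 \<bullet> (ext_power k (mat 1) *v z)"
      by (simp add: inner_axis' )
    also have "\<dots> = ext_col k (mat 1) S \<bullet> z"
      by (simp add: inner_transpose_mult ext_power_transpose[symmetric] transpose_mat)
    finally show ?thesis by (simp add: ext_power_id inner_axis')
  qed
  thus ?thesis unfolding power2_norm_eq_inner by (auto simp: inner_vec_def intro!: sum_mono)
qed

lemma svd_transpose:
  assumes "svd X U s V e"
  shows "transpose X *v column i U = s i *\<^sub>R column i V"
proof -
  have oV: "orthogonal_matrix V" and oU: "orthogonal_matrix U"
    and XV: "\<And>i. X *v column i V = s i *\<^sub>R column i U" using assms by (auto simp: svd_def)
  have "column j V \<bullet> (transpose X *v column i U) = column j V \<bullet> (s i *\<^sub>R column i V)" for j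
  proof -
    have "column j V \<bullet> (transpose X *v column i U) = s j * (column j U \<bullet> column i U)"
      by (simp add: inner_transpose_mult XV)
    thus ?thesis using oV oU unfolding orthogonal_matrix_orthonormal_columns
      by (cases "i = j") (auto simp: orthogonal_def norm_eq_1)
  qed
  hence "transpose V *v (transpose X *v column i U) = transpose V *v (s i *\<^sub>R column i V)"
    by (simp add: vec_eq_iff matrix_vector_mul_component row_transpose column_def)
       (simp add: row_def transpose_def)
  hence "V *v (transpose V *v (transpose X *v column i U)) = V *v (transpose V *v (s i *\<^sub>R column i V))"
    by simp
  moreover have "V *v (transpose V *v z) = z" for z
    using oV by (simp add: matrix_vector_mul_assoc orthogonal_matrix_def)
  ultimately show ?thesis by simp
qed

text \<open>The exterior power of \<open>X\<close> has a singular value decomposition of its own: the wedges of \<open>k\<close> right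
  singular vectors are orthonormal and are mapped to multiples of wedges of left singular vectors, the
  factor being the product of the singular values involved.\<close>

lemma norm_ext_power_svd:
  fixes X :: "real^'n^'n"
  assumes svd: "svd X U s V e"
  shows "(norm (ext_power k X *v z))\<^sup>2 =
    (\<Sum>T | card T = k. (\<Prod>i\<in>T. s i)\<^sup>2 * (ext_col k V T \<bullet> z)\<^sup>2)"
proof -
  have oU: "U ** transpose U = mat 1" using svd by (simp add: svd_def orthogonal_matrix_def)
  define w where "w = ext_power k X *v z"
  have "ext_power k (U ** transpose U) *v w = w"
    by (simp add: oU w_def matrix_vector_mul_assoc ext_power_mult[symmetric])
  hence "(norm w)\<^sup>2 = (\<Sum>T\<in>UNIV. (ext_col k U T \<bullet> w)\<^sup>2)"
    by (simp add: sum_inner_ext_col power2_norm_eq_inner)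
  also have "\<dots> = (\<Sum>T | card T = k. (ext_col k U T \<bullet> w)\<^sup>2)"
    by (intro sum.mono_neutral_right) (auto simp: ext_power_axis)
  also have "\<dots> = (\<Sum>T | card T = k. (\<Prod>i\<in>T. s i)\<^sup>2 * (ext_col k V T \<bullet> z)\<^sup>2)"
  proof (intro sum.cong refl)
    fix T :: "'n set" assume "T \<in> {T. card T = k}"
    hence T: "card T = k" by simp
    have "ext_col k U T \<bullet> w = (ext_power k (transpose X) *v ext_col k U T) \<bullet> z"
      by (simp add: w_def inner_transpose_mult ext_power_transpose)
    also have "\<dots> = (\<Prod>i\<in>T. s i) * (ext_col k V T \<bullet> z)"
      by (subst ext_power_ext_col[OF svd_transpose[OF svd] T]) simp
    finally show "(ext_col k U T \<bullet> w)\<^sup>2 = (\<Prod>i\<in>T. s i)\<^sup>2 * (ext_col k V T \<bullet> z)\<^sup>2"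
      by (simp add: power_mult_distrib)
  qed
  finally show ?thesis by (simp add: w_def)
qed

lemma svd_bessel:
  assumes "svd X U s V e"
  shows "(\<Sum>T | card T = k. (ext_col k V T \<bullet> z)\<^sup>2) \<le> (norm z)\<^sup>2"
proof -
  have "(\<Sum>T | card T = k. (ext_col k V T \<bullet> z)\<^sup>2) = (\<Sum>T\<in>UNIV. (ext_col k V T \<bullet> z)\<^sup>2)"
    by (intro sum.mono_neutral_left) (auto simp: ext_power_axis)
  thus ?thesis using assms ext_power_id_le[of z k]
    by (simp add: sum_inner_ext_col svd_def orthogonal_matrix_def)
qed

lemma prod_le_prod_initial:
  fixes s :: "nat \<Rightarrow> real"
  assumes dec: "\<And>i j. i \<le> j \<Longrightarrow> j < d \<Longrightarrow> s j \<le> s i" and pos: "\<And>i. i < d \<Longrightarrow> 0 < s i"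
  shows "I \<subseteq> {..<d} \<Longrightarrow> card I = k \<Longrightarrow> (\<Prod>i\<in>I. s i) \<le> (\<Prod>i<k. s i)"
proof (induction k arbitrary: I)
  case 0
  thus ?case using finite_subset[of I "{..<d}"] by auto
next
  case (Suc k)
  have fin: "finite I" using Suc.prems finite_subset by blast
  define m where "m = Max I"
  have m: "m \<in> I" using Suc.prems fin by (auto simp: m_def intro!: Max_in)
  have "I \<subseteq> {..m}" using fin by (auto simp: m_def)
  hence "card I \<le> Suc m" using card_mono[of "{..m}" I] by simp
  hence km: "k \<le> m" "m < d" using Suc.prems m by auto
  have "(\<Prod>i\<in>I. s i) = s m * (\<Prod>i\<in>I - {m}. s i)" using fin m by (rule prod.remove)
  also have "\<dots> \<le> s k * (\<Prod>i<k. s i)"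
  proof (intro mult_mono)
    show "s m \<le> s k" using km by (rule dec)
    show "(\<Prod>i\<in>I - {m}. s i) \<le> (\<Prod>i<k. s i)" using Suc.prems fin m by (intro Suc.IH) auto
    show "0 \<le> s k" using pos[of k] km by simp
    show "0 \<le> (\<Prod>i\<in>I - {m}. s i)" using Suc.prems pos by (intro prod_nonneg) (auto intro: less_imp_le)
  qed
  finally show ?case by (simp add: mult.commute)
qed

text \<open>A set of indices other than the initial one contains an index \<open>> k\<close>; the remaining \<open>k\<close> factors are
  bounded by the initial product. Applied to singular values this identifies the second singular
  value of an exterior power.\<close>

lemma prod_le_prod_noninitial:
  fixes s :: "nat \<Rightarrow> real"
  assumes dec: "\<And>i j. i \<le> j \<Longrightarrow> j < d \<Longrightarrow> s j \<le> s i" and pos: "\<And>i. i < d \<Longrightarrow> 0 < s i"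
    and I: "I \<subseteq> {..<d}" "card I = Suc k" "I \<noteq> {..<Suc k}"
  shows "(\<Prod>i\<in>I. s i) \<le> s (Suc k) * (\<Prod>i<k. s i)" and "Suc k < d"
proof -
  have fin: "finite I" using I finite_subset by blast
  have "\<not> I \<subseteq> {..<Suc k}" using I card_subset_eq[of "{..<Suc k}" I] by auto
  then obtain m where m: "m \<in> I" "Suc k \<le> m" by fastforce
  thus "Suc k < d" using I by auto
  have "(\<Prod>i\<in>I. s i) = s m * (\<Prod>i\<in>I - {m}. s i)" using fin m(1) by (rule prod.remove)
  also have "\<dots> \<le> s (Suc k) * (\<Prod>i<k. s i)"
  proof (intro mult_mono)
    show "s m \<le> s (Suc k)" using m I by (intro dec) auto
    show "(\<Prod>i\<in>I - {m}. s i) \<le> (\<Prod>i<k. s i)"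
      using I fin m dec pos by (intro prod_le_prod_initial[where d = d]) auto
    show "0 \<le> s (Suc k)" using pos[of "Suc k"] \<open>Suc k < d\<close> by simp
    show "0 \<le> (\<Prod>i\<in>I - {m}. s i)" using I pos by (intro prod_nonneg) (auto intro: less_imp_le)
  qed
  finally show "(\<Prod>i\<in>I. s i) \<le> s (Suc k) * (\<Prod>i<k. s i)" .
qed

definition vol :: "nat \<Rightarrow> real^'n^'n \<Rightarrow> real" where
  "vol k X = op_norm (ext_power k X)"

text \<open>For \<open>1 \<le> k < CARD('n)\<close> this is the ratio of the singular values number \<open>k + 1\<close> and \<open>k\<close>. Written with volumes
  it can be compared between factors and products, and it is \<open>0\<close> for \<open>k = CARD('n)\<close>.\<close>

definition gap :: "nat \<Rightarrow> real^'n^'n \<Rightarrow> real" where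
  "gap k X = vol (k + 1) X * vol (k - 1) X / (vol k X)\<^sup>2"

lemma op_norm_apply: "norm (A *v x) \<le> op_norm A * norm x" for A :: "real^'n^'m"
  unfolding op_norm_def by (rule onorm) (rule matrix_vector_mul_bounded_linear)

lemma op_norm_le: "(\<And>x. norm (A *v x) \<le> b * norm x) \<Longrightarrow> op_norm A \<le> b" for A :: "real^'n^'m"
  unfolding op_norm_def by (rule onorm_le)

lemma vol_nonneg: "0 \<le> vol k X" by (simp add: vol_def op_norm_nonneg)

lemma vol_mult_le: "vol k (A ** B) \<le> vol k A * vol k B"
  by (simp add: vol_def ext_power_mult op_norm_mult)

context
  fixes X U :: "real^'n^'n" and s V e
  assumes svd: "svd X U s V e"
begin

lemma svd_e: "bij_betw e {..<CARD('n)} UNIV"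
  and svd_dec: "i \<le> j \<Longrightarrow> j < CARD('n) \<Longrightarrow> s (e j) \<le> s (e i)"
  and svd_pos: "0 < s a"
  using svd by (auto simp: svd_def)

lemma svd_card_initial: "k \<le> CARD('n) \<Longrightarrow> card (e ` {..<k}) = k"
  using svd_e by (subst card_image) (auto simp: bij_betw_def intro: inj_on_subset)

lemma svd_prod_initial: "k \<le> CARD('n) \<Longrightarrow> (\<Prod>i\<in>e ` {..<k}. s i) = (\<Prod>i<k. s (e i))"
  using svd_e by (subst prod.reindex) (auto simp: bij_betw_def intro: inj_on_subset)

lemma svd_index_set:
  obtains I where "I \<subseteq> {..<CARD('n)}" "card I = card T" "T = e ` I" "(\<Prod>i\<in>T. s i) = (\<Prod>i\<in>I. s (e i))"
proof -
  define I where "I = {i\<in>{..<CARD('n)}. e i \<in> T}"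
  have inj: "inj_on e I" using svd_e by (auto simp: I_def bij_betw_def intro: inj_on_subset)
  have "T = e ` I"
  proof -
    have "\<exists>i<CARD('n). x = e i" for x using svd_e by (auto simp: bij_betw_def)
    thus ?thesis by (fastforce simp: I_def)
  qed
  moreover have "(\<Prod>i\<in>e ` I. s i) = (\<Prod>i\<in>I. s (e i))" using inj by (simp add: prod.reindex)
  moreover have "card I = card (e ` I)" using inj by (simp add: card_image)
  moreover have "I \<subseteq> {..<CARD('n)}" by (auto simp: I_def)
  ultimately show thesis using that[of I] by simp
qed

lemma svd_prod_le:
  assumes "card T = k"
  shows "(\<Prod>i\<in>T. s i) \<le> (\<Prod>i<k. s (e i))"
proof -
  obtain I where "I \<subseteq> {..<CARD('n)}" "card I = card T" "(\<Prod>i\<in>T. s i) = (\<Prod>i\<in>I. s (e i))"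
    by (rule svd_index_set)
  thus ?thesis using assms prod_le_prod_initial[of "CARD('n)" "\<lambda>i. s (e i)" I k] svd_dec svd_pos by auto
qed

lemma svd_prod_le_noninitial:
  assumes "card T = Suc k" "T \<noteq> e ` {..<Suc k}"
  shows "(\<Prod>i\<in>T. s i) \<le> s (e (Suc k)) * (\<Prod>i<k. s (e i))" and "Suc k < CARD('n)"
proof -
  obtain I where I: "I \<subseteq> {..<CARD('n)}" "card I = card T" "T = e ` I" "(\<Prod>i\<in>T. s i) = (\<Prod>i\<in>I. s (e i))"
    by (rule svd_index_set)
  note * = prod_le_prod_noninitial[of "CARD('n)" "\<lambda>i. s (e i)" I k]
  have "I \<noteq> {..<Suc k}" using I assms by auto
  thus "(\<Prod>i\<in>T. s i) \<le> s (e (Suc k)) * (\<Prod>i<k. s (e i))" "Suc k < CARD('n)"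
    using * I assms svd_dec svd_pos by auto
qed

lemma norm_ext_power_le_svd: "norm (ext_power k X *v z) \<le> (\<Prod>i<k. s (e i)) * norm z"
proof -
  let ?p = "\<Prod>i<k. s (e i)"
  have p0: "0 \<le> ?p" by (intro prod_nonneg) (auto intro: less_imp_le svd_pos)
  have "(norm (ext_power k X *v z))\<^sup>2 \<le> (\<Sum>T | card T = k. ?p\<^sup>2 * (ext_col k V T \<bullet> z)\<^sup>2)"
    unfolding norm_ext_power_svd[OF svd]
    by (intro sum_mono mult_right_mono power_mono svd_prod_le prod_nonneg)
      (auto intro: less_imp_le svd_pos)
  also have "\<dots> \<le> ?p\<^sup>2 * (norm z)\<^sup>2"
    unfolding sum_distrib_left[symmetric] by (intro mult_left_mono svd_bessel[OF svd]) auto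
  finally show ?thesis using p0 by (simp add: power_mult_distrib[symmetric] power2_le_iff_abs_le)
qed

lemma svd_top_image:
  assumes "k \<le> CARD('n)"
  shows "ext_power k X *v ext_col k V (e ` {..<k}) = (\<Prod>i<k. s (e i)) *\<^sub>R ext_col k U (e ` {..<k})"
  using ext_power_ext_col[of X V s U "e ` {..<k}" k] svd svd_card_initial[OF assms] svd_prod_initial[OF assms]
  by (simp add: svd_def)

lemma svd_top_norm:
  assumes "k \<le> CARD('n)"
  shows "norm (ext_col k V (e ` {..<k})) = 1" "norm (ext_col k U (e ` {..<k})) = 1"
  using svd ext_col_orthonormal[OF _ svd_card_initial[OF assms]] by (simp_all add: svd_def norm_eq_1)

lemma vol_svd:
  assumes k: "k \<le> CARD('n)"
  shows "vol k X = (\<Prod>i<k. s (e i))"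
proof (rule antisym)
  show "vol k X \<le> (\<Prod>i<k. s (e i))"
    unfolding vol_def by (rule op_norm_le) (rule norm_ext_power_le_svd)
  have "0 \<le> (\<Prod>i<k. s (e i))" by (intro prod_nonneg) (auto intro: less_imp_le svd_pos)
  thus "(\<Prod>i<k. s (e i)) \<le> vol k X"
    using op_norm_apply[of "ext_power k X" "ext_col k V (e ` {..<k})"] svd_top_norm[OF k]
    by (simp add: vol_def svd_top_image[OF k])
qed

lemma gap_svd:
  assumes k: "1 \<le> k" "k < CARD('n)"
  shows "gap k X = s (e k) / s (e (k - 1))"
proof -
  obtain j where j: "k = Suc j" using k by (cases k) auto
  have "(\<Prod>i<j. s (e i)) \<noteq> 0" using svd_pos by (simp add: less_imp_neq[symmetric])
  thus ?thesis using k svd_pos[of "e j"]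
    by (simp add: gap_def vol_svd j power2_eq_square field_simps)
qed

end

lemma vol_pos: "invertible X \<Longrightarrow> k \<le> CARD('n) \<Longrightarrow> 0 < vol k (X :: real^'n^'n)"
  using svd_exists[of X] vol_svd svd_pos by (metis prod_pos)

lemma gap_nonneg: "0 \<le> gap k X"
  by (simp add: gap_def vol_nonneg)

lemma vol_gt_CARD: "CARD('n) < k \<Longrightarrow> vol k (X :: real^'n^'n) = 0"
proof -
  assume "CARD('n) < k"
  hence "ext_power k X = 0"
    by (auto simp: ext_power_def vec_eq_iff) (metis card_mono finite_class.finite_UNIV leD top_greatest)
  thus ?thesis by (simp add: vol_def op_norm_eq_0)
qed

text \<open>Links domination, which is stated with singular values, to norms of exterior powers, which are
  submultiplicative and continuous.\<close>

lemma gap_eq_singular_value_ratio: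
  fixes X :: "real^'n^'n"
  assumes "invertible X" "1 \<le> k" "k < CARD('n)"
  shows "gap k X = singular_value (k + 1) X / singular_value k X"
proof -
  obtain U s V e where svd: "svd X U s V e" using svd_exists[OF assms(1)] by blast
  have "s (e k) = singular_value (k + 1) X" "s (e (k - 1)) = singular_value (k - 1 + 1) X"
    using svd assms unfolding svd_def by auto
  thus ?thesis using gap_svd[OF svd] assms by simp
qed

text \<open>A unit eigenvector of the exterior power of \<open>X\<^sup>T X\<close> for its largest eigenvalue, with the bound for the
  orthogonal directions.\<close>

definition top_vector :: "nat \<Rightarrow> real^'n^'n \<Rightarrow> real^('n set) \<Rightarrow> bool" where
  "top_vector k X p \<longleftrightarrow> norm p = 1 \<and>
     (\<forall>z. (ext_power k X *v p) \<bullet> (ext_power k X *v z) = (vol k X)\<^sup>2 * (p \<bullet> z)) \<and>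
     (\<forall>z. p \<bullet> z = 0 \<longrightarrow> norm (ext_power k X *v z) \<le> gap k X * vol k X * norm z)"

lemma svd_top_vector:
  fixes X :: "real^'n^'n"
  assumes svd: "svd X U s V e" and k: "1 \<le> k" "k \<le> CARD('n)"
  shows "top_vector k X (ext_col k V (e ` {..<k}))"
  unfolding top_vector_def
proof (intro conjI allI impI)
  let ?p = "ext_col k V (e ` {..<k})"
  show "norm ?p = 1" by (rule svd_top_norm[OF svd k(2)])
  have ci: "card (e ` {..<k}) = k" by (rule svd_card_initial[OF svd k(2)])
  have "ext_power k (transpose X) *v ext_col k U (e ` {..<k}) = vol k X *\<^sub>R ?p"
    using ext_power_ext_col[of "transpose X" U s V, OF svd_transpose[OF svd] ci]
    by (simp add: vol_svd[OF svd k(2)] svd_prod_initial[OF svd k(2)])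
  thus "(ext_power k X *v ?p) \<bullet> (ext_power k X *v z) = (vol k X)\<^sup>2 * (?p \<bullet> z)" for z
    by (simp add: inner_transpose_mult[of _ "ext_power k X"] svd_top_image[OF svd k(2)]
        ext_power_transpose vol_svd[OF svd k(2)] matrix_vector_mult_scaleR power2_eq_square)
  fix z assume z: "?p \<bullet> z = 0"
  define b where "b = gap k X * vol k X"
  have b0: "0 \<le> b" by (simp add: b_def gap_nonneg vol_nonneg)
  have "(norm (ext_power k X *v z))\<^sup>2 \<le> (\<Sum>T | card T = k. b\<^sup>2 * (ext_col k V T \<bullet> z)\<^sup>2)"
    unfolding norm_ext_power_svd[OF svd]
  proof (rule sum_mono)
    fix T :: "'n set" assume "T \<in> {T. card T = k}"
    hence T: "card T = k" by simp
    show "(\<Prod>i\<in>T. s i)\<^sup>2 * (ext_col k V T \<bullet> z)\<^sup>2 \<le> b\<^sup>2 * (ext_col k V T \<bullet> z)\<^sup>2"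
    proof (cases "T = e ` {..<k}")
      case True thus ?thesis using z by simp
    next
      case False
      obtain j where j: "k = Suc j" using k by (cases k) auto
      have *: "(\<Prod>i\<in>T. s i) \<le> s (e k) * (\<Prod>i<j. s (e i))" "k < CARD('n)"
        using svd_prod_le_noninitial[OF svd, of T j] T False j by auto
      have "b = s (e k) * (\<Prod>i<j. s (e i))"
        using gap_svd[OF svd k(1) *(2)] vol_svd[OF svd k(2)] svd_pos[OF svd, of "e j"] by (simp add: b_def j)
      thus ?thesis using * svd_pos[OF svd]
        by (intro mult_right_mono power_mono prod_nonneg) (auto intro: less_imp_le)
    qed
  qed
  also have "\<dots> \<le> b\<^sup>2 * (norm z)\<^sup>2"
    unfolding sum_distrib_left[symmetric] by (intro mult_left_mono svd_bessel[OF svd]) auto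
  finally show "norm (ext_power k X *v z) \<le> b * norm z"
    using b0 by (simp add: power_mult_distrib[symmetric] power2_le_iff_abs_le)
qed

lemma top_vector_exists:
  "invertible X \<Longrightarrow> 1 \<le> k \<Longrightarrow> k \<le> CARD('n) \<Longrightarrow> \<exists>p. top_vector k (X :: real^'n^'n) p"
  using svd_exists svd_top_vector by blast

section \<open>Domination makes volumes almost multiplicative\<close>

lemma products_splitE:
  assumes "Z \<in> products (m + n) S"
  obtains X Y where "X \<in> products m S" "Y \<in> products n S" "Z = X ** Y"
proof -
  have "\<exists>X\<in>products m S. \<exists>Y\<in>products n S. Z = X ** Y" using assms
  proof (induction m arbitrary: Z)
    case (Suc m)
    then obtain A P where AP: "A \<in> S" "P \<in> products (m + n) S" "Z = A ** P" by auto
    then obtain X Y where "X \<in> products m S" "Y \<in> products n S" "P = X ** Y" using Suc.IH by blast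
    thus ?case using AP by (intro bexI[of _ "A ** X"] bexI[of _ Y]) (auto simp: matrix_mul_assoc)
  qed (auto intro!: bexI[of _ "mat 1"])
  thus thesis using that by blast
qed

lemma products_1: "products (Suc 0) S = S"
  by auto

lemma products_SucE_right:
  assumes "Z \<in> products (Suc n) S"
  obtains Y A where "Y \<in> products n S" "A \<in> S" "Z = Y ** A"
  using assms by (metis Suc_eq_plus1 products_1 One_nat_def products_splitE)

lemma invertible_products:
  assumes "\<And>A. A \<in> S \<Longrightarrow> invertible A"
  shows "P \<in> products n S \<Longrightarrow> invertible P"
proof (induction n arbitrary: P)
  case 0
  thus ?case by (auto simp: invertible_def)
qed (auto intro: invertible_mult assms)

definition bounded_GL :: "real \<Rightarrow> (real^'n^'n) set \<Rightarrow> bool" where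
  "bounded_GL b S \<longleftrightarrow> (\<forall>A\<in>S. op_norm A \<le> b \<and> (\<forall>x. norm x \<le> b * norm (A *v x)))"

lemma bounded_GL_invertible:
  fixes A :: "real^'n^'n"
  assumes "bounded_GL b S" "A \<in> S"
  shows "invertible A"
proof -
  have "x = 0" if "A *v x = 0" for x
    using assms that unfolding bounded_GL_def by (metis mult_zero_right norm_le_zero_iff norm_zero)
  thus ?thesis by (metis invertible_left_inverse matrix_left_invertible_ker)
qed

lemma vol_le_power:
  fixes X :: "real^'n^'n"
  assumes inv: "invertible X" and k: "k \<le> CARD('n)"
  shows "vol k X \<le> op_norm X ^ k"
proof -
  obtain U s V e where svd: "svd X U s V e" using svd_exists[OF inv] by blast
  have "s i \<le> op_norm X" for i
  proof -
    have "norm (column i V) = 1" "norm (column i U) = 1" "X *v column i V = s i *\<^sub>R column i U"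
      using svd by (auto simp: svd_def orthogonal_matrix_orthonormal_columns)
    thus ?thesis using op_norm_apply[of X "column i V"] svd_pos[OF svd, of i] by simp
  qed
  hence "(\<Prod>i<k. s (e i)) \<le> (\<Prod>i<k. op_norm X)"
    by (intro prod_mono conjI less_imp_le[OF svd_pos[OF svd]])
  thus ?thesis by (simp add: vol_svd[OF svd k])
qed

lemma matrix_inv_mult:
  fixes A :: "real^'n^'n"
  assumes "invertible A"
  shows "matrix_inv A ** A = mat 1" "A ** matrix_inv A = mat 1" "invertible (matrix_inv A)"
proof -
  have "\<exists>A'. A ** A' = mat 1 \<and> A' ** A = mat 1" using assms by (simp add: invertible_def)
  from someI_ex[OF this] show *: "matrix_inv A ** A = mat 1" "A ** matrix_inv A = mat 1"
    by (simp_all add: matrix_inv_def)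
  show "invertible (matrix_inv A)" using * by (auto simp: invertible_def)
qed

text \<open>The bound on the inverse comes from the lower bound on the expansion; both exponents are enlarged to
  the dimension so that one constant serves all degrees.\<close>

lemma bounded_GL_vol:
  fixes S :: "(real^'n^'n) set"
  assumes S: "bounded_GL b S" and b: "1 \<le> b" and A: "A \<in> S"
  shows "vol j A \<le> b ^ CARD('n)" "vol j (matrix_inv A) \<le> b ^ CARD('n)"
proof -
  have inv: "invertible A" by (rule bounded_GL_invertible[OF S A])
  have gen: "vol j X \<le> b ^ CARD('n)" if "invertible X" "op_norm X \<le> b" for X :: "real^'n^'n"
  proof (cases "j \<le> CARD('n)")
    case True
    have "vol j X \<le> op_norm X ^ j" by (rule vol_le_power[OF that(1) True])
    also have "\<dots> \<le> b ^ j" using that op_norm_nonneg by (intro power_mono)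
    also have "\<dots> \<le> b ^ CARD('n)" using b True by (intro power_increasing)
    finally show ?thesis .
  next
    case False
    thus ?thesis using b vol_gt_CARD[of j X] by simp
  qed
  show "vol j A \<le> b ^ CARD('n)" using gen[OF inv] S A by (auto simp: bounded_GL_def)
  have "op_norm (matrix_inv A) \<le> b"
  proof (rule op_norm_le)
    fix x
    have "norm (matrix_inv A *v x) \<le> b * norm (A *v (matrix_inv A *v x))"
      using S A by (auto simp: bounded_GL_def)
    thus "norm (matrix_inv A *v x) \<le> b * norm x"
      by (simp add: matrix_vector_mul_assoc matrix_inv_mult[OF inv])
  qed
  thus "vol j (matrix_inv A) \<le> b ^ CARD('n)" using gen[OF matrix_inv_mult(3)[OF inv]] by simp
qed

definition vol_bounded :: "real \<Rightarrow> (real^'n^'n) set \<Rightarrow> bool" where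
  "vol_bounded L S \<longleftrightarrow> (\<forall>A\<in>S. invertible A \<and> (\<forall>j. vol j A \<le> L \<and> vol j (matrix_inv A) \<le> L))"

lemma vol_bounded_of_bounded_GL:
  fixes S :: "(real^'n^'n) set"
  assumes "bounded_GL b S" "1 \<le> b"
  shows "vol_bounded (b ^ CARD('n)) S"
  using bounded_GL_vol[OF assms] bounded_GL_invertible[OF assms(1)] by (simp add: vol_bounded_def)

lemma vol_bounded_mult:
  fixes S :: "(real^'n^'n) set"
  assumes "vol_bounded L S" "A \<in> S"
  shows "vol j (A ** X) \<le> L * vol j X" "vol j X \<le> L * vol j (A ** X)"
    "vol j (X ** A) \<le> L * vol j X" "vol j X \<le> L * vol j (X ** A)"
proof -
  have inv: "invertible A" and vA: "vol j A \<le> L" "vol j (matrix_inv A) \<le> L"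
    using assms by (auto simp: vol_bounded_def)
  have le: "vol j (B ** Y) \<le> L * vol j Y" "vol j (Y ** B) \<le> L * vol j Y" if "vol j B \<le> L" for B Y :: "real^'n^'n"
    using vol_mult_le[of j B Y] vol_mult_le[of j Y B] mult_right_mono[OF that vol_nonneg[of j Y]]
    by (simp_all add: mult.commute)
  show "vol j (A ** X) \<le> L * vol j X" "vol j (X ** A) \<le> L * vol j X" using le[OF vA(1)] by auto
  have "matrix_inv A ** (A ** X) = X" "X ** A ** matrix_inv A = X"
    by (simp_all add: matrix_mul_assoc matrix_inv_mult[OF inv])
      (simp add: matrix_mul_assoc[symmetric] matrix_inv_mult[OF inv])
  thus "vol j X \<le> L * vol j (A ** X)" "vol j X \<le> L * vol j (X ** A)"
    using le(1)[OF vA(2), of "A ** X"] le(2)[OF vA(2), of "X ** A"] by auto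
qed

lemma top_vector_uminus: "top_vector k X p \<Longrightarrow> top_vector k X (- p)"
  by (simp add: top_vector_def linear_neg[OF matrix_vector_mul_linear])

lemma top_vector_norm_lower:
  fixes X :: "real^'n^'n"
  assumes "top_vector k X p" "0 < vol k X"
  shows "vol k X * \<bar>p \<bullet> z\<bar> \<le> norm (ext_power k X *v z)"
proof -
  have p: "norm p = 1" "(ext_power k X *v p) \<bullet> (ext_power k X *v z) = (vol k X)\<^sup>2 * (p \<bullet> z)"
    using assms by (auto simp: top_vector_def)
  have "(vol k X)\<^sup>2 * \<bar>p \<bullet> z\<bar> = \<bar>(ext_power k X *v p) \<bullet> (ext_power k X *v z)\<bar>"
    by (simp add: p abs_mult)
  also have "\<dots> \<le> norm (ext_power k X *v p) * norm (ext_power k X *v z)"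
    by (rule Cauchy_Schwarz_ineq2)
  also have "\<dots> \<le> vol k X * norm (ext_power k X *v z)"
    using op_norm_apply[of "ext_power k X" p] p by (intro mult_right_mono) (auto simp: vol_def)
  finally show ?thesis using assms(2) by (simp add: power2_eq_square)
qed

lemma orthogonal_part:
  fixes p z :: "'a::real_inner"
  assumes "norm p = 1"
  shows "p \<bullet> (z - (p \<bullet> z) *\<^sub>R p) = 0"
    and "(norm (z - (p \<bullet> z) *\<^sub>R p))\<^sup>2 = (norm z)\<^sup>2 - (p \<bullet> z)\<^sup>2"
    and "norm (z - (p \<bullet> z) *\<^sub>R p) \<le> norm z"
proof -
  show "p \<bullet> (z - (p \<bullet> z) *\<^sub>R p) = 0" using assms by (simp add: inner_diff_right norm_eq_1)
  show eq: "(norm (z - (p \<bullet> z) *\<^sub>R p))\<^sup>2 = (norm z)\<^sup>2 - (p \<bullet> z)\<^sup>2"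
    using assms unfolding power2_norm_eq_inner
    by (simp add: inner_diff inner_commute norm_eq_1 power2_eq_square)
  show "norm (z - (p \<bullet> z) *\<^sub>R p) \<le> norm z"
    by (rule power2_le_imp_le) (simp_all add: eq)
qed

text \<open>Together with the preceding lemma: up to the relative error \<open>gap k X\<close>, the exterior power of \<open>X\<close>
  only sees the component of \<open>z\<close> along its top vector.\<close>

lemma top_vector_norm_upper:
  fixes X :: "real^'n^'n"
  assumes "top_vector k X p"
  shows "norm (ext_power k X *v z) \<le> vol k X * (\<bar>p \<bullet> z\<bar> + gap k X * norm z)"
proof -
  have p: "norm p = 1" "\<And>z. p \<bullet> z = 0 \<Longrightarrow> norm (ext_power k X *v z) \<le> gap k X * vol k X * norm z"
    using assms by (auto simp: top_vector_def)
  define w where "w = z - (p \<bullet> z) *\<^sub>R p"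
  have pw: "p \<bullet> w = 0" and "norm w \<le> norm z"
    unfolding w_def using orthogonal_part[OF p(1)] by auto
  have "norm (ext_power k X *v z) = norm ((p \<bullet> z) *\<^sub>R (ext_power k X *v p) + ext_power k X *v w)"
    by (simp add: w_def matrix_vector_mult_diff_distrib matrix_vector_mult_scaleR)
  also have "\<dots> \<le> \<bar>p \<bullet> z\<bar> * norm (ext_power k X *v p) + norm (ext_power k X *v w)"
    by (rule norm_triangle_le) simp
  also have "\<dots> \<le> \<bar>p \<bullet> z\<bar> * vol k X + gap k X * vol k X * norm z"
  proof (intro add_mono mult_left_mono)
    show "norm (ext_power k X *v p) \<le> vol k X"
      using op_norm_apply[of "ext_power k X" p] p(1) by (simp add: vol_def)
    have "norm (ext_power k X *v w) \<le> gap k X * vol k X * norm w" by (rule p(2)[OF pw])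
    also have "\<dots> \<le> gap k X * vol k X * norm z"
      using \<open>norm w \<le> norm z\<close> by (intro mult_left_mono mult_nonneg_nonneg gap_nonneg vol_nonneg)
    finally show "norm (ext_power k X *v w) \<le> gap k X * vol k X * norm z" .
  qed auto
  finally show ?thesis by (simp add: algebra_simps)
qed

text \<open>Multiplication by one letter distorts norms by at most \<open>L\<close>, so a unit vector that \<open>A Z\<close> expands most
  cannot have a substantial component in the directions that \<open>Z\<close> expands less by the factor \<open>gap k Z\<close>. The
  sign of the new top vector is chosen to make it close to the old one.\<close>

lemma top_vector_left_mult:
  fixes Z :: "real^'n^'n"
  assumes k: "1 \<le> k" "k \<le> CARD('n)" and S: "vol_bounded L S" "A \<in> S" and L: "1 \<le> L"
    and Z: "invertible Z" and p: "top_vector k Z p"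
  shows "\<exists>p'. top_vector k (A ** Z) p' \<and> norm (p' - p) \<le> 2 * L\<^sup>2 * gap k Z"
proof -
  have invA: "invertible A" using S by (auto simp: vol_bounded_def)
  have invAZ: "invertible (A ** Z)" by (intro invertible_mult invA Z)
  obtain p0 where p0: "top_vector k (A ** Z) p0" using top_vector_exists[OF invAZ k] by blast
  define p' where "p' = (if p0 \<bullet> p \<ge> 0 then p0 else - p0)"
  have p': "top_vector k (A ** Z) p'" using p0 by (simp add: p'_def top_vector_uminus)
  have c0: "0 \<le> p' \<bullet> p" by (simp add: p'_def)
  have n: "norm p = 1" "norm p' = 1" using p p' by (auto simp: top_vector_def)
  have c1: "p' \<bullet> p \<le> 1" using norm_cauchy_schwarz[of p' p] n by simp
  define w where "w = p' - (p \<bullet> p') *\<^sub>R p"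
  have pw: "p \<bullet> w = 0" unfolding w_def by (rule orthogonal_part(1)[OF n(1)])
  have p'w: "p' \<bullet> w = (norm w)\<^sup>2"
    using n pw unfolding power2_norm_eq_inner by (simp add: w_def inner_diff inner_commute norm_eq_1)
  have vAZ: "0 < vol k (A ** Z)" by (rule vol_pos[OF invAZ k(2)])
  have w_le: "norm w \<le> L\<^sup>2 * gap k Z"
  proof (cases "w = 0")
    case True thus ?thesis by (simp add: gap_nonneg)
  next
    case False
    have "vol k (A ** Z) * (norm w)\<^sup>2 \<le> norm (ext_power k (A ** Z) *v w)"
      using top_vector_norm_lower[OF p' vAZ, of w] p'w by simp
    also have "\<dots> = norm (ext_power k A *v (ext_power k Z *v w))"
      by (simp add: ext_power_mult matrix_vector_mul_assoc)
    also have "\<dots> \<le> vol k A * norm (ext_power k Z *v w)"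
      unfolding vol_def by (rule op_norm_apply)
    also have "\<dots> \<le> L * (gap k Z * vol k Z * norm w)"
      using p pw S L by (intro mult_mono) (auto simp: top_vector_def vol_bounded_def)
    also have "\<dots> \<le> L * (gap k Z * (L * vol k (A ** Z)) * norm w)"
      using vol_bounded_mult(2)[OF S, of k Z] L
      by (intro mult_left_mono mult_right_mono) (auto simp: gap_nonneg)
    finally have "norm w * (vol k (A ** Z) * norm w) \<le> norm w * (vol k (A ** Z) * (L\<^sup>2 * gap k Z))"
      by (simp add: power2_eq_square algebra_simps)
    thus ?thesis using False vAZ by simp
  qed
  have "(norm (p' - p))\<^sup>2 = 2 - 2 * (p' \<bullet> p)"
    using n unfolding power2_norm_eq_inner by (simp add: inner_diff inner_commute norm_eq_1)
  also have "\<dots> \<le> 2 * (1 - (p' \<bullet> p)\<^sup>2)"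
    using c0 c1 mult_left_le[of "p' \<bullet> p" "p' \<bullet> p"] by (simp add: power2_eq_square)
  also have "1 - (p' \<bullet> p)\<^sup>2 = (norm w)\<^sup>2"
    using orthogonal_part(2)[OF n(1), of p'] n(2) by (simp add: w_def inner_commute)
  also have "2 * (norm w)\<^sup>2 \<le> (2 * norm w)\<^sup>2" by (simp add: power_mult_distrib)
  finally have "norm (p' - p) \<le> 2 * norm w" by (rule power2_le_imp_le) simp
  thus ?thesis using p' w_le by (intro exI[of _ p']) auto
qed

text \<open>Domination restricted to products of length at most \<open>N\<close>.\<close>

definition gaps_decay :: "nat \<Rightarrow> real \<Rightarrow> real \<Rightarrow> nat \<Rightarrow> (real^'n^'n) set \<Rightarrow> bool" where
  "gaps_decay k C \<tau> N S \<longleftrightarrow> (\<forall>n\<in>{1..N}. \<forall>Z\<in>products n S. gap k Z \<le> C * \<tau> ^ n)"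

text \<open>The relative error per letter in lemma \<open>right_letter_step\<close> below: a geometric series of displacements of the
  top vector, plus one gap.\<close>

definition step_loss :: "real \<Rightarrow> real \<Rightarrow> real \<Rightarrow> real" where
  "step_loss C \<tau> L = L\<^sup>2 * C * (2 * L\<^sup>2 / (1 - \<tau>) + 1)"

definition loss_rate :: "real \<Rightarrow> real \<Rightarrow> real \<Rightarrow> real" where
  "loss_rate C \<tau> L = 2 * step_loss C \<tau> L + 4 * step_loss C \<tau> L * ln L"

context
  fixes k :: nat and C \<tau> L :: real and N :: nat and S :: "(real^'n^'n) set"
  assumes k: "1 \<le> k" "k \<le> CARD('n)" and C: "1 \<le> C" and \<tau>: "0 < \<tau>" "\<tau> < 1" and L: "1 \<le> L"
    and S: "vol_bounded L S" and decay: "gaps_decay k C \<tau> N S"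
begin

lemma inv_prod: "P \<in> products n S \<Longrightarrow> invertible P"
  using S invertible_products by (metis vol_bounded_def)

text \<open>The one-letter displacements form a geometric series, so the total displacement is governed by the
  length \<open>m\<close> of \<open>Y\<close>, no matter how many letters are added on the left.\<close>

lemma top_vector_products:
  assumes Y: "Y \<in> products m S" and m: "1 \<le> m" and p: "top_vector k Y p"
  shows "X \<in> products l S \<Longrightarrow> l + m \<le> N \<Longrightarrow>
    \<exists>p'. top_vector k (X ** Y) p' \<and> norm (p' - p) \<le> 2 * L\<^sup>2 * C * \<tau> ^ m * (\<Sum>j<l. \<tau> ^ j)"
proof (induction l arbitrary: X)
  case 0
  thus ?case using p by auto
next
  case (Suc l)
  obtain A X' where X: "A \<in> S" "X' \<in> products l S" "X = A ** X'" using Suc.prems by auto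
  obtain p1 where p1: "top_vector k (X' ** Y) p1" "norm (p1 - p) \<le> 2 * L\<^sup>2 * C * \<tau> ^ m * (\<Sum>j<l. \<tau> ^ j)"
    using Suc.IH[OF X(2)] Suc.prems by auto
  have XY: "X' ** Y \<in> products (l + m) S" by (rule products_mult[OF X(2) Y])
  obtain p' where p': "top_vector k (A ** (X' ** Y)) p'" "norm (p' - p1) \<le> 2 * L\<^sup>2 * gap k (X' ** Y)"
    using top_vector_left_mult[OF k S X(1) L inv_prod[OF XY] p1(1)] by blast
  have "gap k (X' ** Y) \<le> C * \<tau> ^ (l + m)"
    using decay XY m Suc.prems unfolding gaps_decay_def by auto
  hence "2 * L\<^sup>2 * gap k (X' ** Y) \<le> 2 * L\<^sup>2 * (C * \<tau> ^ (l + m))"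
    by (intro mult_left_mono) auto
  hence "norm (p' - p) \<le> 2 * L\<^sup>2 * (C * \<tau> ^ (l + m)) + 2 * L\<^sup>2 * C * \<tau> ^ m * (\<Sum>j<l. \<tau> ^ j)"
    using norm_triangle_ineq[of "p' - p1" "p1 - p"] p1(2) p'(2) by simp
  also have "\<dots> = 2 * L\<^sup>2 * C * \<tau> ^ m * (\<Sum>j<Suc l. \<tau> ^ j)"
    by (simp add: power_add algebra_simps)
  finally show ?case using p' X by (auto simp: matrix_mul_assoc)
qed

lemma sum_pow_le: "(\<Sum>j<l. \<tau> ^ j) \<le> 1 / (1 - \<tau>)"
  using \<tau> by (simp add: sum_gp_strict divide_right_mono)

lemma step_loss_nonneg: "0 \<le> step_loss C \<tau> L"
  using C L \<tau> by (simp add: step_loss_def)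

text \<open>Appending \<open>A\<close> on the right multiplies \<open>vol k Y\<close> by approximately the length of the projection of the
  image of \<open>A\<close> to the top vector of \<open>Y\<close>, and likewise for \<open>X Y\<close>. The two top vectors are close by the
  previous lemma.\<close>

lemma right_letter_step:
  assumes X: "X \<in> products l S" and Y: "Y \<in> products m S" and m: "1 \<le> m" and N: "l + m \<le> N" and A: "A \<in> S"
  shows "vol k (X ** Y) * vol k (Y ** A) * (1 - step_loss C \<tau> L * \<tau> ^ m) \<le> vol k (X ** Y ** A) * vol k Y"
proof -
  define Z where "Z = X ** Y"
  have Zp: "Z \<in> products (l + m) S" unfolding Z_def by (rule products_mult[OF X Y])
  obtain p where p: "top_vector k Y p" using top_vector_exists[OF inv_prod[OF Y] k] by blast
  obtain p' where p': "top_vector k Z p'" "norm (p' - p) \<le> 2 * L\<^sup>2 * C * \<tau> ^ m * (\<Sum>j<l. \<tau> ^ j)"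
    using top_vector_products[OF Y m p X N] by (auto simp: Z_def)
  define \<delta> where "\<delta> = 2 * L\<^sup>2 * C * \<tau> ^ m / (1 - \<tau>)"
  have d: "norm (p' - p) \<le> \<delta>"
    using p'(2) mult_left_mono[OF sum_pow_le[of l], of "2 * L\<^sup>2 * C * \<tau> ^ m"] C \<tau> by (simp add: \<delta>_def)
  have vY: "0 < vol k Y" and vZ: "0 < vol k Z"
    using vol_pos[OF inv_prod[OF Y] k(2)] vol_pos[OF inv_prod[OF Zp] k(2)] by auto
  have gY: "gap k Y \<le> C * \<tau> ^ m" using decay Y m N unfolding gaps_decay_def by auto
  have "vol k (Y ** A) \<le> vol k Y * (vol k (Z ** A) / vol k Z + (\<delta> + C * \<tau> ^ m) * L)"
    unfolding vol_def[of k "Y ** A"]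
  proof (rule op_norm_le)
    fix y :: "real^('n set)"
    define x where "x = ext_power k A *v y"
    have "norm x \<le> vol k A * norm y" unfolding x_def vol_def by (rule op_norm_apply)
    also have "\<dots> \<le> L * norm y" using S A by (intro mult_right_mono) (auto simp: vol_bounded_def)
    finally have x: "norm x \<le> L * norm y" .
    have "vol k Z * \<bar>p' \<bullet> x\<bar> \<le> norm (ext_power k Z *v x)" by (rule top_vector_norm_lower[OF p'(1) vZ])
    also have "ext_power k Z *v x = ext_power k (Z ** A) *v y"
      by (simp add: x_def ext_power_mult matrix_vector_mul_assoc)
    also have "norm \<dots> \<le> vol k (Z ** A) * norm y" unfolding vol_def by (rule op_norm_apply)
    finally have p'x: "\<bar>p' \<bullet> x\<bar> \<le> vol k (Z ** A) / vol k Z * norm y" using vZ by (simp add: field_simps)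
    have "\<bar>p \<bullet> x\<bar> \<le> \<bar>p' \<bullet> x\<bar> + \<bar>(p' - p) \<bullet> x\<bar>" by (simp add: inner_diff_left)
    also have "\<bar>(p' - p) \<bullet> x\<bar> \<le> norm (p' - p) * norm x" by (rule Cauchy_Schwarz_ineq2)
    also have "\<dots> \<le> \<delta> * norm x" by (intro mult_right_mono d) auto
    finally have px: "\<bar>p \<bullet> x\<bar> \<le> \<bar>p' \<bullet> x\<bar> + \<delta> * norm x" by simp
    have "norm (ext_power k (Y ** A) *v y) = norm (ext_power k Y *v x)"
      by (simp add: x_def ext_power_mult matrix_vector_mul_assoc)
    also have "\<dots> \<le> vol k Y * (\<bar>p \<bullet> x\<bar> + gap k Y * norm x)" by (rule top_vector_norm_upper[OF p])
    also have "\<dots> \<le> vol k Y * (\<bar>p \<bullet> x\<bar> + C * \<tau> ^ m * norm x)"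
      using vY gY by (intro mult_left_mono add_left_mono mult_right_mono) auto
    also have "\<dots> \<le> vol k Y * (\<bar>p' \<bullet> x\<bar> + (\<delta> + C * \<tau> ^ m) * norm x)"
      using vY px by (intro mult_left_mono) (auto simp: algebra_simps)
    also have "\<dots> \<le> vol k Y * (vol k (Z ** A) / vol k Z * norm y + (\<delta> + C * \<tau> ^ m) * (L * norm y))"
      using vY p'x x C \<tau> L by (intro mult_left_mono add_mono) (auto simp: \<delta>_def intro!: add_nonneg_nonneg divide_nonneg_nonneg)
    finally show "norm (ext_power k (Y ** A) *v y) \<le>
        vol k Y * (vol k (Z ** A) / vol k Z + (\<delta> + C * \<tau> ^ m) * L) * norm y"
      by (simp add: algebra_simps)
  qed
  also have "\<dots> = vol k Y * vol k (Z ** A) / vol k Z + (\<delta> + C * \<tau> ^ m) * L * vol k Y"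
    by (simp add: algebra_simps)
  also have "\<dots> \<le> vol k Y * vol k (Z ** A) / vol k Z + (\<delta> + C * \<tau> ^ m) * L * (L * vol k (Y ** A))"
    using vol_bounded_mult(4)[OF S A, of k Y] C \<tau> L
    by (intro add_left_mono mult_left_mono) (auto simp: \<delta>_def intro!: mult_nonneg_nonneg add_nonneg_nonneg divide_nonneg_nonneg)
  also have "(\<delta> + C * \<tau> ^ m) * L * (L * vol k (Y ** A)) = step_loss C \<tau> L * \<tau> ^ m * vol k (Y ** A)"
    using \<tau> by (simp add: \<delta>_def step_loss_def field_simps power2_eq_square)
  finally have "vol k (Y ** A) * (1 - step_loss C \<tau> L * \<tau> ^ m) \<le> vol k Y * vol k (Z ** A) / vol k Z"
    by (simp add: algebra_simps)
  hence "vol k Z * (vol k (Y ** A) * (1 - step_loss C \<tau> L * \<tau> ^ m)) \<le> vol k Z * (vol k Y * vol k (Z ** A) / vol k Z)"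
    using vZ by (intro mult_left_mono) auto
  thus ?thesis using vZ by (simp add: Z_def algebra_simps)
qed

lemma loss_rate_nonneg: "0 \<le> loss_rate C \<tau> L"
  using step_loss_nonneg L by (simp add: loss_rate_def)

text \<open>For small \<open>m\<close> the bound of the previous lemma may be vacuous; then the trivial loss \<open>1 / L\<^sup>2\<close> is used. The
  constant \<open>loss_rate\<close> is chosen so that one exponential lies below both bounds, which makes the losses
  multiply to a convergent product.\<close>

lemma right_letter_step_exp:
  assumes X: "X \<in> products l S" and Y: "Y \<in> products m S" and m: "1 \<le> m" and N: "l + m \<le> N" and A: "A \<in> S"
  shows "vol k (X ** Y) * vol k (Y ** A) * exp (- loss_rate C \<tau> L * \<tau> ^ m) \<le> vol k (X ** Y ** A) * vol k Y"
proof -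
  define x where "x = step_loss C \<tau> L * \<tau> ^ m"
  have x0: "0 \<le> x" using step_loss_nonneg \<tau> by (simp add: x_def)
  have nn: "0 \<le> vol k (X ** Y) * vol k (Y ** A)" by (simp add: vol_nonneg)
  have Kx: "loss_rate C \<tau> L * \<tau> ^ m = 2 * x + 4 * x * ln L" by (simp add: loss_rate_def x_def algebra_simps)
  show ?thesis
  proof (cases "x \<le> 1/2")
    case True
    have "- x - 2 * x\<^sup>2 \<le> ln (1 - x)" by (rule ln_one_minus_pos_lower_bound) (use x0 True in auto)
    moreover have "2 * x\<^sup>2 \<le> x" using x0 True mult_left_mono[of x "1/2" x] by (simp add: power2_eq_square)
    moreover have "0 \<le> 4 * x * ln L" using x0 L by simp
    ultimately have "- loss_rate C \<tau> L * \<tau> ^ m \<le> ln (1 - x)" using Kx by simp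
    hence "exp (- loss_rate C \<tau> L * \<tau> ^ m) \<le> exp (ln (1 - x))" by (simp only: exp_le_cancel_iff)
    hence "exp (- loss_rate C \<tau> L * \<tau> ^ m) \<le> 1 - x" using True by simp
    thus ?thesis using right_letter_step[OF X Y m N A] mult_left_mono[OF _ nn] by (fastforce simp: x_def intro: order_trans)
  next
    case False
    hence "ln L \<le> 2 * x * ln L" using L mult_right_mono[of 1 "2 * x" "ln L"] by simp
    hence "- loss_rate C \<tau> L * \<tau> ^ m \<le> - 2 * ln L" using Kx x0 by simp
    hence "exp (- loss_rate C \<tau> L * \<tau> ^ m) \<le> exp (- 2 * ln L)" by (simp only: exp_le_cancel_iff)
    also have "exp (- 2 * ln L) = inverse (exp (ln L) * exp (ln L))"
      by (simp add: exp_minus[symmetric] exp_add[symmetric])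
    also have "\<dots> = 1 / L\<^sup>2" using L by (simp add: power2_eq_square divide_inverse)
    finally have "vol k (X ** Y) * vol k (Y ** A) * exp (- loss_rate C \<tau> L * \<tau> ^ m) \<le>
        vol k (X ** Y) * vol k (Y ** A) * (1 / L\<^sup>2)" by (intro mult_left_mono nn)
    also have "\<dots> \<le> (L * vol k (X ** Y ** A)) * (L * vol k Y) * (1 / L\<^sup>2)"
      using vol_bounded_mult[OF S A] L
      by (intro mult_right_mono mult_mono) (auto simp: vol_nonneg)
    also have "\<dots> = vol k (X ** Y ** A) * vol k Y" using L by (simp add: power2_eq_square)
    finally show ?thesis .
  qed
qed

text \<open>Induction on the length of \<open>Y\<close>, starting at one letter rather than at the empty product, for which
  decay of gaps carries no information.\<close>

lemma almost_multiplicative_aux: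
  assumes X: "X \<in> products l S"
  shows "Y \<in> products (Suc m) S \<Longrightarrow> l + Suc m \<le> N \<Longrightarrow>
    vol k X * vol k Y * (exp (- loss_rate C \<tau> L * (\<Sum>j<Suc m. \<tau> ^ j)) / L\<^sup>2) \<le> vol k (X ** Y)"
proof (induction m arbitrary: Y)
  case 0
  hence Y: "Y \<in> S" by simp
  have "exp (- loss_rate C \<tau> L * (\<Sum>j<Suc 0. \<tau> ^ j)) \<le> 1" using loss_rate_nonneg by simp
  hence "vol k X * vol k Y * (exp (- loss_rate C \<tau> L * (\<Sum>j<Suc 0. \<tau> ^ j)) / L\<^sup>2) \<le> vol k X * vol k Y * (1 / L\<^sup>2)"
    by (intro mult_left_mono divide_right_mono) (auto simp: vol_nonneg)
  also have "\<dots> \<le> (L * vol k (X ** Y)) * L * (1 / L\<^sup>2)"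
    using vol_bounded_mult(4)[OF S Y] S Y L
    by (intro mult_right_mono mult_mono) (auto simp: vol_nonneg vol_bounded_def)
  also have "\<dots> = vol k (X ** Y)" using L by (simp add: power2_eq_square)
  finally show ?case .
next
  case (Suc m)
  then obtain Y' A where Y: "Y' \<in> products (Suc m) S" "A \<in> S" "Y = Y' ** A"
    using products_SucE_right by blast
  define c where "c = exp (- loss_rate C \<tau> L * (\<Sum>j<Suc m. \<tau> ^ j)) / L\<^sup>2"
  define f where "f = exp (- loss_rate C \<tau> L * \<tau> ^ Suc m)"
  have ih: "vol k X * vol k Y' * c \<le> vol k (X ** Y')" using Suc.IH[OF Y(1)] Suc.prems by (simp add: c_def)
  have st: "vol k (X ** Y') * vol k (Y' ** A) * f \<le> vol k (X ** Y' ** A) * vol k Y'"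
    unfolding f_def using Suc.prems by (intro right_letter_step_exp[OF X Y(1) _ _ Y(2)]) auto
  have v: "0 < vol k Y'" by (rule vol_pos[OF inv_prod[OF Y(1)] k(2)])
  have cf: "exp (- loss_rate C \<tau> L * (\<Sum>j<Suc (Suc m). \<tau> ^ j)) / L\<^sup>2 = c * f"
    by (simp add: c_def f_def exp_add[symmetric] algebra_simps)
  have "vol k Y' * (vol k X * vol k Y * (c * f)) = (vol k X * vol k Y' * c) * (vol k Y * f)" by simp
  also have "\<dots> \<le> vol k (X ** Y') * (vol k Y * f)"
    by (intro mult_right_mono ih) (auto simp: f_def vol_nonneg)
  also have "\<dots> \<le> vol k Y' * vol k (X ** Y)" using st by (simp add: Y(3) matrix_mul_assoc mult_ac)
  finally show ?case using v by (simp only: cf) (simp add: mult_ac)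
qed

lemma almost_multiplicative_decay:
  assumes X: "X \<in> products l S" and Y: "Y \<in> products m S" and m: "1 \<le> m" and N: "l + m \<le> N"
  shows "exp (- loss_rate C \<tau> L / (1 - \<tau>)) / L\<^sup>2 * vol k X * vol k Y \<le> vol k (X ** Y)"
proof -
  obtain m' where m': "m = Suc m'" using m by (cases m) auto
  have "loss_rate C \<tau> L * (\<Sum>j<Suc m'. \<tau> ^ j) \<le> loss_rate C \<tau> L * (1 / (1 - \<tau>))"
    by (rule mult_left_mono[OF sum_pow_le loss_rate_nonneg])
  hence "exp (- loss_rate C \<tau> L / (1 - \<tau>)) / L\<^sup>2 \<le> exp (- loss_rate C \<tau> L * (\<Sum>j<Suc m'. \<tau> ^ j)) / L\<^sup>2"
    by (intro divide_right_mono) auto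
  hence "exp (- loss_rate C \<tau> L / (1 - \<tau>)) / L\<^sup>2 * (vol k X * vol k Y) \<le>
      exp (- loss_rate C \<tau> L * (\<Sum>j<Suc m'. \<tau> ^ j)) / L\<^sup>2 * (vol k X * vol k Y)"
    by (intro mult_right_mono) (auto simp: vol_nonneg)
  also have "\<dots> \<le> vol k (X ** Y)"
    using almost_multiplicative_aux[OF X, of Y m'] Y N m' by (simp add: mult_ac)
  finally show ?thesis by (simp add: mult_ac)
qed

end

lemma gap_mult_le:
  fixes X Y :: "real^'n^'n"
  assumes inv: "invertible X" "invertible Y" and k: "k \<le> CARD('n)"
    and c: "0 < c" "c * vol k X * vol k Y \<le> vol k (X ** Y)"
  shows "gap k (X ** Y) \<le> gap k X * gap k Y / c\<^sup>2"
proof -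
  have v: "0 < vol k X" "0 < vol k Y" using vol_pos inv k by auto
  have "gap k (X ** Y) \<le> (vol (k + 1) X * vol (k + 1) Y) * (vol (k - 1) X * vol (k - 1) Y) / (c * vol k X * vol k Y)\<^sup>2"
    unfolding gap_def using c v
    by (intro frac_le mult_mono power_mono vol_mult_le) (auto simp: vol_nonneg)
  thus ?thesis by (simp add: gap_def power_mult_distrib mult_ac)
qed

lemma gap_left_mult_le:
  fixes Z :: "real^'n^'n"
  assumes S: "vol_bounded L S" "A \<in> S" and L: "1 \<le> L" and Z: "invertible Z" and k: "k \<le> CARD('n)"
  shows "gap k (A ** Z) \<le> L ^ 4 * gap k Z"
proof -
  have v: "0 < vol k Z" by (rule vol_pos[OF Z k])
  have "vol k Z / L \<le> vol k (A ** Z)" using vol_bounded_mult(2)[OF S, of k Z] L by (simp add: field_simps)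
  hence "gap k (A ** Z) \<le> (L * vol (k + 1) Z) * (L * vol (k - 1) Z) / (vol k Z / L)\<^sup>2"
    unfolding gap_def using v L vol_bounded_mult(1)[OF S]
    by (intro frac_le mult_mono power_mono) (auto simp: vol_nonneg)
  also have "\<dots> = L ^ 4 * gap k Z" by (simp add: gap_def power_divide power4_eq_xxxx power2_eq_square)
  finally show ?thesis .
qed

lemma gaps_decay_mono:
  assumes "gaps_decay k C \<tau> N S" "C \<le> C'" "0 \<le> \<tau>"
  shows "gaps_decay k C' \<tau> N S"
  unfolding gaps_decay_def
proof (intro ballI)
  fix n Z assume "n \<in> {1..N}" "Z \<in> products n S"
  hence "gap k Z \<le> C * \<tau> ^ n" using assms(1) by (auto simp: gaps_decay_def)
  also have "\<dots> \<le> C' * \<tau> ^ n" using assms by (intro mult_right_mono) auto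
  finally show "gap k Z \<le> C' * \<tau> ^ n" .
qed

text \<open>The constant \<open>c\<close> of almost multiplicativity depends on \<open>C\<close>, \<open>\<tau>\<close> and \<open>L\<close> only, so \<open>n0\<close> can be chosen afterwards
  with \<open>C * \<tau> ^ n0 \<le> c\<^sup>2\<close>. Given decay up to length \<open>N\<close>, decay up to length \<open>N + 1\<close> holds at once with the
  worse constant \<open>C'\<close>; this already yields almost multiplicativity with \<open>c\<close>, and splitting off a prefix
  of length \<open>n0\<close>, whose gap decays at the faster rate \<open>\<tau>\<^sup>2\<close>, restores the constant \<open>C\<close>.\<close>

lemma gaps_decay_extend:
  fixes k :: nat and C \<tau> L :: real
  assumes k: "1 \<le> k" "k \<le> CARD('n)" and C: "1 \<le> C" and \<tau>: "0 < \<tau>" "\<tau> < 1" and L: "1 \<le> L"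
  shows "\<exists>n0\<ge>1. \<exists>c>0. \<forall>S :: (real^'n^'n) set. vol_bounded L S \<longrightarrow> gaps_decay k C (\<tau>\<^sup>2) n0 S \<longrightarrow>
    (\<forall>l m. 1 \<le> m \<longrightarrow> (\<forall>X\<in>products l S. \<forall>Y\<in>products m S. c * vol k X * vol k Y \<le> vol k (X ** Y)))"
proof -
  define C' where "C' = L ^ 4 * C / \<tau>"
  have C'C: "C \<le> C'"
  proof -
    have "C * \<tau> \<le> C * L ^ 4" using C \<tau> one_le_power[OF L, of 4] by (intro mult_left_mono) auto
    thus ?thesis using \<tau> by (simp add: C'_def field_simps)
  qed
  define c where "c = exp (- loss_rate C' \<tau> L / (1 - \<tau>)) / L\<^sup>2"
  have c: "c > 0" using L by (simp add: c_def)
  have am: "c * vol k X * vol k Y \<le> vol k (X ** Y)"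
    if "vol_bounded L S" "gaps_decay k C' \<tau> N S" "X \<in> products l S" "Y \<in> products m S" "1 \<le> m" "l + m \<le> N"
    for S :: "(real^'n^'n) set" and l m N X Y
    using almost_multiplicative_decay[OF k _ \<tau> L that] C C'C by (simp add: c_def)
  obtain n0 where n0: "\<tau> ^ n0 < c\<^sup>2 / C" "n0 \<ge> 1"
  proof -
    obtain n where "\<tau> ^ n < c\<^sup>2 / C" using real_arch_pow_inv[of "c\<^sup>2 / C" \<tau>] c C \<tau> by auto
    moreover have "\<tau> ^ Suc n \<le> \<tau> ^ n" using \<tau> by (intro power_decreasing) auto
    ultimately show thesis using that[of "Suc n"] by auto
  qed
  have "gaps_decay k C \<tau> N S" if S: "vol_bounded L S" and d: "gaps_decay k C (\<tau>\<^sup>2) n0 S" for S :: "(real^'n^'n) set" and N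
  proof (induction N)
    case 0
    show ?case by (simp add: gaps_decay_def)
  next
    case (Suc N)
    have inv: "invertible P" if "P \<in> products n S" for P n
      using that S invertible_products by (metis vol_bounded_def)
    have short: "gap k Z \<le> C * \<tau> ^ n * \<tau> ^ n" if "1 \<le> n" "n \<le> n0" "Z \<in> products n S" for Z n
      using d that unfolding gaps_decay_def by (auto simp: power_mult[symmetric] power_add[symmetric] mult_2 mult.assoc)
    have "gap k Z \<le> C * \<tau> ^ Suc N" if Z: "Z \<in> products (Suc N) S" for Z
    proof (cases "Suc N \<le> n0")
      case True
      have "gap k Z \<le> C * \<tau> ^ Suc N * \<tau> ^ Suc N" using short[OF _ True Z] by simp
      also have "\<dots> \<le> C * \<tau> ^ Suc N * 1"
        using C \<tau> by (intro mult_left_mono power_le_one) auto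
      finally show ?thesis by simp
    next
      case False
      have d': "gaps_decay k C' \<tau> (Suc N) S"
        unfolding gaps_decay_def
      proof (intro ballI)
        fix n W assume n: "n \<in> {1..Suc N}" and W: "W \<in> products n S"
        show "gap k W \<le> C' * \<tau> ^ n"
        proof (cases "n = Suc N")
          case False
          hence "gap k W \<le> C * \<tau> ^ n" using Suc n W unfolding gaps_decay_def by auto
          also have "\<dots> \<le> C' * \<tau> ^ n" using C'C \<tau> by (intro mult_right_mono) auto
          finally show ?thesis .
        next
          case True
          then obtain A W' where W': "A \<in> S" "W' \<in> products N S" "W = A ** W'" using W by auto
          have "gap k W' \<le> C * \<tau> ^ N"
            using Suc W' False \<open>\<not> Suc N \<le> n0\<close> n0(2) unfolding gaps_decay_def by auto
          hence "gap k W \<le> L ^ 4 * (C * \<tau> ^ N)"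
            using gap_left_mult_le[OF S W'(1) L inv[OF W'(2)] k(2)] W' L
            by (meson mult_left_mono order_trans zero_le_power zero_le_one)
          also have "\<dots> = C' * \<tau> ^ n" using \<tau> by (simp add: C'_def True)
          finally show ?thesis .
        qed
      qed
      define m where "m = Suc N - n0"
      have m: "n0 + m = Suc N" "1 \<le> m" "m \<le> N" using False n0(2) by (auto simp: m_def)
      obtain X Y where XY: "X \<in> products n0 S" "Y \<in> products m S" "Z = X ** Y"
        using Z m(1) by (metis products_splitE)
      have "gap k Z \<le> gap k X * gap k Y / c\<^sup>2"
        unfolding XY(3) using am[OF S d' XY(1,2) m(2)] m(1)
        by (intro gap_mult_le inv[OF XY(1)] inv[OF XY(2)] k c) auto
      also have "\<dots> \<le> (C * \<tau> ^ n0 * \<tau> ^ n0) * (C * \<tau> ^ m) / c\<^sup>2"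
        using short[OF n0(2) _ XY(1)] Suc XY(2) m C \<tau> unfolding gaps_decay_def
        by (intro divide_right_mono mult_mono) (auto simp: gap_nonneg)
      also have "\<dots> = (C * \<tau> ^ (n0 + m)) * (\<tau> ^ n0 * C / c\<^sup>2)" by (simp add: power_add)
      also have "\<dots> \<le> (C * \<tau> ^ (n0 + m)) * 1"
        using n0(1) C c \<tau> by (intro mult_left_mono) (auto simp: field_simps)
      finally show ?thesis using m(1) by simp
    qed
    thus ?case using Suc unfolding gaps_decay_def by (metis atLeastAtMost_iff le_Suc_eq)
  qed
  hence "gaps_decay k C' \<tau> N S"
    if "vol_bounded L S" "gaps_decay k C (\<tau>\<^sup>2) n0 S" for S :: "(real^'n^'n) set" and N
    using that C'C \<tau> by (intro gaps_decay_mono[where C = C and C' = C']) auto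
  hence "c * vol k X * vol k Y \<le> vol k (X ** Y)"
    if "vol_bounded L S" "gaps_decay k C (\<tau>\<^sup>2) n0 S" "X \<in> products l S" "Y \<in> products m S" "1 \<le> m"
    for S :: "(real^'n^'n) set" and l m X Y
    using that by (intro am[where N = "l + m"]) auto
  thus ?thesis using n0(2) c by blast
qed

section \<open>Lower semicontinuity under domination\<close>

lemma norm_le_op_norm: "norm M \<le> real CARD('m) * real CARD('n) * op_norm M" for M :: "real^'n^'m"
proof -
  have entry: "\<bar>M $ i $ j\<bar> \<le> op_norm M" for i j
  proof -
    have "\<bar>M $ i $ j\<bar> = \<bar>(M *v axis j 1) $ i\<bar>" by (simp add: matrix_vector_mult_basis column_def)
    also have "\<dots> \<le> norm (M *v axis j 1)" by (rule component_le_norm_cart)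
    also have "\<dots> \<le> op_norm M" using op_norm_apply[of M "axis j 1"] by simp
    finally show ?thesis .
  qed
  have "norm M \<le> (\<Sum>i\<in>UNIV. norm (M $ i))" unfolding norm_vec_def by (rule L2_set_le_sum) simp
  also have "\<dots> \<le> (\<Sum>i\<in>(UNIV::'m set). \<Sum>j\<in>(UNIV::'n set). \<bar>M $ i $ j\<bar>)" by (intro sum_mono norm_le_l1_cart)
  also have "\<dots> \<le> (\<Sum>i\<in>(UNIV::'m set). \<Sum>j\<in>(UNIV::'n set). op_norm M)" by (intro sum_mono entry)
  finally show ?thesis by simp
qed

lemma compact_subset_open_op_norm:
  fixes K :: "(real^'n^'m) set"
  assumes "compact K" "open W" "K \<subseteq> W"
  shows "\<exists>\<epsilon>>0. \<forall>P\<in>K. \<forall>Q. op_norm (P - Q) \<le> \<epsilon> \<longrightarrow> Q \<in> W"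
proof -
  obtain e where e: "e > 0" "(\<Union>x\<in>K. ball x e) \<subseteq> W"
    using compact_subset_open_imp_ball_epsilon_subset[OF assms] by blast
  define c where "c = real CARD('m) * real CARD('n)"
  have c: "c > 0" by (simp add: c_def)
  have "Q \<in> W" if "P \<in> K" "op_norm (P - Q) \<le> e / (2 * c)" for P Q
  proof -
    have "norm (P - Q) \<le> c * (e / (2 * c))"
      using norm_le_op_norm[of "P - Q"] mult_left_mono[OF that(2), of c] c by (simp add: c_def)
    hence "dist P Q < e" using c e by (simp add: dist_norm)
    thus ?thesis using e(2) that(1) by (meson UN_I mem_ball subsetD)
  qed
  thus ?thesis using e c by (intro exI[of _ "e / (2 * c)"]) auto
qed

text \<open>One-sided Hausdorff distance: only the distance of points of \<open>T\<close> from \<open>S\<close> matters for bounds that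
  hold for all products from \<open>T\<close>.\<close>

definition near :: "real \<Rightarrow> (real^'n^'n) set \<Rightarrow> (real^'n^'n) set \<Rightarrow> bool" where
  "near \<delta> S T \<longleftrightarrow> (\<forall>B\<in>T. \<exists>A\<in>S. op_norm (A - B) \<le> \<delta>)"

lemma near_mono: "near \<delta> S T \<Longrightarrow> \<delta> \<le> \<delta>' \<Longrightarrow> near \<delta>' S T"
  unfolding near_def by (meson order_trans)

lemma op_norm_products_le:
  fixes S :: "(real^'n^'n) set"
  assumes "\<And>A. A \<in> S \<Longrightarrow> op_norm A \<le> b" "0 \<le> b"
  shows "P \<in> products n S \<Longrightarrow> op_norm P \<le> b ^ n"
proof (induction n arbitrary: P)
  case 0
  thus ?case by (auto intro: op_norm_le)
next
  case (Suc n)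
  then obtain A P' where P: "A \<in> S" "P' \<in> products n S" "P = A ** P'" by auto
  have "op_norm P \<le> op_norm A * op_norm P'" unfolding P(3) by (rule op_norm_mult)
  also have "\<dots> \<le> b * b ^ n" using P assms Suc.IH by (intro mult_mono) (auto simp: op_norm_nonneg)
  finally show ?case by simp
qed

lemma matrix_diff_mult: "(A - B) ** C = A ** C - B ** (C :: real^'k^'n)" for A B :: "real^'n^'m"
  by (simp add: vec_eq_iff matrix_matrix_mult_def left_diff_distrib sum_subtractf)

lemma matrix_mult_diff: "A ** (B - C) = A ** B - A ** (C :: real^'k^'n)" for A :: "real^'n^'m"
  by (simp add: vec_eq_iff matrix_matrix_mult_def right_diff_distrib sum_subtractf)

text \<open>Continuity of multiplication, uniform in \<open>T\<close>: this is where the Hausdorff distance enters.\<close>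

lemma products_near:
  fixes S :: "(real^'n^'n) set"
  assumes b: "\<And>A. A \<in> S \<Longrightarrow> op_norm A \<le> b" "1 \<le> b"
  shows "0 < \<epsilon> \<Longrightarrow> \<exists>\<delta>>0. \<forall>T. near \<delta> S T \<longrightarrow> (\<forall>Q\<in>products n T. \<exists>P\<in>products n S. op_norm (P - Q) \<le> \<epsilon>)"
proof (induction n arbitrary: \<epsilon>)
  case 0
  have "op_norm (mat 1 - mat 1 :: real^'n^'n) = 0" by (simp add: op_norm_eq_0)
  thus ?case using 0 by (intro exI[of _ 1]) auto
next
  case (Suc n)
  define \<epsilon>' where "\<epsilon>' = min 1 (\<epsilon> / (2 * b))"
  have e': "0 < \<epsilon>'" "\<epsilon>' \<le> 1" "b * \<epsilon>' \<le> \<epsilon> / 2" using Suc.prems b(2) by (auto simp: \<epsilon>'_def min_def field_simps)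
  obtain \<delta>1 where \<delta>1: "\<delta>1 > 0"
    "\<And>T Q. near \<delta>1 S T \<Longrightarrow> Q \<in> products n T \<Longrightarrow> \<exists>P\<in>products n S. op_norm (P - Q) \<le> \<epsilon>'"
    using Suc.IH[OF e'(1)] by blast
  define \<delta> where "\<delta> = min \<delta>1 (\<epsilon> / (2 * (b ^ n + 1)))"
  have bn: "b ^ n + 1 > 0" using b(2) by (simp add: add_nonneg_pos)
  have \<delta>: "\<delta> > 0" "\<delta> \<le> \<delta>1" using \<delta>1(1) Suc.prems bn by (auto simp: \<delta>_def)
  have \<delta>': "\<delta> * (b ^ n + 1) \<le> \<epsilon> / 2"
  proof -
    have "\<delta> \<le> \<epsilon> / (2 * (b ^ n + 1))" by (simp add: \<delta>_def)
    thus ?thesis using bn by (simp add: field_simps)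
  qed
  have "\<exists>P\<in>products (Suc n) S. op_norm (P - Q) \<le> \<epsilon>" if T: "near \<delta> S T" and Q: "Q \<in> products (Suc n) T" for T Q
  proof -
    obtain B Q' where BQ: "B \<in> T" "Q' \<in> products n T" "Q = B ** Q'" using Q by auto
    obtain A where A: "A \<in> S" "op_norm (A - B) \<le> \<delta>" using T BQ(1) by (auto simp: near_def)
    obtain P where P: "P \<in> products n S" "op_norm (P - Q') \<le> \<epsilon>'"
      using \<delta>1(2)[OF near_mono[OF T \<delta>(2)] BQ(2)] by blast
    have "op_norm Q' \<le> op_norm P + op_norm (Q' - P)" using op_norm_triangle[of P "Q' - P"] by simp
    also have "\<dots> \<le> b ^ n + 1"
      using op_norm_products_le[OF b(1) _ P(1)] b(2) P(2) e'(2) by (simp add: op_norm_minus_commute[of Q' P])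
    finally have Q': "op_norm Q' \<le> b ^ n + 1" .
    have "A ** P - Q = (A - B) ** Q' + A ** (P - Q')"
      by (simp add: BQ(3) matrix_diff_mult matrix_mult_diff)
    hence "op_norm (A ** P - Q) \<le> op_norm (A - B) * op_norm Q' + op_norm A * op_norm (P - Q')"
      using op_norm_triangle[of "(A - B) ** Q'" "A ** (P - Q')"] op_norm_mult[of "A - B" Q'] op_norm_mult[of A "P - Q'"]
      by simp
    also have "\<dots> \<le> \<delta> * (b ^ n + 1) + b * \<epsilon>'"
      using A Q' P b \<delta>(1) by (intro add_mono mult_mono) (auto simp: op_norm_nonneg)
    also have "\<dots> \<le> \<epsilon>" using \<delta>' e'(3) by simp
    finally show ?thesis using A(1) P(1) by auto
  qed
  thus ?case using \<delta>(1) by blast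
qed

lemma continuous_on_matrix_mult_pair:
  "continuous_on W (\<lambda>x. fst x ** snd x :: real^'k^'m)" for W :: "((real^'n^'m) \<times> (real^'k^'n)) set"
  unfolding matrix_matrix_mult_def by (intro continuous_intros continuous_on_vec_lambda)

lemma compact_products:
  fixes S :: "(real^'n^'n) set"
  assumes "compact S"
  shows "compact (products n S)"
proof (induction n)
  case (Suc n)
  have "products (Suc n) S = (\<lambda>x. fst x ** snd x) ` (S \<times> products n S)" by force
  thus ?case using Suc assms
    by (auto intro!: compact_continuous_image compact_Times continuous_on_matrix_mult_pair)
qed simp

lemma continuous_on_vol: "continuous_on UNIV (vol k :: real^'n^'n \<Rightarrow> real)"
proof -
  have "continuous_on UNIV (\<lambda>A :: real^'n^'n. ext_power k A $ U $ T)" for U T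
  proof (cases "card U = k \<and> card T = k")
    case True
    hence "card U = k" "card T = k" by auto
    thus ?thesis by (simp only: ext_power_component) (intro continuous_intros)
  next
    case False
    hence "ext_power k A $ U $ T = 0" for A :: "real^'n^'n" by (auto simp: ext_power_def wedge_def)
    thus ?thesis by simp
  qed
  hence "continuous_on UNIV (\<lambda>A :: real^'n^'n. \<chi> U T. ext_power k A $ U $ T)"
    by (intro continuous_on_vec_lambda)
  hence "continuous_on UNIV (\<lambda>A :: real^'n^'n. ext_power k A)" by simp
  thus ?thesis unfolding vol_def by (intro continuous_on_compose2[OF continuous_on_op_norm[of UNIV]]) auto
qed

lemma products_subset_open:
  fixes S :: "(real^'n^'n) set"
  assumes S: "compact S" and W: "open W" "products n S \<subseteq> W"
  shows "\<exists>\<delta>>0. \<forall>T. near \<delta> S T \<longrightarrow> products n T \<subseteq> W"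
proof -
  obtain \<epsilon> where e: "\<epsilon> > 0" "\<And>P Q. P \<in> products n S \<Longrightarrow> op_norm (P - Q) \<le> \<epsilon> \<Longrightarrow> Q \<in> W"
    using compact_subset_open_op_norm[OF compact_products[OF S] W] by blast
  have "bounded (op_norm ` S)"
    by (intro compact_imp_bounded compact_continuous_image continuous_on_op_norm S)
  then obtain b0 where "\<And>A. A \<in> S \<Longrightarrow> op_norm A \<le> b0"
    by (metis bounded_iff image_eqI real_norm_def abs_le_D1)
  hence "\<And>A. A \<in> S \<Longrightarrow> op_norm A \<le> max b0 1" by (meson max.coboundedI1)
  from products_near[of S "max b0 1", OF this _ e(1), of n]
  obtain \<delta> where "\<delta> > 0" "\<forall>T. near \<delta> S T \<longrightarrow> (\<forall>Q\<in>products n T. \<exists>P\<in>products n S. op_norm (P - Q) \<le> \<epsilon>)"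
    by (auto simp del: products.simps)
  thus ?thesis using e(2) by (meson subsetI)
qed

text \<open>On the compact set of pairs of a matrix in \<open>S\<close> and a unit vector the expansion attains a positive
  minimum, and a perturbation by half of it keeps the matrices uniformly invertible.\<close>

lemma bounded_GL_near:
  fixes S :: "(real^'n^'n) set"
  assumes S: "S \<in> compact_GL"
  shows "\<exists>b\<ge>1. \<exists>\<delta>>0. \<forall>T. near \<delta> S T \<longrightarrow> bounded_GL b T"
proof -
  have cS: "compact S" "S \<noteq> {}" "\<And>A. A \<in> S \<Longrightarrow> invertible A" using S by (auto simp: compact_GL_def)
  have "bounded (op_norm ` S)"
    by (intro compact_imp_bounded compact_continuous_image continuous_on_op_norm cS)
  then obtain b0 where b0: "\<And>A. A \<in> S \<Longrightarrow> op_norm A \<le> b0"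
    by (metis bounded_iff image_eqI real_norm_def abs_le_D1)
  define W where "W = S \<times> sphere (0::real^'n) 1"
  have "compact W" "W \<noteq> {}" using cS by (auto simp: W_def compact_Times)
  moreover have "continuous_on W (\<lambda>x. norm (fst x *v snd x))"
    unfolding matrix_vector_mult_def by (intro continuous_intros continuous_on_vec_lambda)
  ultimately obtain w where w: "w \<in> W" "\<And>x. x \<in> W \<Longrightarrow> norm (fst w *v snd w) \<le> norm (fst x *v snd x)"
    using continuous_attains_inf[of W "\<lambda>x. norm (fst x *v snd x)"] by blast
  define \<mu> where "\<mu> = norm (fst w *v snd w)"
  have "fst w *v snd w \<noteq> 0"
  proof
    assume 0: "fst w *v snd w = 0"
    have "invertible (fst w)" "snd w \<noteq> 0" using w(1) cS(3) by (auto simp: W_def)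
    thus False using 0 by (metis invertible_left_inverse matrix_left_invertible_ker)
  qed
  hence \<mu>: "\<mu> > 0" by (simp add: \<mu>_def)
  have lower: "\<mu> * norm x \<le> norm (A *v x)" if "A \<in> S" for A x
  proof (cases "x = 0")
    case False
    have "\<mu> \<le> norm (A *v (x /\<^sub>R norm x))"
      using w(2)[of "(A, x /\<^sub>R norm x)"] that False by (simp add: W_def \<mu>_def)
    thus ?thesis using False by (simp add: matrix_vector_mult_scaleR field_simps)
  qed simp
  define \<delta> where "\<delta> = \<mu> / 2"
  define b where "b = max 1 (max (b0 + \<delta>) (1 / \<delta>))"
  have \<delta>: "\<delta> > 0" using \<mu> by (simp add: \<delta>_def)
  have "bounded_GL b T" if T: "near \<delta> S T" for T
    unfolding bounded_GL_def
  proof (intro ballI conjI allI)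
    fix B assume "B \<in> T"
    then obtain A where A: "A \<in> S" "op_norm (A - B) \<le> \<delta>" using T by (auto simp: near_def)
    have "op_norm B \<le> op_norm A + op_norm (B - A)" using op_norm_triangle[of A "B - A"] by simp
    thus "op_norm B \<le> b" using A b0[OF A(1)] by (simp add: b_def op_norm_minus_commute[of B A])
    fix x
    have "norm (A *v x) \<le> norm (B *v x) + norm ((A - B) *v x)"
      using norm_triangle_ineq[of "B *v x" "(A - B) *v x"] by (simp add: matrix_vector_mult_diff_rdistrib)
    also have "norm ((A - B) *v x) \<le> \<delta> * norm x"
      using op_norm_apply[of "A - B" x] A(2) by (meson mult_right_mono norm_ge_zero order_trans)
    finally have "\<delta> * norm x \<le> norm (B *v x)" using lower[OF A(1), of x] by (simp add: \<delta>_def)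
    hence "norm x \<le> 1 / \<delta> * norm (B *v x)" using \<delta> by (simp add: field_simps)
    also have "\<dots> \<le> b * norm (B *v x)" by (intro mult_right_mono) (auto simp: b_def)
    finally show "norm x \<le> b * norm (B *v x)" .
  qed
  moreover have "b \<ge> 1" by (simp add: b_def)
  ultimately show ?thesis using \<delta> by blast
qed

lemma near_GL_dist:
  assumes "S \<in> compact_GL" "T \<in> compact_GL" "GL_dist S T \<le> \<delta>"
  shows "near \<delta> S T"
  using assms hausdorff_dist_le_iff[of S T \<delta>] by (auto simp: near_def GL_dist_def compact_GL_def)

lemma ext_power_image_products:
  "1 \<le> n \<Longrightarrow> P \<in> products n S \<Longrightarrow> ext_power k P \<in> products n (ext_power k ` S)"
proof (induction n arbitrary: P)
  case (Suc n)
  then obtain A P' where P: "A \<in> S" "P' \<in> products n S" "P = A ** P'" by auto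
  show ?case
  proof (cases "n = 0")
    case True thus ?thesis using P by auto
  next
    case False
    hence "ext_power k P' \<in> products n (ext_power k ` S)" using Suc P by auto
    thus ?thesis using P by (auto simp: ext_power_mult)
  qed
qed simp

lemma products_ext_power_image:
  "1 \<le> n \<Longrightarrow> Q \<in> products n (ext_power k ` S) \<Longrightarrow> \<exists>P\<in>products n S. Q = ext_power k P"
proof (induction n arbitrary: Q)
  case (Suc n)
  then obtain A Q' where Q: "A \<in> S" "Q' \<in> products n (ext_power k ` S)" "Q = ext_power k A ** Q'" by auto
  show ?case
  proof (cases "n = 0")
    case True thus ?thesis using Q by auto
  next
    case False
    then obtain P' where "P' \<in> products n S" "Q' = ext_power k P'" using Suc Q by auto
    moreover from this have "A ** P' \<in> products (Suc n) S" using Q by auto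
    ultimately show ?thesis using Q by (metis ext_power_mult)
  qed
qed simp

lemma bdd_below_root_op_norm: "bdd_below ((\<lambda>P. root n (op_norm P)) ` X)"
  for X :: "(real^'n^'n) set"
  by (rule bdd_belowI2[of _ 0]) (simp add: op_norm_nonneg real_root_ge_zero)

lemma lower_spectral_radius_le:
  fixes S :: "(real^'n^'n) set"
  assumes "S \<noteq> {}" "1 \<le> n" "P \<in> products n S"
  shows "lower_spectral_radius S ^ n \<le> op_norm P" and "0 \<le> lower_spectral_radius S"
proof -
  let ?f = "\<lambda>n. INF P\<in>products n S. root n (op_norm P)"
  have f0: "0 \<le> ?f n" for n
    using products_nonempty[OF assms(1)] by (intro cINF_greatest) (auto simp: op_norm_nonneg real_root_ge_zero)
  show 0: "0 \<le> lower_spectral_radius S"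
    by (rule LIMSEQ_le_const[OF lower_spectral_radius_LIMSEQ[OF assms(1)]]) (use f0 in auto)
  have "lower_spectral_radius S \<le> ?f n"
    unfolding lower_spectral_radius_eq_INF[OF assms(1)]
    using assms(2) f0 by (intro cINF_lower bdd_belowI2[of _ 0]) auto
  also have "\<dots> \<le> root n (op_norm P)" using assms(3) by (intro cINF_lower bdd_below_root_op_norm)
  finally have "lower_spectral_radius S ^ n \<le> root n (op_norm P) ^ n" using 0 by (intro power_mono)
  thus "lower_spectral_radius S ^ n \<le> op_norm P" using assms(2) by (simp add: op_norm_nonneg)
qed

text \<open>Lengths divisible by a fixed \<open>n\<close> suffice, because the radius is a limit along all lengths.\<close>

lemma lower_spectral_radius_ge:
  fixes S :: "(real^'n^'n) set"
  assumes S: "S \<noteq> {}" and n: "1 \<le> n" and w: "0 \<le> w"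
    and le: "\<And>q P. 1 \<le> q \<Longrightarrow> P \<in> products (q * n) S \<Longrightarrow> w ^ (q * n) \<le> op_norm P"
  shows "w \<le> lower_spectral_radius S"
proof (rule LIMSEQ_le_const)
  let ?f = "\<lambda>n. INF P\<in>products n S. root n (op_norm P)"
  have "strict_mono (\<lambda>q. Suc q * n)" using n by (intro strict_monoI) simp
  from LIMSEQ_subseq_LIMSEQ[OF lower_spectral_radius_LIMSEQ[OF S] this]
  show "(\<lambda>q. ?f (Suc q * n)) \<longlonglongrightarrow> lower_spectral_radius S" by (simp add: o_def)
  have "w \<le> ?f (Suc q * n)" for q
  proof (rule cINF_greatest[OF products_nonempty[OF S]])
    fix P assume "P \<in> products (Suc q * n) S"
    hence "w ^ (Suc q * n) \<le> op_norm P" by (intro le) auto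
    hence "root (Suc q * n) (w ^ (Suc q * n)) \<le> root (Suc q * n) (op_norm P)" using n by simp
    thus "w \<le> root (Suc q * n) (op_norm P)" using n w by (subst (asm) real_root_power_cancel) auto
  qed
  thus "\<exists>N. \<forall>q\<ge>N. w \<le> ?f (Suc q * n)" by blast
qed

lemma lower_spectral_radius_ext_power:
  fixes S :: "(real^'n^'n) set"
  assumes "S \<noteq> {}"
  shows "1 \<le> n \<Longrightarrow> P \<in> products n S \<Longrightarrow> lower_spectral_radius (ext_power k ` S) ^ n \<le> vol k P"
    and "0 \<le> lower_spectral_radius (ext_power k ` S)"
proof -
  have ne: "ext_power k ` S \<noteq> {}" using assms by simp
  show "lower_spectral_radius (ext_power k ` S) ^ n \<le> vol k P" if "1 \<le> n" "P \<in> products n S"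
    unfolding vol_def using that by (intro lower_spectral_radius_le(1)[OF ne] ext_power_image_products)
  obtain Q where "Q \<in> products 1 (ext_power k ` S)" using ne products_nonempty[OF ne, of 1] by blast
  thus "0 \<le> lower_spectral_radius (ext_power k ` S)" by (rule lower_spectral_radius_le(2)[OF ne order_refl])
qed

text \<open>Almost multiplicativity makes \<open>c * v\<close> a supermultiplicative lower bound, cutting a product into blocks
  of length \<open>n\<close>.\<close>

lemma vol_products_lower:
  fixes S :: "(real^'n^'n) set"
  assumes c: "0 < c" "c \<le> 1" and v: "0 \<le> v" and n: "1 \<le> n"
    and am: "\<And>l m X Y. 1 \<le> m \<Longrightarrow> X \<in> products l S \<Longrightarrow> Y \<in> products m S \<Longrightarrow> c * vol k X * vol k Y \<le> vol k (X ** Y)"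
    and vle: "\<And>P. P \<in> products n S \<Longrightarrow> v \<le> vol k P"
  shows "P \<in> products (Suc q * n) S \<Longrightarrow> (c * v) ^ Suc q \<le> vol k P"
proof (induction q arbitrary: P)
  case 0
  have "c * v \<le> 1 * v" using c v by (intro mult_right_mono) auto
  thus ?case using vle[of P] 0 by simp
next
  case (Suc q)
  have "P \<in> products (n + Suc q * n) S" using Suc.prems by simp
  then obtain X Y where XY: "X \<in> products n S" "Y \<in> products (Suc q * n) S" "P = X ** Y"
    by (rule products_splitE)
  have "(c * v) ^ Suc (Suc q) = c * v * (c * v) ^ Suc q" by simp
  also have "\<dots> \<le> c * vol k X * vol k Y"
    using c v vle[OF XY(1)] Suc.IH[OF XY(2)] by (intro mult_mono mult_left_mono) (auto simp: vol_nonneg)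
  also have "\<dots> \<le> vol k P" unfolding XY(3) using n by (intro am[OF _ XY(1,2)]) simp
  finally show ?case .
qed

text \<open>For \<open>k\<close> equal to the dimension, domination is a convention and the gap is \<open>0\<close>, since there are no
  nonzero exterior products of higher degree.\<close>

lemma dominated_gap_decay:
  fixes S :: "(real^'n^'n) set"
  assumes S: "\<And>A. A \<in> S \<Longrightarrow> invertible A" and dom: "dominated k S"
  shows "\<exists>C\<ge>1. \<exists>\<tau>. 0 < \<tau> \<and> \<tau> < 1 \<and> (\<forall>n\<ge>1. \<forall>P\<in>products n S. gap k P \<le> C * \<tau> ^ n)"
proof (cases "k = CARD('n)")
  case True
  hence "gap k P = 0" for P :: "real^'n^'n" using vol_gt_CARD[of "k + 1" P] by (simp add: gap_def)
  thus ?thesis by (intro exI[of _ 1] conjI exI[of _ "1/2"]) auto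
next
  case False
  then obtain C \<tau> where k: "1 \<le> k" "k < CARD('n)" and C: "C > 1" "0 < \<tau>" "\<tau> < 1"
      "\<forall>n\<ge>1. \<forall>P\<in>products n S. singular_value (k + 1) P / singular_value k P \<le> C * \<tau> ^ n"
    using dom by (auto simp: dominated_def)
  thus ?thesis using gap_eq_singular_value_ratio[OF invertible_products[OF S] k]
    by (intro exI[of _ C] conjI exI[of _ \<tau>]) auto
qed

lemma lower_spectral_radius_lower_semicontinuous:
  fixes S :: "(real^'n^'n) set"
  assumes S: "S \<in> compact_GL" and k: "1 \<le> k" "k \<le> CARD('n)" and dom: "dominated k S"
    and w: "0 \<le> w" "w ^ k < lower_spectral_radius (ext_power k ` S)"
  shows "\<exists>\<delta>>0. \<forall>T\<in>compact_GL. near \<delta> S T \<longrightarrow> w \<le> lower_spectral_radius T"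
proof -
  have cS: "compact S" "S \<noteq> {}" "\<And>A. A \<in> S \<Longrightarrow> invertible A" using S by (auto simp: compact_GL_def)
  define r where "r = lower_spectral_radius (ext_power k ` S)"
  have r: "0 \<le> w ^ k" "w ^ k < r" using w by (auto simp: r_def)
  obtain C \<tau> where C: "1 \<le> C" "0 < \<tau>" "\<tau> < 1" "\<And>n P. n \<ge> 1 \<Longrightarrow> P \<in> products n S \<Longrightarrow> gap k P \<le> C * \<tau> ^ n"
    using dominated_gap_decay[OF cS(3) dom] by blast
  obtain b \<delta>0 where b: "1 \<le> b" "0 < \<delta>0" "\<And>T. near \<delta>0 S T \<Longrightarrow> bounded_GL b T"
    using bounded_GL_near[OF S] by blast
  define L where "L = b ^ CARD('n)"
  have L: "1 \<le> L" using b by (simp add: L_def one_le_power)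
  have "0 < sqrt \<tau>" "sqrt \<tau> < 1" "1 \<le> 2 * C" using C by auto
  from gaps_decay_extend[OF k this(3,1,2) L] C(2)
  obtain n0 c0 where n0: "1 \<le> n0" "0 < c0" and
    am0: "\<And>T :: (real^'n^'n) set. \<And>l m X Y. vol_bounded L T \<Longrightarrow> gaps_decay k (2 * C) \<tau> n0 T \<Longrightarrow> 1 \<le> m \<Longrightarrow>
      X \<in> products l T \<Longrightarrow> Y \<in> products m T \<Longrightarrow> c0 * vol k X * vol k Y \<le> vol k (X ** Y)"
    by (auto simp: less_imp_le)
  define c where "c = min c0 1"
  have c: "0 < c" "c \<le> 1" "c \<le> c0" using n0 by (auto simp: c_def)
  \<comment> \<open>decay up to a fixed length, with a slightly larger constant, is an open condition on \<open>S\<close>\<close>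
  have "\<exists>\<delta>>0. \<forall>T. near \<delta> S T \<longrightarrow> gaps_decay k (2 * C) \<tau> N T" for N
  proof (induction N)
    case 0
    show ?case by (intro exI[of _ 1]) (auto simp: gaps_decay_def)
  next
    case (Suc N)
    then obtain \<delta> where \<delta>: "\<delta> > 0" "\<And>T. near \<delta> S T \<Longrightarrow> gaps_decay k (2 * C) \<tau> N T" by blast
    define W where "W = {Q :: real^'n^'n. vol (k + 1) Q * vol (k - 1) Q < 2 * C * \<tau> ^ Suc N * (vol k Q)\<^sup>2}"
    have "open W" unfolding W_def by (intro open_Collect_less continuous_intros continuous_on_vol)
    moreover have "products (Suc N) S \<subseteq> W"
    proof
      fix P assume P: "P \<in> products (Suc N) S"
      have v: "0 < vol k P" by (rule vol_pos[OF invertible_products[OF cS(3) P] k(2)])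
      have "gap k P \<le> C * \<tau> ^ Suc N" by (rule C(4)[OF _ P]) simp
      also have "\<dots> < 2 * C * \<tau> ^ Suc N" using C by simp
      finally show "P \<in> W" using v by (simp add: W_def gap_def field_simps)
    qed
    ultimately obtain \<delta>' where \<delta>': "\<delta>' > 0" "\<And>T. near \<delta>' S T \<Longrightarrow> products (Suc N) T \<subseteq> W"
      using products_subset_open[OF cS(1)] by blast
    have "gaps_decay k (2 * C) \<tau> (Suc N) T" if T: "near (min \<delta> \<delta>') S T" for T
    proof -
      have "gap k P \<le> 2 * C * \<tau> ^ Suc N" if "P \<in> products (Suc N) T" for P
      proof -
        have PW: "P \<in> W" using that \<delta>'(2)[OF near_mono[OF T]] by auto
        hence "vol k P \<noteq> 0" using mult_nonneg_nonneg[OF vol_nonneg[of "k + 1" P] vol_nonneg[of "k - 1" P]]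
          by (auto simp: W_def)
        hence "0 < (vol k P)\<^sup>2" by simp
        thus ?thesis using PW by (simp add: W_def gap_def divide_le_eq)
      qed
      thus ?thesis using \<delta>(2)[OF near_mono[OF T]] unfolding gaps_decay_def
        by (metis atLeastAtMost_iff le_Suc_eq min.cobounded1)
    qed
    thus ?case using \<delta>(1) \<delta>'(1) by (intro exI[of _ "min \<delta> \<delta>'"]) auto
  qed
  then obtain \<delta>1 where \<delta>1: "\<delta>1 > 0" "\<And>T. near \<delta>1 S T \<Longrightarrow> gaps_decay k (2 * C) \<tau> n0 T" by blast
  \<comment> \<open>for long blocks, the strict inequality \<open>w ^ k < r\<close> outweighs both the factor \<open>c\<close> and the
    factor \<open>1/2\<close> given away when passing from \<open>S\<close> to \<open>T\<close>\<close>
  obtain n where n: "1 \<le> n" "(w ^ k) ^ n \<le> c * (r ^ n / 2)"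
  proof -
    have "w ^ k / r < 1" using r by simp
    then obtain n where n: "(w ^ k / r) ^ n < c / 2" using real_arch_pow_inv[of "c / 2" "w ^ k / r"] c by auto
    have "(w ^ k / r) ^ Suc n \<le> (w ^ k / r) ^ n" using r by (intro power_decreasing) (auto simp: field_simps)
    hence "(w ^ k / r) ^ Suc n \<le> c / 2" using n by linarith
    hence "(w ^ k) ^ Suc n / r ^ Suc n \<le> c / 2" by (simp only: power_divide)
    moreover have "r ^ Suc n > 0" using r by (intro zero_less_power) simp
    ultimately have "(w ^ k) ^ Suc n \<le> c * (r ^ Suc n / 2)" by (simp add: divide_le_eq)
    thus thesis using that[of "Suc n"] by simp
  qed
  define W where "W = {Q :: real^'n^'n. r ^ n / 2 < vol k Q}"
  have "open W" unfolding W_def by (intro open_Collect_less continuous_intros continuous_on_vol)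
  moreover have "products n S \<subseteq> W"
  proof
    fix P assume P: "P \<in> products n S"
    have "r ^ n \<le> vol k P" unfolding r_def by (rule lower_spectral_radius_ext_power(1)[OF cS(2) n(1) P])
    moreover have "0 < r ^ n" using r by (intro zero_less_power) simp
    ultimately show "P \<in> W" by (simp add: W_def)
  qed
  ultimately obtain \<delta>2 where \<delta>2: "\<delta>2 > 0" "\<And>T. near \<delta>2 S T \<Longrightarrow> products n T \<subseteq> W"
    using products_subset_open[OF cS(1)] by blast
  define \<delta> where "\<delta> = min \<delta>0 (min \<delta>1 \<delta>2)"
  have "w \<le> lower_spectral_radius T" if T: "T \<in> compact_GL" and nT: "near \<delta> S T" for T
  proof -
    have nT': "near \<delta>0 S T" "near \<delta>1 S T" "near \<delta>2 S T"
      using near_mono[OF nT] by (auto simp: \<delta>_def)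
    have bT: "bounded_GL b T" by (rule b(3)[OF nT'(1)])
    have vT: "vol_bounded L T" unfolding L_def by (rule vol_bounded_of_bounded_GL[OF bT b(1)])
    have am: "c * vol k X * vol k Y \<le> vol k (X ** Y)" if "1 \<le> m" "X \<in> products l T" "Y \<in> products m T" for l m X Y
    proof -
      have "c * (vol k X * vol k Y) \<le> c0 * (vol k X * vol k Y)"
        using c by (intro mult_right_mono mult_nonneg_nonneg vol_nonneg)
      thus ?thesis using am0[OF vT \<delta>1(2)[OF nT'(2)] that] by (simp add: mult_ac)
    qed
    show ?thesis
    proof (rule lower_spectral_radius_ge[OF _ n(1) w(1)])
      show "T \<noteq> {}" using T by (auto simp: compact_GL_def)
      fix q :: nat and P assume q: "1 \<le> q" and P: "P \<in> products (q * n) T"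
      obtain q' where q': "q = Suc q'" using q by (cases q) auto
      have invP: "invertible P" by (rule invertible_products[OF bounded_GL_invertible[OF bT] P])
      have "(w ^ (q * n)) ^ k = ((w ^ k) ^ n) ^ q"
        by (simp add: power_mult[symmetric] mult_ac)
      also have "\<dots> \<le> (c * (r ^ n / 2)) ^ q" using n(2) w(1) by (intro power_mono) auto
      also have "\<dots> \<le> vol k P"
        unfolding q' using \<delta>2(2)[OF nT'(3)] P q' r n(1)
        by (intro vol_products_lower[OF c(1,2) _ n(1) am]) (auto simp: W_def less_imp_le)
      also have "\<dots> \<le> op_norm P ^ k" by (rule vol_le_power[OF invP k(2)])
      finally show "w ^ (q * n) \<le> op_norm P"
        using k(1) w(1) op_norm_nonneg[of P] by (metis Suc_le_eq One_nat_def not_less power_strict_mono zero_less_iff_neq_zero)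
    qed
  qed
  moreover have "\<delta> > 0" using b \<delta>1 \<delta>2 by (simp add: \<delta>_def)
  ultimately show ?thesis by blast
qed

section \<open>Steering by small perturbations in the absence of domination\<close>

definition rank1 :: "real^'m \<Rightarrow> real^'n \<Rightarrow> real^'n^'m" where
  "rank1 a b = (\<chi> i j. a $ i * b $ j)"

lemma rank1_apply: "rank1 a b *v x = (b \<bullet> x) *\<^sub>R a"
  by (simp add: rank1_def vec_eq_iff matrix_vector_mult_def inner_vec_def sum_distrib_left mult_ac)

lemma op_norm_rank1_le: "op_norm (rank1 a b) \<le> norm a * norm b"
proof (rule op_norm_le)
  fix x
  have "norm (rank1 a b *v x) = \<bar>b \<bullet> x\<bar> * norm a" by (simp add: rank1_apply)
  also have "\<dots> \<le> (norm b * norm x) * norm a" by (intro mult_right_mono Cauchy_Schwarz_ineq2) simp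
  finally show "norm (rank1 a b *v x) \<le> norm a * norm b * norm x" by (simp add: mult_ac)
qed

lemma id_plus_rank1:
  fixes a b :: "real^'n"
  shows "op_norm ((mat 1 + rank1 a b) - mat 1) \<le> norm a * norm b"
    and "(mat 1 + rank1 a b) *v x = x + (b \<bullet> x) *\<^sub>R a"
  using op_norm_rank1_le[of a b] by (simp_all add: matrix_vector_mult_add_rdistrib rank1_apply)

lemma small_kick:
  fixes u v :: "real^'n"
  assumes "u \<noteq> 0"
  shows "\<exists>R. op_norm (R - mat 1) \<le> \<bar>c\<bar> * norm v / norm u \<and> R *v u = u + c *\<^sub>R v"
proof -
  let ?b = "(c / (u \<bullet> u)) *\<^sub>R u"
  have "norm v * norm ?b = \<bar>c\<bar> * norm v / norm u"
    using assms by (simp add: power2_norm_eq_inner[symmetric] power2_eq_square)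
  moreover have "?b \<bullet> u = c" using assms by simp
  ultimately show ?thesis using id_plus_rank1[of v ?b] by metis
qed

text \<open>If the directions of \<open>u\<close> and \<open>v\<close> nearly agree, up to sign, then adding a small multiple of the
  component \<open>w\<close> of \<open>sgn v\<close> orthogonal to \<open>u\<close> turns \<open>u\<close> into the direction of \<open>v\<close>.\<close>

lemma small_rotation:
  fixes u v :: "real^'n"
  assumes u: "u \<noteq> 0" and v: "v \<noteq> 0" and \<eta>: "0 < \<eta>" "\<eta> \<le> 1"
    and small: "norm (sgn v - (sgn v \<bullet> sgn u) *\<^sub>R sgn u) \<le> \<eta> / 2"
  shows "\<exists>R. op_norm (R - mat 1) \<le> \<eta> \<and> (\<exists>c\<noteq>0. R *v u = c *\<^sub>R v)"
proof -
  define c where "c = sgn v \<bullet> sgn u"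
  define w where "w = sgn v - c *\<^sub>R sgn u"
  have n: "norm (sgn u) = 1" "norm (sgn v) = 1" using u v by (simp_all add: norm_sgn)
  have "(norm w)\<^sup>2 = 1 - c\<^sup>2"
    using n unfolding power2_norm_eq_inner
    by (simp add: w_def c_def inner_diff inner_commute norm_eq_1 power2_eq_square)
  moreover have "(norm w)\<^sup>2 \<le> (1 / 2)\<^sup>2"
    using small \<eta> by (intro power_mono) (auto simp: w_def c_def)
  ultimately have "(1 / 2)\<^sup>2 \<le> c\<^sup>2" by (simp add: power2_eq_square)
  hence c: "1 / 2 \<le> \<bar>c\<bar>" using abs_le_square_iff[of "1 / 2" c] by simp
  define R where "R = mat 1 + rank1 ((1 / c) *\<^sub>R w) (sgn u)"
  have "norm ((1 / c) *\<^sub>R w) * norm (sgn u) = norm w / \<bar>c\<bar>" using n by simp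
  also have "\<dots> \<le> (\<eta> / 2) / (1 / 2)" using small c \<eta> by (intro frac_le) (auto simp: w_def c_def)
  finally have small_R: "op_norm (R - mat 1) \<le> \<eta>" using id_plus_rank1(1)[of "(1 / c) *\<^sub>R w" "sgn u"] by (simp add: R_def)
  have "R *v sgn u = (1 / c) *\<^sub>R sgn v"
  proof -
    have "c \<noteq> 0" using c by auto
    thus ?thesis unfolding R_def id_plus_rank1(2)
      using n by (simp add: w_def norm_eq_1 scaleR_diff_right)
  qed
  hence "R *v (norm u *\<^sub>R sgn u) = (norm u * (1 / c)) *\<^sub>R sgn v"
    by (simp only: matrix_vector_mult_scaleR scaleR_scaleR)
  moreover have "norm u *\<^sub>R sgn u = u" using u by (simp add: sgn_div_norm)
  ultimately have Ru: "R *v u = (norm u / (c * norm v)) *\<^sub>R v"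
    by (simp add: sgn_div_norm divide_inverse mult_ac)
  have "norm u / (c * norm v) \<noteq> 0" using u v c by auto
  thus ?thesis using small_R Ru by blast
qed

text \<open>If the angle is not small, \<open>v\<close> can be stretched by a map that fixes \<open>u\<close>. The stretching is only
  quadratic in \<open>\<eta>\<close> because the rank-one correction is divided by the sine of the angle.\<close>

lemma small_amplification:
  fixes u v :: "real^'n"
  assumes u: "u \<noteq> 0" and v: "v \<noteq> 0" and \<eta>: "0 < \<eta>"
    and large: "\<eta> / 2 \<le> norm (sgn v - (sgn v \<bullet> sgn u) *\<^sub>R sgn u)"
  shows "\<exists>R. op_norm (R - mat 1) \<le> \<eta> \<and> R *v u = u \<and> R *v v = (1 + \<eta>\<^sup>2 / 2) *\<^sub>R v"
proof -
  define w where "w = sgn v - (sgn v \<bullet> sgn u) *\<^sub>R sgn u"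
  have n: "norm (sgn u) = 1" "norm (sgn v) = 1" using u v by (simp_all add: norm_sgn)
  have w: "\<eta> / 2 \<le> norm w" using large by (simp add: w_def)
  hence w0: "norm w > 0" using \<eta> by linarith
  have wu: "w \<bullet> sgn u = 0" using n by (simp add: w_def inner_diff_left norm_eq_1)
  have wv: "w \<bullet> sgn v = (norm w)\<^sup>2"
    using n wu unfolding power2_norm_eq_inner
    by (simp add: w_def inner_diff inner_commute norm_eq_1 power2_eq_square)
  define b where "b = (\<eta>\<^sup>2 / 2 / (norm w)\<^sup>2) *\<^sub>R w"
  define R where "R = mat 1 + rank1 (sgn v) b"
  have "norm (sgn v) * norm b = \<eta>\<^sup>2 / 2 / norm w" using n w0 by (simp add: b_def power2_eq_square)
  also have "\<dots> \<le> \<eta>\<^sup>2 / 2 / (\<eta> / 2)" using w \<eta> by (intro divide_left_mono) (auto intro!: mult_pos_pos w0)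
  also have "\<dots> = \<eta>" using \<eta> by (simp add: power2_eq_square)
  finally have "op_norm (R - mat 1) \<le> \<eta>" using id_plus_rank1(1)[of "sgn v" b] by (simp add: R_def)
  moreover have "b \<bullet> u = 0" using wu u by (simp add: b_def sgn_div_norm)
  hence "R *v u = u" by (simp add: R_def id_plus_rank1)
  moreover have "w \<bullet> v = (norm w)\<^sup>2 * norm v" using wv v by (simp add: sgn_div_norm field_simps)
  hence "b \<bullet> v = \<eta>\<^sup>2 / 2 * norm v" using w0 by (simp add: b_def)
  hence "R *v v = v + (\<eta>\<^sup>2 / 2 * norm v) *\<^sub>R sgn v" by (simp only: R_def id_plus_rank1)
  hence "R *v v = v + (\<eta>\<^sup>2 / 2) *\<^sub>R v" using v by (simp add: sgn_div_norm)
  ultimately show ?thesis by (auto simp: scaleR_add_left)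
qed

text \<open>If \<open>z\<close> is much longer than \<open>u\<close>, then the summand \<open>u\<close> of \<open>u + z\<close> can be removed by a small correction.\<close>

lemma small_projection:
  fixes u z :: "real^'n"
  assumes u: "u \<noteq> 0" and \<eta>: "0 < \<eta>" and z: "(1 + 1 / \<eta>) * norm u \<le> norm z"
  shows "\<exists>R. op_norm (R - mat 1) \<le> \<eta> \<and> R *v (u + z) = z"
proof -
  have "norm u / \<eta> \<le> norm (u + z)"
    using norm_triangle_ineq4[of "u + z" u] z by (simp add: algebra_simps)
  hence le: "norm u \<le> \<eta> * norm (u + z)" using \<eta> by (simp add: field_simps)
  hence nz: "u + z \<noteq> 0" using u by auto
  obtain R where R: "op_norm (R - mat 1) \<le> \<bar>-1\<bar> * norm u / norm (u + z)"
      "R *v (u + z) = (u + z) + (-1) *\<^sub>R u"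
    using small_kick[OF nz, of "-1" u] by blast
  have "\<bar>-1\<bar> * norm u / norm (u + z) \<le> \<eta>" using le nz by (simp add: divide_le_eq)
  thus ?thesis using order_trans[OF R(1)] R(2) by auto
qed

definition perturbed :: "real \<Rightarrow> (real^'n^'n) set \<Rightarrow> (real^'n^'n) set" where
  "perturbed \<eta> S = {R ** A | R A. A \<in> S \<and> op_norm (R - mat 1) \<le> \<eta>}"

lemma perturbedI: "A \<in> S \<Longrightarrow> op_norm (R - mat 1) \<le> \<eta> \<Longrightarrow> R ** A \<in> perturbed \<eta> S"
  by (auto simp: perturbed_def)

lemma subset_perturbed: "0 \<le> \<eta> \<Longrightarrow> S \<subseteq> perturbed \<eta> S" for S :: "(real^'n^'n) set"
proof
  fix A assume "0 \<le> \<eta>" "A \<in> S"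
  moreover have "op_norm (mat 1 - mat 1 :: real^'n^'n) = 0" by (simp add: op_norm_eq_0)
  ultimately have "mat 1 ** A \<in> perturbed \<eta> S" by (intro perturbedI) auto
  thus "A \<in> perturbed \<eta> S" by simp
qed

lemma products_mono: "S \<subseteq> T \<Longrightarrow> products n S \<subseteq> products n T"
  by (induction n) auto

lemma products_perturbed_left:
  assumes "P \<in> products (Suc n) S" "op_norm (R - mat 1) \<le> \<eta>"
  shows "R ** P \<in> products (Suc n) (perturbed \<eta> S)"
proof -
  obtain A P' where "A \<in> S" "P' \<in> products n S" "P = A ** P'" using assms by auto
  moreover have "0 \<le> \<eta>" using assms(2) op_norm_nonneg order_trans by blast
  ultimately have "R ** A \<in> perturbed \<eta> S" "P' \<in> products n (perturbed \<eta> S)" "R ** P = (R ** A) ** P'"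
    using perturbedI[OF _ assms(2)] products_mono[OF subset_perturbed[of \<eta> S], of n]
    by (auto simp: matrix_mul_assoc)
  thus ?thesis by (subst products.simps) blast
qed

lemma invertible_nonzero: "invertible P \<Longrightarrow> x \<noteq> 0 \<Longrightarrow> P *v x \<noteq> 0" for P :: "real^'n^'n"
  by (metis invertible_left_inverse matrix_left_invertible_ker)

text \<open>The two alternatives: if at some time the images of \<open>u\<close> and \<open>v\<close> have a small angle, then \<open>u\<close> is rotated
  into \<open>v\<close> at that time; otherwise \<open>u\<close> receives a small component along \<open>v\<close> after the first letter, and
  this component is amplified after every further letter. The factor \<open>1 / b\<^sup>2\<close> accounts for the distortion
  by the first letter.\<close>

lemma drift:
  fixes S :: "(real^'n^'n) set" and u v :: "real^'n"
  assumes S: "bounded_GL b S" and b: "1 \<le> b" and \<eta>: "0 < \<eta>" "\<eta> \<le> 1" and uv: "u \<noteq> 0" "v \<noteq> 0"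
  shows "P \<in> products (Suc n) S \<Longrightarrow>
    \<exists>P'\<in>products (Suc n) (perturbed \<eta> S). (\<exists>c. c \<noteq> 0 \<and> P' *v u = c *\<^sub>R (P *v v)) \<or>
      (\<exists>\<beta>\<ge>\<eta> / b\<^sup>2 * (norm u / norm v) * (1 + \<eta>\<^sup>2 / 2) ^ n. P' *v u = P *v u + \<beta> *\<^sub>R (P *v v))"
proof (induction n arbitrary: P)
  case 0
  hence P: "P \<in> S" by simp
  have inv: "invertible P" by (rule bounded_GL_invertible[OF S P])
  have nz: "P *v u \<noteq> 0" "P *v v \<noteq> 0" using invertible_nonzero[OF inv] uv by auto
  define \<beta> where "\<beta> = \<eta> * norm (P *v u) / norm (P *v v)"
  obtain R where R: "op_norm (R - mat 1) \<le> \<bar>\<beta>\<bar> * norm (P *v v) / norm (P *v u)"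
      "R *v (P *v u) = P *v u + \<beta> *\<^sub>R (P *v v)"
    using small_kick[OF nz(1)] by blast
  have "\<bar>\<beta>\<bar> * norm (P *v v) / norm (P *v u) = \<eta>" using nz \<eta> by (simp add: \<beta>_def)
  hence "R ** P \<in> products (Suc 0) (perturbed \<eta> S)" using perturbedI[OF P, of R \<eta>] R(1) by (auto intro!: exI[of _ "R ** P"])
  moreover have "\<eta> / b\<^sup>2 * (norm u / norm v) * (1 + \<eta>\<^sup>2 / 2) ^ 0 \<le> \<beta>"
  proof -
    have "norm u / b \<le> norm (P *v u)"
      using S P b unfolding bounded_GL_def by (simp add: divide_le_eq mult.commute)
    moreover have "norm (P *v v) \<le> b * norm v"
      using S P op_norm_apply[of P v] unfolding bounded_GL_def by (meson mult_right_mono norm_ge_zero order_trans)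
    ultimately have "norm u / b / (b * norm v) \<le> norm (P *v u) / norm (P *v v)"
      using nz b by (intro frac_le) auto
    from mult_left_mono[OF this, of \<eta>] show ?thesis
      using \<eta> by (simp add: \<beta>_def power2_eq_square)
  qed
  ultimately show ?case using R(2) by (intro bexI[of _ "R ** P"]) (auto simp: matrix_vector_mul_assoc)
next
  case (Suc n)
  then obtain A P0 where P: "A \<in> S" "P0 \<in> products (Suc n) S" "P = A ** P0" by (metis products_splitE products_1 plus_1_eq_Suc One_nat_def)
  have inv: "invertible P" by (rule invertible_products[OF bounded_GL_invertible[OF S] Suc.prems])
  have nz: "P *v u \<noteq> 0" "P *v v \<noteq> 0" using invertible_nonzero[OF inv] uv by auto
  obtain P' where P': "P' \<in> products (Suc n) (perturbed \<eta> S)" and or: "(\<exists>c. c \<noteq> 0 \<and> P' *v u = c *\<^sub>R (P0 *v v)) \<or>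
      (\<exists>\<beta>\<ge>\<eta> / b\<^sup>2 * (norm u / norm v) * (1 + \<eta>\<^sup>2 / 2) ^ n. P' *v u = P0 *v u + \<beta> *\<^sub>R (P0 *v v))"
    using Suc.IH[OF P(2)] by blast
  have ext: "R ** A ** P'' \<in> products (Suc (Suc n)) (perturbed \<eta> S)"
    if "op_norm (R - mat 1) \<le> \<eta>" "P'' \<in> products (Suc n) (perturbed \<eta> S)" for R P''
    using perturbedI[OF P(1) that(1)] that(2) by (subst products.simps) blast
  show ?case
  proof (cases "norm (sgn (P *v v) - (sgn (P *v v) \<bullet> sgn (P *v u)) *\<^sub>R sgn (P *v u)) \<le> \<eta> / 2")
    case True
    obtain R c where R: "op_norm (R - mat 1) \<le> \<eta>" "c \<noteq> 0" "R *v (P *v u) = c *\<^sub>R (P *v v)"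
      using small_rotation[OF nz \<eta> True] by blast
    have "R ** P \<in> products (Suc (Suc n)) (perturbed \<eta> S)" by (rule products_perturbed_left[OF Suc.prems R(1)])
    thus ?thesis using R(2,3) by (metis matrix_vector_mul_assoc)
  next
    case False
    then obtain R where R: "op_norm (R - mat 1) \<le> \<eta>" "R *v (P *v u) = P *v u"
        "R *v (P *v v) = (1 + \<eta>\<^sup>2 / 2) *\<^sub>R (P *v v)"
      using small_amplification[OF nz \<eta>(1)] by force
    let ?P = "R ** A ** P'"
    have app: "?P *v u = R *v (A *v (P' *v u))" by (simp add: matrix_vector_mul_assoc matrix_mul_assoc)
    have A: "A *v (P0 *v x) = P *v x" for x by (simp add: P(3) matrix_vector_mul_assoc)
    from or show ?thesis
    proof
      assume "\<exists>c. c \<noteq> 0 \<and> P' *v u = c *\<^sub>R (P0 *v v)"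
      then obtain c where c: "c \<noteq> 0" "P' *v u = c *\<^sub>R (P0 *v v)" by blast
      have "?P *v u = (c * (1 + \<eta>\<^sup>2 / 2)) *\<^sub>R (P *v v)"
        by (simp only: app c(2) matrix_vector_mult_scaleR A R scaleR_scaleR)
      moreover have "c * (1 + \<eta>\<^sup>2 / 2) \<noteq> 0" using c by (simp add: add_nonneg_eq_0_iff)
      ultimately show ?thesis using ext[OF R(1) P'] by blast
    next
      assume "\<exists>\<beta>\<ge>\<eta> / b\<^sup>2 * (norm u / norm v) * (1 + \<eta>\<^sup>2 / 2) ^ n. P' *v u = P0 *v u + \<beta> *\<^sub>R (P0 *v v)"
      then obtain \<beta> where \<beta>: "\<eta> / b\<^sup>2 * (norm u / norm v) * (1 + \<eta>\<^sup>2 / 2) ^ n \<le> \<beta>"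
        "P' *v u = P0 *v u + \<beta> *\<^sub>R (P0 *v v)" by blast
      have "?P *v u = P *v u + (\<beta> * (1 + \<eta>\<^sup>2 / 2)) *\<^sub>R (P *v v)"
        by (simp only: app \<beta>(2) matrix_vector_mult_scaleR matrix_vector_right_distrib A R scaleR_scaleR)
      moreover have "\<eta> / b\<^sup>2 * (norm u / norm v) * (1 + \<eta>\<^sup>2 / 2) ^ Suc n \<le> \<beta> * (1 + \<eta>\<^sup>2 / 2)"
        using mult_right_mono[OF \<beta>(1), of "1 + \<eta>\<^sup>2 / 2"] by (simp add: mult_ac)
      ultimately show ?thesis using ext[OF R(1) P'] by blast
    qed
  qed
qed

lemma dim_orthogonal_ge:
  fixes B :: "(real^'n) set"
  assumes "finite B"
  shows "CARD('n) \<le> dim {x. \<forall>c\<in>B. c \<bullet> x = 0} + card B"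
proof -
  have "dim {y \<in> UNIV. \<forall>x \<in> span B. orthogonal x y} + dim (span B) = dim (UNIV :: (real^'n) set)"
    by (intro dim_subspace_orthogonal_to_vectors) auto
  moreover have "{y \<in> UNIV. \<forall>x \<in> span B. orthogonal x y} = {x. \<forall>c\<in>B. c \<bullet> x = 0}"
  proof -
    have "subspace {x. orthogonal x y}" for y :: "real^'n"
      by (auto simp: subspace_def orthogonal_clauses)
    hence "(\<forall>x \<in> span B. orthogonal x y) \<longleftrightarrow> (\<forall>c\<in>B. orthogonal c y)" for y
      by (metis (mono_tags, lifting) mem_Collect_eq span_base span_induct)
    thus ?thesis by (auto simp: orthogonal_def)
  qed
  moreover have "dim (span B) \<le> card B" using assms by (simp add: dim_le_card')
  ultimately show ?thesis by simp
qed

lemma subspace_meets_orthogonal: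
  fixes B :: "(real^'n) set"
  assumes "finite B" "subspace U" "card B < dim U"
  shows "\<exists>x\<in>U. x \<noteq> 0 \<and> (\<forall>c\<in>B. c \<bullet> x = 0)"
proof -
  let ?W = "{x. \<forall>c\<in>B. c \<bullet> x = 0}"
  have W: "subspace ?W" by (auto simp: subspace_def inner_add_right)
  have "dim {x + y |x y. x \<in> U \<and> y \<in> ?W} + dim (U \<inter> ?W) = dim U + dim ?W"
    by (rule dim_sums_Int[OF assms(2) W])
  moreover have "dim {x + y |x y. x \<in> U \<and> y \<in> ?W} \<le> CARD('n)"
    using dim_subset_UNIV[of "{x + y |x y. x \<in> U \<and> y \<in> ?W}"] by simp
  ultimately have "dim (U \<inter> ?W) \<noteq> 0" using dim_orthogonal_ge[OF assms(1)] assms(3) by linarith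
  hence "\<not> U \<inter> ?W \<subseteq> {0}" by (simp only: dim_eq_0 not_False_eq_True)
  thus ?thesis by blast
qed

lemma norm_svd:
  fixes X :: "real^'n^'n"
  assumes svd: "svd X U s V e"
  shows "(norm (X *v x))\<^sup>2 = (\<Sum>i\<in>UNIV. (s i)\<^sup>2 * (column i V \<bullet> x)\<^sup>2)"
    and "(norm x)\<^sup>2 = (\<Sum>i\<in>UNIV. (column i V \<bullet> x)\<^sup>2)"
proof -
  have parseval: "(norm y)\<^sup>2 = (\<Sum>i\<in>UNIV. (column i W \<bullet> y)\<^sup>2)" if "orthogonal_matrix W" for W and y :: "real^'n"
  proof -
    have "(transpose W *v y) $ i = column i W \<bullet> y" for i
      by (simp add: matrix_vector_mult_def transpose_def column_def inner_vec_def)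
    hence "(\<Sum>i\<in>UNIV. (column i W \<bullet> y)\<^sup>2) = (transpose W *v y) \<bullet> (transpose W *v y)"
      by (simp add: inner_vec_def power2_eq_square)
    also have "\<dots> = y \<bullet> (W *v (transpose W *v y))" by (simp add: inner_transpose_mult)
    also have "\<dots> = (norm y)\<^sup>2"
      using that by (simp add: matrix_vector_mul_assoc orthogonal_matrix_def power2_norm_eq_inner)
    finally show ?thesis by simp
  qed
  show "(norm x)\<^sup>2 = (\<Sum>i\<in>UNIV. (column i V \<bullet> x)\<^sup>2)" using svd by (intro parseval) (simp add: svd_def)
  have "column i U \<bullet> (X *v x) = s i * (column i V \<bullet> x)" for i
    by (simp add: inner_transpose_mult svd_transpose[OF svd])
  thus "(norm (X *v x))\<^sup>2 = (\<Sum>i\<in>UNIV. (s i)\<^sup>2 * (column i V \<bullet> x)\<^sup>2)"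
    using parseval[of U "X *v x"] svd by (simp add: svd_def power_mult_distrib)
qed

lemma norm_svd_le:
  assumes svd: "svd X U s V e" and le: "\<And>i. column i V \<bullet> x \<noteq> 0 \<Longrightarrow> s i \<le> c" and c: "0 \<le> c"
  shows "norm (X *v x) \<le> c * norm x"
proof -
  have "(s i)\<^sup>2 * (column i V \<bullet> x)\<^sup>2 \<le> c\<^sup>2 * (column i V \<bullet> x)\<^sup>2" for i
    using le[of i] svd_pos[OF svd, of i]
    by (cases "column i V \<bullet> x = 0") (auto intro!: mult_right_mono power_mono)
  hence "(norm (X *v x))\<^sup>2 \<le> c\<^sup>2 * (norm x)\<^sup>2"
    unfolding norm_svd(1)[OF svd] norm_svd(2)[OF svd, of x] sum_distrib_left by (intro sum_mono)
  thus ?thesis using c by (simp add: power_mult_distrib[symmetric] power2_le_iff_abs_le)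
qed

lemma norm_svd_ge:
  assumes svd: "svd X U s V e" and ge: "\<And>i. column i V \<bullet> x \<noteq> 0 \<Longrightarrow> c \<le> s i" and c: "0 \<le> c"
  shows "c * norm x \<le> norm (X *v x)"
proof -
  have "c\<^sup>2 * (column i V \<bullet> x)\<^sup>2 \<le> (s i)\<^sup>2 * (column i V \<bullet> x)\<^sup>2" for i
    using ge[of i] c by (cases "column i V \<bullet> x = 0") (auto intro!: mult_right_mono power_mono)
  hence "c\<^sup>2 * (norm x)\<^sup>2 \<le> (norm (X *v x))\<^sup>2"
    unfolding norm_svd(1)[OF svd] norm_svd(2)[OF svd, of x] sum_distrib_left by (intro sum_mono)
  thus ?thesis by (simp add: power_mult_distrib[symmetric] power2_le_iff_abs_le[of "norm (X *v x)"] c)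
qed

text \<open>By counting dimensions, \<open>E\<close> contains a vector \<open>u\<close> stretched by \<open>W\<close> at most by its \<open>k\<close>th singular value, and
  the preimage of \<open>F\<close> contains a vector \<open>v\<close> stretched at least by the next one. The gap condition says that
  the component along \<open>v\<close> created by the drift finally outweighs the image of \<open>u\<close>, which can then be
  removed. The length of the word and the gap condition do not involve \<open>E\<close> and \<open>F\<close>.\<close>

lemma steering:
  fixes S :: "(real^'n^'n) set"
  assumes S: "bounded_GL b S" and b: "1 \<le> b" and \<eta>: "0 < \<eta>" "\<eta> \<le> 1" and k: "1 \<le> k" "k < CARD('n)"
    and W: "W \<in> products (Suc n) S"
    and gap: "(1 + 1 / \<eta>) * b\<^sup>2 / \<eta> / (1 + \<eta>\<^sup>2 / 2) ^ n \<le> gap k W"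
    and E: "subspace E" "k \<le> dim E" and F: "subspace F" "CARD('n) - k \<le> dim F"
  shows "\<exists>Q\<in>products (Suc n) (perturbed \<eta> (perturbed \<eta> S)). \<exists>u\<in>E. u \<noteq> 0 \<and> Q *v u \<in> F"
proof -
  have inv: "invertible W" by (rule invertible_products[OF bounded_GL_invertible[OF S] W])
  obtain U s V e where svd: "svd W U s V e" using svd_exists[OF inv] by blast
  have e: "bij_betw e {..<CARD('n)} UNIV" by (rule svd_e[OF svd])
  have ex_idx: "\<exists>j<CARD('n). i = e j" for i using e by (auto simp: bij_betw_def)
  define q where "q = (1 + \<eta>\<^sup>2 / 2) ^ n"
  have q: "q > 0" unfolding q_def by (intro zero_less_power) (simp add: add_pos_nonneg)
  \<comment> \<open>\<open>k - 1\<close> orthogonality conditions on a space of dimension at least \<open>k\<close>\<close>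
  have "card ((\<lambda>i. column (e i) V) ` {..<k - 1}) < dim E"
    using card_image_le[of "{..<k - 1}" "\<lambda>i. column (e i) V"] E(2) k by simp
  then obtain u where u: "u \<in> E" "u \<noteq> 0" "\<And>i. i < k - 1 \<Longrightarrow> column (e i) V \<bullet> u = 0"
    using subspace_meets_orthogonal[OF _ E(1), of "(\<lambda>i. column (e i) V) ` {..<k - 1}"] by auto
  have Wu: "norm (W *v u) \<le> s (e (k - 1)) * norm u"
  proof (rule norm_svd_le[OF svd])
    fix i assume nz: "column i V \<bullet> u \<noteq> 0"
    obtain j where j: "j < CARD('n)" "i = e j" using ex_idx by blast
    hence "k - 1 \<le> j" using nz u(3) by (metis not_le)
    thus "s i \<le> s (e (k - 1))" using j by (simp add: svd_dec[OF svd])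
  qed (simp add: less_imp_le[OF svd_pos[OF svd]])
  \<comment> \<open>\<open>CARD('n) - k - 1\<close> conditions on a space of dimension at least \<open>CARD('n) - k\<close>\<close>
  define F' where "F' = (*v) (matrix_inv W) ` F"
  have F': "subspace F'" unfolding F'_def by (rule linear_subspace_image[OF matrix_vector_mul_linear F(1)])
  have "inj ((*v) (matrix_inv W))"
    using matrix_inv_mult(3)[OF inv] by (simp add: inj_matrix_vector_mult)
  hence "dim F' = dim F" unfolding F'_def
    by (intro dim_image_eq matrix_vector_mul_linear) (auto intro: inj_on_subset)
  moreover have "card ((\<lambda>i. column (e i) V) ` {Suc k..<CARD('n)}) \<le> CARD('n) - Suc k"
    using card_image_le[of "{Suc k..<CARD('n)}" "\<lambda>i. column (e i) V"] by simp
  ultimately have "card ((\<lambda>i. column (e i) V) ` {Suc k..<CARD('n)}) < dim F'" using F(2) k by linarith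
  then obtain v where v: "v \<in> F'" "v \<noteq> 0" "\<And>i. Suc k \<le> i \<Longrightarrow> i < CARD('n) \<Longrightarrow> column (e i) V \<bullet> v = 0"
    using subspace_meets_orthogonal[OF _ F', of "(\<lambda>i. column (e i) V) ` {Suc k..<CARD('n)}"] by auto
  have Wv: "s (e k) * norm v \<le> norm (W *v v)"
  proof (rule norm_svd_ge[OF svd])
    fix i assume nz: "column i V \<bullet> v \<noteq> 0"
    obtain j where j: "j < CARD('n)" "i = e j" using ex_idx by blast
    hence "j \<le> k" using nz v(3) by (metis not_less_eq_eq)
    thus "s (e k) \<le> s i" using j k by (simp add: svd_dec[OF svd])
  qed (simp add: less_imp_le[OF svd_pos[OF svd]])
  have WvF: "W *v v \<in> F" using v(1) by (auto simp: F'_def matrix_vector_mul_assoc matrix_inv_mult[OF inv])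
  obtain P where P: "P \<in> products (Suc n) (perturbed \<eta> S)" and or: "(\<exists>c. c \<noteq> 0 \<and> P *v u = c *\<^sub>R (W *v v)) \<or>
      (\<exists>\<beta>\<ge>\<eta> / b\<^sup>2 * (norm u / norm v) * q. P *v u = W *v u + \<beta> *\<^sub>R (W *v v))"
    using drift[OF S b \<eta> u(2) v(2) W] unfolding q_def by blast
  from or show ?thesis
  proof
    assume "\<exists>c. c \<noteq> 0 \<and> P *v u = c *\<^sub>R (W *v v)"
    hence "P *v u \<in> F" using WvF F(1) by (auto simp: subspace_scale)
    moreover have "P \<in> products (Suc n) (perturbed \<eta> (perturbed \<eta> S))"
      using P products_mono[OF subset_perturbed[of \<eta>]] \<eta>(1) by (meson less_imp_le subsetD)
    ultimately show ?thesis using u by blast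
  next
    assume "\<exists>\<beta>\<ge>\<eta> / b\<^sup>2 * (norm u / norm v) * q. P *v u = W *v u + \<beta> *\<^sub>R (W *v v)"
    then obtain \<beta> where \<beta>: "\<eta> / b\<^sup>2 * (norm u / norm v) * q \<le> \<beta>" "P *v u = W *v u + \<beta> *\<^sub>R (W *v v)" by blast
    have s: "0 < s (e k)" "0 < s (e (k - 1))" by (rule svd_pos[OF svd])+
    have "(1 + 1 / \<eta>) * b\<^sup>2 / \<eta> / q \<le> s (e k) / s (e (k - 1))"
      using gap by (simp add: q_def gap_svd[OF svd k])
    hence "(1 + 1 / \<eta>) * s (e (k - 1)) \<le> \<eta> / b\<^sup>2 * q * s (e k)"
      using s q \<eta> b by (simp add: field_simps)
    hence "(1 + 1 / \<eta>) * s (e (k - 1)) * norm u \<le> \<eta> / b\<^sup>2 * q * s (e k) * norm u"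
      by (intro mult_right_mono) auto
    also have "\<dots> = (\<eta> / b\<^sup>2 * (norm u / norm v) * q) * (s (e k) * norm v)" using v(2) by simp
    also have "\<dots> \<le> \<beta> * norm (W *v v)"
    proof (intro mult_mono \<beta>(1) Wv)
      have "0 \<le> \<eta> / b\<^sup>2 * (norm u / norm v) * q" using \<eta> q by simp
      thus "0 \<le> \<beta>" using \<beta>(1) by linarith
    qed (use s in auto)
    also have "\<dots> \<le> norm (\<beta> *\<^sub>R (W *v v))" by (simp add: mult_right_mono)
    finally have "(1 + 1 / \<eta>) * (s (e (k - 1)) * norm u) \<le> norm (\<beta> *\<^sub>R (W *v v))" by (simp add: mult_ac)
    moreover have "(1 + 1 / \<eta>) * norm (W *v u) \<le> (1 + 1 / \<eta>) * (s (e (k - 1)) * norm u)"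
      using \<eta> by (intro mult_left_mono Wu) auto
    ultimately obtain R where R: "op_norm (R - mat 1) \<le> \<eta>" "R *v (P *v u) = \<beta> *\<^sub>R (W *v v)"
      using small_projection[OF invertible_nonzero[OF inv u(2)] \<eta>(1), of "\<beta> *\<^sub>R (W *v v)"] \<beta>(2) by auto
    have "R ** P \<in> products (Suc n) (perturbed \<eta> (perturbed \<eta> S))" by (rule products_perturbed_left[OF P R(1)])
    moreover have "(R ** P) *v u \<in> F"
      using R(2) WvF F(1) by (simp add: matrix_vector_mul_assoc[symmetric] subspace_scale)
    ultimately show ?thesis using u by blast
  qed
qed

section \<open>Sandwiching a connecting word, and relaxation\<close>

text \<open>A square submatrix with a nonzero kernel vector has determinant \<open>0\<close>. The minor is an entry of an
  exterior power, so the usual column operation is carried out by functoriality.\<close>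

lemma ext_power_minor_zero:
  fixes M :: "real^'n^'n"
  assumes T: "card T = k" and c: "c \<noteq> 0" "\<And>j. j \<notin> T \<Longrightarrow> c $ j = 0"
    and Mc: "\<And>i. i \<in> T \<Longrightarrow> (M *v c) $ i = 0"
  shows "ext_power k M $ T $ T = 0"
proof -
  obtain j0 where j0: "c $ j0 \<noteq> 0" using c(1) by (auto simp: vec_eq_iff)
  hence j0T: "j0 \<in> T" using c(2) by blast
  \<comment> \<open>\<open>E\<close> is invertible and maps the basis vector with index \<open>j0\<close> to \<open>c\<close>, so column \<open>j0\<close> of the submatrix of
    \<open>M ** E\<close> vanishes; on the wedge of the basis vectors in \<open>T\<close> its exterior power is a scalar \<open>\<gamma> \<noteq> 0\<close>\<close>
  define E where "E = (\<chi> i j. if j = j0 then c $ i else if i = j then 1 else 0)"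
  have E0: "E *v axis j0 1 = c" by (simp add: matrix_vector_mult_basis column_def E_def vec_eq_iff)
  have "x = 0" if "E *v x = 0" for x
  proof -
    have comp: "(E *v x) $ i = c $ i * x $ j0 + (if i = j0 then 0 else x $ i)" for i
    proof -
      have "(E *v x) $ i = (\<Sum>j\<in>UNIV. (if j = j0 then c $ i * x $ j else 0) + (if j = i then (if i = j0 then 0 else x $ j) else 0))"
        unfolding matrix_vector_mult_def E_def by (simp, intro sum.cong) auto
      thus ?thesis by (simp add: sum.distrib)
    qed
    have "x $ j0 = 0" using comp[of j0] that j0 by simp
    thus ?thesis using comp that by (metis (mono_tags, lifting) add_cancel_left_left mult_zero_right vec_eq_iff zero_index)
  qed
  hence invE: "invertible E" by (metis invertible_left_inverse matrix_left_invertible_ker)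
  have nth_T: "elems T ! i \<in> T" if "i < k" for i
    using that elems[of T] T by (metis nth_mem)
  have off: "ext_power k E $ R $ T = 0" if "card R = k" "R \<noteq> T" for R
  proof -
    have "\<not> R \<subseteq> T" using that T card_subset_eq[of T R] by auto
    then obtain r where r: "r \<in> R" "r \<notin> T" by auto
    have "r \<in> set (elems R)" "length (elems R) = k" using r that by (simp_all add: elems)
    then obtain i where i: "i < k" "elems R ! i = r" by (auto simp: in_set_conv_nth)
    have prod0: "(\<Prod>i<k. E $ (elems R ! i) $ (elems T ! p i)) = 0" if p: "p permutes {..<k}" for p
    proof (rule prod_zero)
      have "elems T ! p i \<in> T" using nth_T permutes_in_image[OF p] i by auto
      hence "E $ (elems R ! i) $ (elems T ! p i) = 0" using r i c(2)[OF r(2)] by (auto simp: E_def)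
      thus "\<exists>i\<in>{..<k}. E $ (elems R ! i) $ (elems T ! p i) = 0" using i by auto
    qed auto
    show ?thesis unfolding ext_power_component[OF that(1) T]
      by (intro sum.neutral ballI) (simp only: mem_Collect_eq prod0 mult_zero_right)
  qed
  define \<gamma> where "\<gamma> = ext_power k E $ T $ T"
  have Eax: "ext_power k E *v axis T 1 = \<gamma> *\<^sub>R axis T 1"
  proof -
    have "ext_power k E $ R $ T = (\<gamma> *\<^sub>R axis T (1::real)) $ R" for R
      using off[of R] by (cases "card R = k") (auto simp: \<gamma>_def axis_def ext_power_def wedge_def T)
    thus ?thesis by (simp add: matrix_vector_mult_basis column_def vec_eq_iff)
  qed
  have "\<gamma> \<noteq> 0"
  proof
    assume "\<gamma> = 0"
    hence "ext_power k (matrix_inv E ** E) *v axis T 1 = 0"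
      by (simp add: ext_power_mult matrix_vector_mul_assoc[symmetric] Eax)
    thus False using T by (simp add: matrix_inv_mult[OF invE] ext_power_id axis_eq_0_iff)
  qed
  have "ext_power k (M ** E) $ T $ T = 0"
  proof -
    have "j0 \<in> set (elems T)" "length (elems T) = k" using j0T T by (simp_all add: elems)
    then obtain i0 where i0: "i0 < k" "elems T ! i0 = j0" by (auto simp: in_set_conv_nth)
    have prod0: "(\<Prod>i<k. (M ** E) $ (elems T ! i) $ (elems T ! p i)) = 0" if p: "p permutes {..<k}" for p
    proof (rule prod_zero)
      obtain i where pi: "p i = i0" using permutes_surj[OF p] by (metis surjD)
      hence i: "i < k" "p i = i0" using permutes_in_image[OF p, of i] i0(1) by auto
      have "(M ** E) $ (elems T ! i) $ j0 = (M *v (E *v axis j0 1)) $ (elems T ! i)"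
        unfolding matrix_vector_mult_basis by (simp add: matrix_matrix_mult_def matrix_vector_mult_def column_def)
      hence "(M ** E) $ (elems T ! i) $ (elems T ! p i) = 0" using E0 Mc nth_T i i0 by simp
      thus "\<exists>i\<in>{..<k}. (M ** E) $ (elems T ! i) $ (elems T ! p i) = 0" using i by auto
    qed auto
    show ?thesis unfolding ext_power_component[OF T T]
      by (intro sum.neutral ballI) (simp only: mem_Collect_eq prod0 mult_zero_right)
  qed
  moreover have "ext_power k (M ** E) $ T $ T = (ext_power k (M ** E) *v axis T 1) $ T"
    by (simp add: matrix_vector_mult_basis column_def)
  moreover have "ext_power k (M ** E) *v axis T 1 = \<gamma> *\<^sub>R (ext_power k M *v axis T 1)"
    by (simp add: ext_power_mult matrix_vector_mul_assoc[symmetric] Eax matrix_vector_mult_scaleR)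
  moreover have "(ext_power k M *v axis T 1) $ T = ext_power k M $ T $ T"
    by (simp add: matrix_vector_mult_basis column_def)
  ultimately show ?thesis using \<open>\<gamma> \<noteq> 0\<close> by simp
qed

text \<open>Let \<open>p\<close> and \<open>q\<close> be the wedges of the \<open>k\<close> leading right and left singular vectors of \<open>P\<close>. The exterior power of \<open>P Q P\<close>
  sends \<open>p\<close> through \<open>q\<close> to the image of \<open>y\<close>, the \<open>Q\<close>-image of \<open>q\<close>. The hypothesis
  provides \<open>Q\<close> for which \<open>y\<close> is orthogonal to \<open>p\<close>, so the second application of \<open>P\<close> loses the factor
  \<open>gap k P\<close>. Vectors orthogonal to \<open>p\<close> lose this factor in the first application.\<close>

lemma vol_sandwich:
  fixes P :: "real^'n^'n"
  assumes inv: "invertible P" and k: "1 \<le> k" "k < CARD('n)"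
    and steer: "\<And>E F :: (real^'n) set. subspace E \<Longrightarrow> k \<le> dim E \<Longrightarrow> subspace F \<Longrightarrow> CARD('n) - k \<le> dim F \<Longrightarrow>
      \<exists>Q\<in>\<Q>. \<exists>u\<in>E. u \<noteq> 0 \<and> Q *v u \<in> F"
  shows "\<exists>Q\<in>\<Q>. vol k (P ** Q ** P) \<le> 2 * vol k Q * (vol (k - 1) P * vol (k + 1) P)"
proof -
  have kd: "k \<le> CARD('n)" using k by simp
  obtain U s V e where svd: "svd P U s V e" using svd_exists[OF inv] by blast
  have oU: "orthogonal_matrix U" using svd by (simp add: svd_def)
  define T where "T = e ` {..<k}"
  have T: "card T = k" unfolding T_def by (rule svd_card_initial[OF svd kd])
  define E where "E = {x. \<forall>c\<in>(\<lambda>i. column i U) ` (- T). c \<bullet> x = 0}"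
  define F where "F = {x. \<forall>c\<in>(\<lambda>i. column i V) ` T. c \<bullet> x = 0}"
  have sub: "subspace E" "subspace F" by (auto simp: E_def F_def subspace_def inner_add_right)
  have "card ((\<lambda>i. column i U) ` (- T)) \<le> CARD('n) - k"
    using card_image_le[of "- T" "\<lambda>i. column i U"] by (simp add: Compl_eq_Diff_UNIV card_Diff_subset T)
  hence dE: "k \<le> dim E" using dim_orthogonal_ge[of "(\<lambda>i. column i U) ` (- T)"] k by (simp add: E_def)
  have "card ((\<lambda>i. column i V) ` T) \<le> k" using card_image_le[of T "\<lambda>i. column i V"] by (simp add: T)
  hence dF: "CARD('n) - k \<le> dim F" using dim_orthogonal_ge[of "(\<lambda>i. column i V) ` T"] by (simp add: F_def)
  obtain Q u where Q: "Q \<in> \<Q>" and u: "u \<in> E" "u \<noteq> 0" "Q *v u \<in> F"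
    using steer[OF sub(1) dE sub(2) dF] by blast
  have comp: "(transpose A *v x) $ i = column i A \<bullet> x" for A :: "real^'n^'n" and x i
    by (simp add: matrix_vector_mult_def transpose_def column_def inner_vec_def)
  define c where "c = transpose U *v u"
  have Uc: "U *v c = u" using oU by (simp add: c_def matrix_vector_mul_assoc orthogonal_matrix_def)
  define p where "p = ext_col k V T"
  define q where "q = ext_col k U T"
  define y where "y = ext_power k Q *v q"
  have py: "p \<bullet> y = 0"
  proof -
    have "ext_power k (transpose V ** Q ** U) $ T $ T = 0"
    proof (rule ext_power_minor_zero[OF T])
      show "c \<noteq> 0" using Uc u(2) by auto
      show "c $ j = 0" if "j \<notin> T" for j using u(1) that by (simp add: c_def comp E_def)
      show "((transpose V ** Q ** U) *v c) $ i = 0" if "i \<in> T" for i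
        using u(3) that by (simp add: matrix_vector_mul_assoc[symmetric] Uc comp F_def)
    qed
    moreover have "p \<bullet> y = axis T 1 \<bullet> (ext_power k (transpose V ** Q ** U) *v axis T 1)"
      by (simp add: p_def q_def y_def ext_power_mult ext_power_transpose matrix_vector_mul_assoc[symmetric] inner_transpose_mult)
    ultimately show ?thesis by (simp add: inner_axis' matrix_vector_mult_basis column_def)
  qed
  have top: "top_vector k P p" unfolding p_def T_def by (rule svd_top_vector[OF svd k(1) kd])
  have Pp: "ext_power k P *v p = vol k P *\<^sub>R q"
    using svd_top_image[OF svd kd] by (simp add: p_def q_def T_def vol_svd[OF svd kd])
  have np: "norm p = 1" "norm q = 1" using svd_top_norm[OF svd kd] by (auto simp: p_def q_def T_def)
  define v where "v = vol k P"
  define g where "g = gap k P"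
  have vg: "0 \<le> v" "0 \<le> g" by (auto simp: v_def g_def vol_nonneg gap_nonneg)
  have small: "norm (ext_power k P *v z) \<le> g * v * norm z" if "p \<bullet> z = 0" for z
    using top that by (auto simp: top_vector_def v_def g_def)
  have "vol k (P ** Q ** P) \<le> 2 * vol k Q * (g * v * v)"
    unfolding vol_def[of k "P ** Q ** P"]
  proof (rule op_norm_le)
    fix z
    define w where "w = z - (p \<bullet> z) *\<^sub>R p"
    have pw: "p \<bullet> w = 0" and "norm w \<le> norm z"
      unfolding w_def using orthogonal_part[OF np(1)] by auto
    define x where "x = ext_power k P *v w"
    have x: "norm x \<le> g * v * norm z"
      using small[OF pw] mult_left_mono[OF \<open>norm w \<le> norm z\<close>, of "g * v"] vg by (simp add: x_def)
    have "z = (p \<bullet> z) *\<^sub>R p + w" by (simp add: w_def)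
    hence "ext_power k (P ** Q ** P) *v z = ext_power k P *v (ext_power k Q *v (ext_power k P *v ((p \<bullet> z) *\<^sub>R p + w)))"
      by (simp add: ext_power_mult matrix_vector_mul_assoc[symmetric])
    also have "ext_power k P *v ((p \<bullet> z) *\<^sub>R p + w) = ((p \<bullet> z) * v) *\<^sub>R q + x"
      by (simp add: matrix_vector_right_distrib matrix_vector_mult_scaleR Pp x_def v_def)
    also have "ext_power k P *v (ext_power k Q *v (((p \<bullet> z) * v) *\<^sub>R q + x)) =
        ((p \<bullet> z) * v) *\<^sub>R (ext_power k P *v y) + ext_power k P *v (ext_power k Q *v x)"
      by (simp add: matrix_vector_right_distrib matrix_vector_mult_scaleR y_def)
    finally have eq: "ext_power k (P ** Q ** P) *v z =
        ((p \<bullet> z) * v) *\<^sub>R (ext_power k P *v y) + ext_power k P *v (ext_power k Q *v x)" .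
    have "norm (ext_power k (P ** Q ** P) *v z) \<le>
        norm (((p \<bullet> z) * v) *\<^sub>R (ext_power k P *v y)) + norm (ext_power k P *v (ext_power k Q *v x))"
      unfolding eq by (rule norm_triangle_ineq)
    also have "\<dots> \<le> vol k Q * (g * v * v) * norm z + vol k Q * (g * v * v) * norm z"
    proof (rule add_mono)
      have "\<bar>p \<bullet> z\<bar> \<le> norm z" using Cauchy_Schwarz_ineq2[of p z] np by simp
      moreover have "norm (ext_power k P *v y) \<le> g * v * vol k Q"
      proof -
        have "norm y \<le> vol k Q" using op_norm_apply[of "ext_power k Q" q] np by (simp add: y_def vol_def)
        thus ?thesis using small[OF py] mult_left_mono[of "norm y" "vol k Q" "g * v"] vg by simp
      qed
      ultimately have "\<bar>p \<bullet> z\<bar> * v * norm (ext_power k P *v y) \<le> norm z * v * (g * v * vol k Q)"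
        using vg by (intro mult_mono) auto
      thus "norm (((p \<bullet> z) * v) *\<^sub>R (ext_power k P *v y)) \<le> vol k Q * (g * v * v) * norm z"
        using vg by (simp add: abs_mult mult_ac)
      have "norm (ext_power k P *v (ext_power k Q *v x)) \<le> v * norm (ext_power k Q *v x)"
        unfolding v_def vol_def by (rule op_norm_apply)
      also have "\<dots> \<le> v * (vol k Q * norm x)"
        using vg op_norm_apply[of "ext_power k Q" x] by (intro mult_left_mono) (auto simp: vol_def)
      also have "\<dots> \<le> v * (vol k Q * (g * v * norm z))"
        using vg x by (intro mult_left_mono) (auto simp: vol_nonneg)
      finally show "norm (ext_power k P *v (ext_power k Q *v x)) \<le> vol k Q * (g * v * v) * norm z"
        by (simp add: mult_ac)
    qed
    finally show "norm (ext_power k (P ** Q ** P) *v z) \<le> 2 * vol k Q * (g * v * v) * norm z" by (simp add: mult_ac)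
  qed
  moreover have "g * v * v = vol (k - 1) P * vol (k + 1) P"
    using vol_pos[OF inv kd] by (simp add: g_def v_def gap_def power2_eq_square)
  ultimately show ?thesis using Q by auto
qed

text \<open>Bound for the relative excess over the linear profile when the nodes \<open>1, \<dots>, i\<close> have been updated; the end
  points \<open>0\<close> and \<open>l\<close> are exact.\<close>

definition relax_profile :: "nat \<Rightarrow> nat \<Rightarrow> nat \<Rightarrow> real" where
  "relax_profile l i j = (if l \<le> j then 0 else if j \<le> i then 1 - (1/2) ^ j else 1)"

text \<open>Gauss-Seidel relaxation for the discrete Dirichlet problem on \<open>{0..l}\<close>. The exponent \<open>r\<close> counts the
  doublings, and \<open>L\<close> is the linear solution. After the nodes \<open>1, \<dots>, i\<close> have been updated, the excess over \<open>L\<close> is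
  bounded by \<open>M * relax_profile l i\<close>, because the mean of \<open>1 - (1/2) ^ i\<close> and \<open>1\<close> is \<open>1 - (1/2) ^ (i + 1)\<close>.\<close>

lemma relaxation_sweep:
  fixes y :: "'s \<Rightarrow> nat \<Rightarrow> real"
  assumes step: "\<And>s k. s \<in> R \<Longrightarrow> 1 \<le> k \<Longrightarrow> k < l \<Longrightarrow>
      \<exists>s'\<in>R. y s' k \<le> y s (k - 1) + y s (k + 1) \<and> (\<forall>j\<le>l. j \<noteq> k \<longrightarrow> y s' j \<le> 2 * y s j)"
    and M: "0 \<le> M" and lin: "\<And>k. 1 \<le> k \<Longrightarrow> L (k - 1) + L (k + 1) = 2 * L k"
    and s: "s \<in> R" "\<forall>j\<le>l. y s j \<le> 2 ^ r * (L j + M * relax_profile l 0 j)"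
  shows "i < l \<Longrightarrow> \<exists>s\<in>R. \<exists>r. \<forall>j\<le>l. y s j \<le> 2 ^ r * (L j + M * relax_profile l i j)"
proof (induction i)
  case 0
  thus ?case using s by blast
next
  case (Suc i)
  then obtain s r where s: "s \<in> R" and b: "\<And>j. j \<le> l \<Longrightarrow> y s j \<le> 2 ^ r * (L j + M * relax_profile l i j)" by auto
  obtain s' where s': "s' \<in> R" "y s' (Suc i) \<le> y s i + y s (i + 2)" "\<And>j. j \<le> l \<Longrightarrow> j \<noteq> Suc i \<Longrightarrow> y s' j \<le> 2 * y s j"
    using step[OF s, of "Suc i"] Suc.prems by auto
  have "y s' j \<le> 2 ^ Suc r * (L j + M * relax_profile l (Suc i) j)" if "j \<le> l" for j
  proof (cases "j = Suc i")
    case True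
    have h: "(1/2::real) ^ i = 2 * (1/2) ^ Suc i" by simp
    have "relax_profile l i i + relax_profile l i (i + 2) \<le> 2 * relax_profile l (Suc i) (Suc i)"
      using Suc.prems unfolding relax_profile_def by (auto simp: h simp del: power_Suc)
    from mult_left_mono[OF this M]
    have "M * relax_profile l i i + M * relax_profile l i (i + 2) \<le> 2 * (M * relax_profile l (Suc i) (Suc i))"
      by (simp add: distrib_left)
    moreover have "L i + L (i + 2) = 2 * L (Suc i)" using lin[of "Suc i"] by simp
    ultimately have "(L i + M * relax_profile l i i) + (L (i + 2) + M * relax_profile l i (i + 2)) \<le>
        2 * (L (Suc i) + M * relax_profile l (Suc i) (Suc i))" by simp
    from mult_left_mono[OF this, of "2 ^ r"]
    have "2 ^ r * (L i + M * relax_profile l i i) + 2 ^ r * (L (i + 2) + M * relax_profile l i (i + 2)) \<le>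
        2 ^ Suc r * (L (Suc i) + M * relax_profile l (Suc i) (Suc i))" by (simp add: distrib_left)
    thus ?thesis using s'(2) b[of i] b[of "i + 2"] Suc.prems True by simp
  next
    case False
    hence "relax_profile l (Suc i) j = relax_profile l i j" by (auto simp: relax_profile_def)
    thus ?thesis using s'(3)[OF that False] b[OF that] by simp
  qed
  thus ?case using s'(1) by blast
qed

text \<open>A full sweep contracts the excess over the linear profile \<open>L\<close> by the factor \<open>\<theta> < 1\<close>, so eventually
  the value at \<open>1\<close> is negative, as \<open>L 1\<close> is.\<close>

lemma relaxation:
  fixes y :: "'s \<Rightarrow> nat \<Rightarrow> real"
  assumes l: "1 \<le> l"
    and step: "\<And>s k. s \<in> R \<Longrightarrow> 1 \<le> k \<Longrightarrow> k < l \<Longrightarrow>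
      \<exists>s'\<in>R. y s' k \<le> y s (k - 1) + y s (k + 1) \<and> (\<forall>j\<le>l. j \<noteq> k \<longrightarrow> y s' j \<le> 2 * y s j)"
    and s0: "s0 \<in> R" and neg: "(real l - 1) * y s0 0 + y s0 l < 0"
  shows "\<exists>s\<in>R. y s 1 < 0"
proof -
  define L where "L j = ((real l - real j) * y s0 0 + real j * y s0 l) / real l" for j
  have lin: "L (k - 1) + L (k + 1) = 2 * L k" if "1 \<le> k" for k
    using that by (simp add: L_def add_divide_distrib[symmetric] of_nat_diff algebra_simps)
  have L0: "L 0 = y s0 0" and Ll: "L l = y s0 l" using l by (simp_all add: L_def)
  have L1: "L 1 < 0" using neg l by (simp add: L_def divide_less_0_iff)
  define M where "M = Max (insert 0 ((\<lambda>j. y s0 j - L j) ` {..l}))"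
  have M0: "0 \<le> M" unfolding M_def by (intro Max_ge) auto
  have My: "y s0 j - L j \<le> M" if "j \<le> l" for j unfolding M_def using that by (intro Max_ge) auto
  define \<theta> where "\<theta> = 1 - (1/2::real) ^ l"
  have \<theta>: "0 \<le> \<theta>" "\<theta> < 1" by (auto simp: \<theta>_def power_le_one)
  have prof: "relax_profile l (l - 1) j \<le> \<theta> * relax_profile l 0 j" for j
  proof -
    have "(1/2::real) ^ l \<le> (1/2) ^ j" if "j < l" using that by (intro power_decreasing) auto
    thus ?thesis using l by (auto simp: relax_profile_def \<theta>_def)
  qed
  have sweeps: "\<exists>s\<in>R. \<exists>r. \<forall>j\<le>l. y s j \<le> 2 ^ r * (L j + \<theta> ^ t * M * relax_profile l 0 j)" for t
  proof (induction t)
    case 0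
    have "y s0 j \<le> 2 ^ 0 * (L j + \<theta> ^ 0 * M * relax_profile l 0 j)" if "j \<le> l" for j
      using My[OF that] L0 Ll that by (cases "j = 0 \<or> j = l") (auto simp: relax_profile_def)
    thus ?case using s0 by blast
  next
    case (Suc t)
    then obtain s r where s: "s \<in> R" "\<forall>j\<le>l. y s j \<le> 2 ^ r * (L j + \<theta> ^ t * M * relax_profile l 0 j)" by blast
    have "0 \<le> \<theta> ^ t * M" using \<theta> M0 by simp
    from relaxation_sweep[OF step this lin s, of "l - 1"] l
    obtain s' r' where s': "s' \<in> R" "\<And>j. j \<le> l \<Longrightarrow> y s' j \<le> 2 ^ r' * (L j + \<theta> ^ t * M * relax_profile l (l - 1) j)" by auto
    have "y s' j \<le> 2 ^ r' * (L j + \<theta> ^ Suc t * M * relax_profile l 0 j)" if "j \<le> l" for j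
    proof -
      have "\<theta> ^ t * M * relax_profile l (l - 1) j \<le> \<theta> ^ t * M * (\<theta> * relax_profile l 0 j)"
        using \<theta> M0 by (intro mult_left_mono prof) auto
      hence "2 ^ r' * (L j + \<theta> ^ t * M * relax_profile l (l - 1) j) \<le> 2 ^ r' * (L j + \<theta> ^ Suc t * M * relax_profile l 0 j)"
        by (intro mult_left_mono) (auto simp: mult_ac)
      with s'(2)[OF that] show ?thesis by (rule order_trans)
    qed
    thus ?case using s'(1) by blast
  qed
  obtain t where t: "\<theta> ^ t * M < - L 1"
  proof -
    have "(\<lambda>t. \<theta> ^ t * M) \<longlonglongrightarrow> 0 * M" using \<theta> by (intro tendsto_mult LIMSEQ_power_zero tendsto_const) auto
    hence "eventually (\<lambda>t. \<theta> ^ t * M < - L 1) sequentially" using L1 by (auto simp: order_tendsto_iff)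
    thus thesis using that by (auto simp: eventually_sequentially)
  qed
  obtain s r where s: "s \<in> R" "y s 1 \<le> 2 ^ r * (L 1 + \<theta> ^ t * M * relax_profile l 0 1)"
    using sweeps[of t] l by blast
  have "\<theta> ^ t * M * relax_profile l 0 1 \<le> \<theta> ^ t * M * 1"
    using \<theta> M0 by (intro mult_left_mono) (auto simp: relax_profile_def)
  hence "L 1 + \<theta> ^ t * M * relax_profile l 0 1 < 0" using t by simp
  hence "2 ^ r * (L 1 + \<theta> ^ t * M * relax_profile l 0 1) < 0" by (simp add: mult_less_0_iff)
  thus ?thesis using s by (intro bexI[of _ s]) auto
qed

section \<open>The lower limit\<close>

lemma op_norm_scaleR: "op_norm (c *\<^sub>R A) = \<bar>c\<bar> * op_norm (A :: real^'n^'m)"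
  unfolding op_norm_def scaleR_matrix_vector_assoc[symmetric]
  by (rule onorm_scaleR) (rule matrix_vector_mul_bounded_linear)

definition closed_nbhd :: "real \<Rightarrow> (real^'n^'n) set \<Rightarrow> (real^'n^'n) set" where
  "closed_nbhd \<theta> S = {M. \<exists>A\<in>S. op_norm (A - M) \<le> \<theta>}"

lemma near_closed_nbhd: "near \<theta> S (closed_nbhd \<theta> S)"
  by (auto simp: near_def closed_nbhd_def)

lemma subset_closed_nbhd: "0 \<le> \<theta> \<Longrightarrow> S \<subseteq> closed_nbhd \<theta> S" for S :: "(real^'n^'n) set"
proof
  fix A assume "0 \<le> \<theta>" "A \<in> S"
  moreover have "op_norm (A - A) = 0" by (simp add: op_norm_eq_0)
  ultimately show "A \<in> closed_nbhd \<theta> S"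
    unfolding closed_nbhd_def by (intro CollectI bexI[of _ A]) auto
qed

lemma compact_closed_nbhd:
  fixes S :: "(real^'n^'n) set"
  assumes "compact S"
  shows "compact (closed_nbhd \<theta> S)"
proof -
  let ?B = "{E :: real^'n^'n. op_norm E \<le> \<theta>}"
  have "closed ?B" by (intro closed_Collect_le continuous_on_op_norm continuous_intros)
  moreover have "bounded ?B"
  proof (rule boundedI)
    fix E :: "real^'n^'n" assume "E \<in> ?B"
    thus "norm E \<le> real CARD('n) * real CARD('n) * \<theta>"
      by (intro order_trans[OF norm_le_op_norm] mult_left_mono) auto
  qed
  ultimately have "compact ?B" by (simp add: compact_eq_bounded_closed)
  hence "compact {A - E |A E. A \<in> S \<and> E \<in> ?B}" by (rule compact_differences[OF assms])
  moreover have "closed_nbhd \<theta> S = {A - E |A E. A \<in> S \<and> E \<in> ?B}"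
  proof (intro equalityI subsetI)
    fix M assume "M \<in> closed_nbhd \<theta> S"
    then obtain A where "A \<in> S" "op_norm (A - M) \<le> \<theta>" by (auto simp: closed_nbhd_def)
    moreover have "M = A - (A - M)" by simp
    ultimately show "M \<in> {A - E |A E. A \<in> S \<and> E \<in> ?B}" by blast
  next
    fix M assume "M \<in> {A - E |A E. A \<in> S \<and> E \<in> ?B}"
    then obtain A where "A \<in> S" "op_norm (A - M) \<le> \<theta>" by fastforce
    thus "M \<in> closed_nbhd \<theta> S" unfolding closed_nbhd_def by blast
  qed
  ultimately show ?thesis by simp
qed

text \<open>The punctured limit requires a set different from \<open>S\<close>: the neighbourhood contains a multiple of a
  matrix of largest norm in \<open>S\<close> whose norm is larger still.\<close>

lemma closed_nbhd_neq:
  fixes S :: "(real^'n^'n) set"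
  assumes S: "S \<in> compact_GL" and \<theta>: "0 < \<theta>"
  shows "closed_nbhd \<theta> S \<noteq> S"
proof -
  have "compact S" "S \<noteq> {}" using S by (auto simp: compact_GL_def)
  then obtain A where A: "A \<in> S" "\<And>B. B \<in> S \<Longrightarrow> op_norm B \<le> op_norm A"
    using continuous_attains_sup[of S op_norm, OF _ _ continuous_on_op_norm] by blast
  have "A \<noteq> 0"
  proof
    assume "A = 0"
    moreover have "invertible A" using S A(1) by (auto simp: compact_GL_def)
    ultimately have "(mat 1 :: real^'n^'n) = 0" by (auto simp: invertible_def)
    hence "(mat 1 :: real^'n^'n) $ i $ i = 0" for i by simp
    thus False by (simp add: mat_def)
  qed
  hence nA: "0 < op_norm A" using op_norm_nonneg[of A] op_norm_eq_0[of A] by linarith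
  define t where "t = \<theta> / op_norm A"
  have t: "t > 0" using nA \<theta> by (simp add: t_def)
  have "A - (1 + t) *\<^sub>R A = (- t) *\<^sub>R A" by (simp add: algebra_simps)
  hence "op_norm (A - (1 + t) *\<^sub>R A) = \<theta>" using nA t \<theta> by (simp only: op_norm_scaleR) (simp add: t_def)
  hence "(1 + t) *\<^sub>R A \<in> closed_nbhd \<theta> S" using A(1) by (auto simp: closed_nbhd_def)
  moreover have "op_norm ((1 + t) *\<^sub>R A) > op_norm A" using t nA by (simp add: op_norm_scaleR)
  ultimately show ?thesis using A(2) by force
qed

lemma GL_dist_closed_nbhd:
  assumes "S \<in> compact_GL" "closed_nbhd \<theta> S \<in> compact_GL" "0 \<le> \<theta>"
  shows "GL_dist S (closed_nbhd \<theta> S) \<le> \<theta>"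
proof -
  have "\<forall>A\<in>S. \<exists>B\<in>closed_nbhd \<theta> S. op_norm (A - B) \<le> \<theta>"
  proof
    fix A assume "A \<in> S"
    moreover have "op_norm (A - A) \<le> \<theta>" using assms(3) by (simp add: op_norm_eq_0[THEN iffD2])
    ultimately show "\<exists>B\<in>closed_nbhd \<theta> S. op_norm (A - B) \<le> \<theta>" using subset_closed_nbhd[OF assms(3), of S] by blast
  qed
  moreover have "\<forall>B\<in>closed_nbhd \<theta> S. \<exists>A\<in>S. op_norm (A - B) \<le> \<theta>" by (auto simp: closed_nbhd_def)
  ultimately show ?thesis
    using assms hausdorff_dist_le_iff[of S "closed_nbhd \<theta> S" \<theta>] by (auto simp: GL_dist_def compact_GL_def)
qed

lemma perturbed_subset_closed_nbhd:
  fixes S :: "(real^'n^'n) set"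
  assumes S: "\<And>A. A \<in> S \<Longrightarrow> op_norm A \<le> b" and \<eta>: "0 \<le> \<eta>" "\<eta> \<le> 1"
  shows "perturbed \<eta> (perturbed \<eta> S) \<subseteq> closed_nbhd (3 * \<eta> * b) S"
proof
  fix M assume "M \<in> perturbed \<eta> (perturbed \<eta> S)"
  then obtain R' R A where A: "A \<in> S" and R: "op_norm (R - mat 1) \<le> \<eta>" "op_norm (R' - mat 1) \<le> \<eta>"
    and M: "M = R' ** (R ** A)" by (auto simp: perturbed_def)
  have diff: "op_norm (X ** Y - Y) \<le> \<eta> * op_norm Y" if "op_norm (X - mat 1) \<le> \<eta>" for X Y :: "real^'n^'n"
  proof -
    have "X ** Y - Y = (X - mat 1) ** Y" by (simp add: matrix_diff_mult)
    hence "op_norm (X ** Y - Y) \<le> op_norm (X - mat 1) * op_norm Y" by (simp add: op_norm_mult)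
    also have "\<dots> \<le> \<eta> * op_norm Y" using that by (intro mult_right_mono op_norm_nonneg)
    finally show ?thesis .
  qed
  have b0: "0 \<le> b" using S[OF A] op_norm_nonneg order_trans by blast
  have 1: "op_norm (R ** A - A) \<le> \<eta> * b"
    using diff[OF R(1), of A] mult_left_mono[OF S[OF A] \<eta>(1)] by simp
  have "op_norm (R ** A) \<le> op_norm A + op_norm (R ** A - A)" using op_norm_triangle[of A "R ** A - A"] by simp
  also have "\<dots> \<le> b + 1 * b" using S[OF A] 1 mult_right_mono[OF \<eta>(2) b0] by simp
  finally have "\<eta> * op_norm (R ** A) \<le> \<eta> * (2 * b)" using \<eta>(1) by (intro mult_left_mono) auto
  hence 2: "op_norm (M - R ** A) \<le> 2 * \<eta> * b" using diff[OF R(2), of "R ** A"] by (simp add: M)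
  have "op_norm (M - A) \<le> 3 * \<eta> * b"
    using op_norm_triangle[of "M - R ** A" "R ** A - A"] 1 2 by simp
  hence "op_norm (A - M) \<le> 3 * \<eta> * b" by (simp add: op_norm_minus_commute[of A M])
  thus "M \<in> closed_nbhd (3 * \<eta> * b) S" using A unfolding closed_nbhd_def by blast
qed

lemma not_dominated_steering:
  fixes S :: "(real^'n^'n) set"
  assumes S: "bounded_GL b S" and b: "1 \<le> b" and \<eta>: "0 < \<eta>" "\<eta> \<le> 1" and k: "1 \<le> k" "k < CARD('n)"
    and nd: "\<not> dominated k S"
  shows "\<exists>m\<ge>1. \<forall>E F :: (real^'n) set. subspace E \<longrightarrow> k \<le> dim E \<longrightarrow> subspace F \<longrightarrow> CARD('n) - k \<le> dim F \<longrightarrow>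
      (\<exists>Q\<in>products m (perturbed \<eta> (perturbed \<eta> S)). \<exists>u\<in>E. u \<noteq> 0 \<and> Q *v u \<in> F)"
proof -
  define q where "q = 1 + \<eta>\<^sup>2 / 2"
  have q: "q > 1" using \<eta> by (simp add: q_def)
  define C where "C = (1 + 1 / \<eta>) * b\<^sup>2 / \<eta> * q"
  have "1 \<le> b\<^sup>2" using b by (simp add: one_le_power)
  hence "1 \<le> b\<^sup>2 / \<eta>" using \<eta> by (simp add: field_simps)
  moreover have "1 \<le> 1 + 1 / \<eta>" using \<eta> by simp
  ultimately have "1 * 1 \<le> (1 + 1 / \<eta>) * (b\<^sup>2 / \<eta>)" by (intro mult_mono) auto
  hence "1 * q \<le> C" using q unfolding C_def by (intro mult_right_mono) auto
  hence C: "C > 1" using q by simp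
  have "1 / q \<in> {0<..<1}" using q by simp
  hence "\<not> (\<forall>n\<ge>1. \<forall>P\<in>products n S. singular_value (k + 1) P / singular_value k P \<le> C * (1 / q) ^ n)"
    using nd k C unfolding dominated_def by blast
  then obtain n P where n: "1 \<le> n" and P: "P \<in> products n S"
    and gt: "C * (1 / q) ^ n < singular_value (k + 1) P / singular_value k P" by (auto simp: not_le)
  obtain m where m: "n = Suc m" using n by (cases n) auto
  have inv: "invertible P" by (rule invertible_products[OF bounded_GL_invertible[OF S] P])
  have "(1 + 1 / \<eta>) * b\<^sup>2 / \<eta> / q ^ m = C * (1 / q) ^ n"
    using q by (simp add: C_def m power_one_over)
  hence "(1 + 1 / \<eta>) * b\<^sup>2 / \<eta> / (1 + \<eta>\<^sup>2 / 2) ^ m \<le> gap k P"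
    using gt gap_eq_singular_value_ratio[OF inv k] by (simp add: q_def)
  from steering[OF S b \<eta> k P[unfolded m] this] show ?thesis by (intro exI[of _ "Suc m"]) auto
qed

lemma vol_0: "invertible P \<Longrightarrow> vol 0 P = 1" for P :: "real^'n^'n"
  using svd_exists[of P] vol_svd[where k = 0] by fastforce

lemma op_norm_le_vol_1:
  fixes P :: "real^'n^'n"
  assumes "invertible P"
  shows "op_norm P \<le> vol 1 P"
proof -
  obtain U s V e where svd: "svd P U s V e" using svd_exists[OF assms] by blast
  have d: "0 < CARD('n)" by simp
  have "s i \<le> s (e 0)" for i
  proof -
    obtain j where "j < CARD('n)" "i = e j" using svd_e[OF svd] by (auto simp: bij_betw_def)
    thus ?thesis by (simp add: svd_dec[OF svd])
  qed
  hence "op_norm P \<le> s (e 0)"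
    by (intro op_norm_le norm_svd_le[OF svd]) (auto intro: less_imp_le svd_pos[OF svd])
  thus ?thesis using vol_svd[OF svd, of 1] d by simp
qed

lemma lower_spectral_radius_approx:
  fixes S :: "(real^'n^'n) set"
  assumes S: "S \<noteq> {}" and r: "lower_spectral_radius (ext_power k ` S) < r"
  shows "eventually (\<lambda>n. \<exists>P\<in>products n S. vol k P \<le> r ^ n) sequentially"
proof -
  let ?S = "ext_power k ` S"
  have ne: "?S \<noteq> {}" using S by simp
  have "eventually (\<lambda>n. (INF P\<in>products n ?S. root n (op_norm P)) < r) sequentially"
    using lower_spectral_radius_LIMSEQ[OF ne] r by (simp add: order_tendsto_iff)
  thus ?thesis using eventually_ge_at_top[of 1]
  proof eventually_elim
    case (elim n)
    obtain Q where Q: "Q \<in> products n ?S" "root n (op_norm Q) < r"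
      using elim(1) cINF_less_iff[OF products_nonempty[OF ne] bdd_below_root_op_norm] by blast
    obtain P where P: "P \<in> products n S" "Q = ext_power k P" using products_ext_power_image[OF elim(2) Q(1)] by blast
    have "root n (op_norm Q) ^ n \<le> r ^ n"
      using Q(2) elim(2) by (intro power_mono) (auto simp: op_norm_nonneg real_root_ge_zero)
    hence "vol k P \<le> r ^ n" using elim(2) P(2) by (simp add: vol_def op_norm_nonneg)
    thus ?case using P(1) by blast
  qed
qed

text \<open>Volumes are normalised by the target rate \<open>\<mu>\<close> and multiplied by a constant \<open>C\<close> which absorbs the
  connecting words; the logarithms of the normalised volumes then satisfy the hypotheses of
  \<open>relaxation\<close> exactly. In degree \<open>0\<close> the normalised volume is \<open>C\<close>, and in degree \<open>l\<close> it decays exponentially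
  for suitable products, so for a sufficiently long initial product the linear profile is negative at \<open>1\<close>.\<close>

lemma small_product_in_perturbation:
  fixes T :: "(real^'n^'n) set"
  assumes T: "bounded_GL b T" and b: "1 \<le> b" and l: "1 \<le> l" "l \<le> CARD('n)" and \<mu>: "0 < \<mu>"
    and steer: "\<And>k. 1 \<le> k \<Longrightarrow> k < l \<Longrightarrow> \<exists>m\<ge>1. \<forall>E F :: (real^'n) set. subspace E \<longrightarrow> k \<le> dim E \<longrightarrow>
      subspace F \<longrightarrow> CARD('n) - k \<le> dim F \<longrightarrow> (\<exists>Q\<in>products m T. \<exists>u\<in>E. u \<noteq> 0 \<and> Q *v u \<in> F)"
    and r: "0 < r" "r < \<mu> ^ l" and P: "eventually (\<lambda>n. \<exists>P\<in>products n T. vol l P \<le> r ^ n) sequentially"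
  shows "\<exists>n\<ge>1. \<exists>X\<in>products n T. op_norm X \<le> \<mu> ^ n"
proof -
  have inv: "invertible X" if "X \<in> products n T" for X n
    by (rule invertible_products[OF bounded_GL_invertible[OF T] that])
  obtain m where m: "\<And>k E F. 1 \<le> k \<Longrightarrow> k < l \<Longrightarrow> subspace E \<Longrightarrow> k \<le> dim E \<Longrightarrow>
      subspace F \<Longrightarrow> CARD('n) - k \<le> dim F \<Longrightarrow> \<exists>Q\<in>products (m k) T. \<exists>u\<in>E. u \<noteq> 0 \<and> Q *v (u :: real^'n) \<in> F"
    using steer by metis
  define \<kappa> where "\<kappa> = max 1 (1 / \<mu>)"
  have \<kappa>: "1 \<le> \<kappa>" "1 / \<mu> \<le> \<kappa>" by (auto simp: \<kappa>_def)
  define M where "M = (\<Sum>k<l. m k)"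
  define C where "C = 2 * (b * \<kappa>) ^ (M * CARD('n))"
  have bk: "1 \<le> b * \<kappa>" using b \<kappa> mult_mono[of 1 b 1 \<kappa>] by simp
  have C: "2 \<le> C" using one_le_power[OF bk] by (simp add: C_def)
  \<comment> \<open>the lengths \<open>m k\<close> of the connecting words are fixed before the products to be connected are chosen\<close>
  have conn: "2 * vol j Q / \<mu> ^ (j * m k) \<le> C" if "k < l" "j \<le> l" "Q \<in> products (m k) T" for k j Q
  proof -
    have mM: "m k \<le> M" unfolding M_def using that by (intro member_le_sum) auto
    have jm: "j * m k \<le> M * CARD('n)" using mult_le_mono[OF _ mM, of j "CARD('n)"] that l by (simp add: mult.commute)
    have "op_norm Q \<le> b ^ m k" using T b that(3) by (intro op_norm_products_le) (auto simp: bounded_GL_def)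
    have "vol j Q \<le> op_norm Q ^ j" using that l by (intro vol_le_power inv[OF that(3)]) auto
    also have "\<dots> \<le> (b ^ m k) ^ j" using \<open>op_norm Q \<le> b ^ m k\<close> by (intro power_mono op_norm_nonneg)
    finally have "vol j Q \<le> b ^ (j * m k)" by (simp add: power_mult[symmetric] mult.commute)
    hence "vol j Q * (1 / \<mu>) ^ (j * m k) \<le> b ^ (j * m k) * \<kappa> ^ (j * m k)"
      using \<kappa> \<mu> b by (intro mult_mono power_mono) auto
    also have "\<dots> \<le> (b * \<kappa>) ^ (M * CARD('n))"
      unfolding power_mult_distrib[symmetric] by (rule power_increasing[OF jm bk])
    finally show ?thesis by (simp add: C_def power_one_over)
  qed
  define R where "R = {(n, X). 1 \<le> n \<and> X \<in> products n T}"
  define a where "a s j = C * vol j (snd s) / \<mu> ^ (j * fst s)" for s :: "nat \<times> (real^'n^'n)" and j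
  have apos: "0 < a s j" if "s \<in> R" "j \<le> l" for s j
    using that C \<mu> l vol_pos[OF inv, of "snd s" "fst s" j] by (auto simp: a_def R_def)
  have step: "\<exists>s'\<in>R. ln (a s' k) \<le> ln (a s (k - 1)) + ln (a s (k + 1)) \<and>
      (\<forall>j\<le>l. j \<noteq> k \<longrightarrow> ln (a s' j) \<le> 2 * ln (a s j))" if s: "s \<in> R" and k: "1 \<le> k" "k < l" for s k
  proof -
    obtain n X where nX: "s = (n, X)" "1 \<le> n" "X \<in> products n T" using s by (auto simp: R_def)
    have "k < CARD('n)" using k l by simp
    from vol_sandwich[OF inv[OF nX(3)] k(1) this m[OF k]]
    obtain Q where Q: "Q \<in> products (m k) T" "vol k (X ** Q ** X) \<le> 2 * vol k Q * (vol (k - 1) X * vol (k + 1) X)"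
      by blast
    define s' where "s' = (n + m k + n, X ** Q ** X)"
    have s'R: "s' \<in> R" using nX Q by (auto simp: s'_def R_def intro!: products_mult)
    have transfer: "ln (a s' j) \<le> ln (a s i) + ln (a s i')"
      if j: "j \<le> l" and i: "i \<le> l" "i' \<le> l" "i + i' = 2 * j"
        and le: "vol j (X ** Q ** X) \<le> 2 * vol j Q * (vol i X * vol i' X)" for j i i'
    proof -
      have "j * n + j * n = i * n + i' * n" using i(3) by (metis add_mult_distrib mult_2)
      hence lin: "\<mu> ^ (j * (n + m k + n)) = \<mu> ^ (j * m k) * (\<mu> ^ (i * n) * \<mu> ^ (i' * n))"
        unfolding power_add[symmetric] by (intro arg_cong[where f = "\<lambda>x. \<mu> ^ x"]) (simp add: algebra_simps)
      have "a s' j \<le> C * (2 * vol j Q * (vol i X * vol i' X)) / \<mu> ^ (j * (n + m k + n))"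
        using le C \<mu> by (simp add: a_def s'_def divide_right_mono)
      also have "\<dots> = (2 * vol j Q / \<mu> ^ (j * m k)) * (C * (vol i X * vol i' X) / (\<mu> ^ (i * n) * \<mu> ^ (i' * n)))"
        unfolding lin by simp
      also have "\<dots> \<le> C * (C * (vol i X * vol i' X) / (\<mu> ^ (i * n) * \<mu> ^ (i' * n)))"
        using conn[OF k(2) j Q(1)] C \<mu> by (intro mult_right_mono) (auto simp: vol_nonneg)
      also have "\<dots> = a s i * a s i'" by (simp add: a_def nX)
      finally have "ln (a s' j) \<le> ln (a s i * a s i')"
        using apos[OF s'R j] by (subst ln_le_cancel_iff) (auto intro!: mult_pos_pos apos[OF s] i)
      thus ?thesis by (simp only: ln_mult_pos[OF apos[OF s i(1)] apos[OF s i(2)]])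
    qed
    have 1: "ln (a s' k) \<le> ln (a s (k - 1)) + ln (a s (k + 1))"
      using k Q(2) by (intro transfer) auto
    have "ln (a s' j) \<le> 2 * ln (a s j)" if j: "j \<le> l" for j
    proof -
      have "vol j (X ** Q ** X) \<le> vol j (X ** Q) * vol j X" by (rule vol_mult_le)
      also have "\<dots> \<le> (vol j X * vol j Q) * vol j X" by (intro mult_right_mono vol_mult_le vol_nonneg)
      also have "\<dots> \<le> 2 * vol j Q * (vol j X * vol j X)" by (simp add: vol_nonneg)
      finally show ?thesis using transfer[OF j j j] by simp
    qed
    thus ?thesis using 1 s'R by blast
  qed
  \<comment> \<open>\<open>C\<close> does not depend on \<open>N\<close>, so a long initial product makes \<open>C ^ l * (r / \<mu> ^ l) ^ N\<close> less than \<open>1\<close>\<close>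
  have "(\<lambda>n. C ^ l * (r / \<mu> ^ l) ^ n) \<longlonglongrightarrow> C ^ l * 0"
    using r \<mu> by (intro tendsto_mult tendsto_const LIMSEQ_power_zero) (simp add: field_simps)
  hence "eventually (\<lambda>n. C ^ l * (r / \<mu> ^ l) ^ n < 1) sequentially" by (auto simp: order_tendsto_iff)
  from eventually_conj[OF this eventually_conj[OF P eventually_ge_at_top[of 1]]]
  obtain N X where N: "1 \<le> N" "C ^ l * (r / \<mu> ^ l) ^ N < 1" "X \<in> products N T" "vol l X \<le> r ^ N"
    by (auto simp: eventually_sequentially)
  have s0: "(N, X) \<in> R" using N by (simp add: R_def)
  have a0: "a (N, X) 0 = C" using vol_0[OF inv[OF N(3)]] by (simp add: a_def)
  have "C ^ (l - 1) * a (N, X) l < 1"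
  proof -
    have "C ^ (l - 1) * a (N, X) l = C ^ l * vol l X / \<mu> ^ (l * N)"
      using l by (simp add: a_def power_eq_if)
    also have "\<dots> \<le> C ^ l * r ^ N / \<mu> ^ (l * N)"
      using N(4) C \<mu> by (intro divide_right_mono mult_left_mono) auto
    also have "\<dots> = C ^ l * (r / \<mu> ^ l) ^ N" by (simp add: power_divide power_mult)
    finally show ?thesis using N(2) by simp
  qed
  hence "ln (C ^ (l - 1) * a (N, X) l) < 0"
    using C apos[OF s0, of l] by (subst ln_less_zero_iff) (auto intro!: mult_pos_pos)
  hence "real (l - 1) * ln C + ln (a (N, X) l) < 0"
    using C apos[OF s0, of l] by (simp add: ln_mult ln_realpow)
  hence "(real l - 1) * ln (a (N, X) 0) + ln (a (N, X) l) < 0" using l by (simp add: a0 of_nat_diff)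
  from relaxation[where y = "\<lambda>s j. ln (a s j)", OF l(1) step s0 this]
  obtain s where s: "s \<in> R" "ln (a s 1) < 0" by blast
  obtain n Y where nY: "s = (n, Y)" "1 \<le> n" "Y \<in> products n T" using s(1) by (auto simp: R_def)
  have "a s 1 < 1" using s apos[OF s(1), of 1] l by (simp add: ln_less_zero_iff)
  hence "C * vol 1 Y < \<mu> ^ n" using \<mu> by (simp add: a_def nY divide_less_eq)
  moreover have "1 * vol 1 Y \<le> C * vol 1 Y" using C by (intro mult_right_mono vol_nonneg) auto
  ultimately have "op_norm Y \<le> \<mu> ^ n" using op_norm_le_vol_1[OF inv[OF nY(3)]] by simp
  thus ?thesis using nY by blast
qed

text \<open>The perturbed set is the full closed \<open>\<theta>\<close>-neighbourhood of \<open>S\<close>; it contains all perturbations needed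
  for the steering at every index \<open>k < l\<close> simultaneously.\<close>

lemma small_radius_nearby:
  fixes S :: "(real^'n^'n) set"
  assumes S: "S \<in> compact_GL" and l: "1 \<le> l" "l \<le> CARD('n)"
    and nd: "\<And>k. 1 \<le> k \<Longrightarrow> k < l \<Longrightarrow> \<not> dominated k S"
    and \<mu>: "0 < \<mu>" "lower_spectral_radius (ext_power l ` S) < \<mu> ^ l" and \<delta>: "0 < \<delta>"
  shows "\<exists>T\<in>compact_GL. T \<noteq> S \<and> GL_dist S T < \<delta> \<and> lower_spectral_radius T \<le> \<mu>"
proof -
  have cS: "compact S" "S \<noteq> {}" "\<And>A. A \<in> S \<Longrightarrow> invertible A" using S by (auto simp: compact_GL_def)
  obtain b \<delta>0 where b: "1 \<le> b" "0 < \<delta>0" "\<And>T. near \<delta>0 S T \<Longrightarrow> bounded_GL b T"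
    using bounded_GL_near[OF S] by blast
  define \<theta> where "\<theta> = min \<delta>0 (\<delta> / 2)"
  have \<theta>: "0 < \<theta>" "\<theta> < \<delta>" "\<theta> \<le> \<delta>0" using b \<delta> by (auto simp: \<theta>_def)
  define T where "T = closed_nbhd \<theta> S"
  have bT: "bounded_GL b T" using b(3)[OF near_mono[OF near_closed_nbhd \<theta>(3)]] by (simp add: T_def)
  have ST: "S \<subseteq> T" unfolding T_def using \<theta> by (intro subset_closed_nbhd) auto
  have bS: "bounded_GL b S" using bT ST by (auto simp: bounded_GL_def)
  have TGL: "T \<in> compact_GL"
    using cS ST compact_closed_nbhd[OF cS(1)] bounded_GL_invertible[OF bT] by (auto simp: compact_GL_def T_def)
  have dist: "GL_dist S T < \<delta>" using GL_dist_closed_nbhd[OF S, of \<theta>] TGL \<theta> by (simp add: T_def)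
  define \<eta> where "\<eta> = min 1 (\<theta> / (3 * b))"
  have \<eta>: "0 < \<eta>" "\<eta> \<le> 1" "3 * \<eta> * b \<le> \<theta>" using \<theta> b by (auto simp: \<eta>_def min_def field_simps)
  have "perturbed \<eta> (perturbed \<eta> S) \<subseteq> closed_nbhd (3 * \<eta> * b) S"
    using bS \<eta> by (intro perturbed_subset_closed_nbhd) (auto simp: bounded_GL_def)
  also have "\<dots> \<subseteq> T" unfolding T_def closed_nbhd_def using order_trans[OF _ \<eta>(3)] by blast
  finally have pT: "perturbed \<eta> (perturbed \<eta> S) \<subseteq> T" .
  have steer: "\<exists>m\<ge>1. \<forall>E F :: (real^'n) set. subspace E \<longrightarrow> k \<le> dim E \<longrightarrow>
      subspace F \<longrightarrow> CARD('n) - k \<le> dim F \<longrightarrow> (\<exists>Q\<in>products m T. \<exists>u\<in>E. u \<noteq> 0 \<and> Q *v u \<in> F)"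
    if k: "1 \<le> k" "k < l" for k
  proof -
    have kd: "k < CARD('n)" using k l by simp
    show ?thesis
      using not_dominated_steering[OF bS b(1) \<eta>(1,2) k(1) kd nd[OF k]] products_mono[OF pT] by (meson subsetD)
  qed
  define r where "r = (lower_spectral_radius (ext_power l ` S) + \<mu> ^ l) / 2"
  have r: "lower_spectral_radius (ext_power l ` S) < r" "r < \<mu> ^ l" using \<mu>(2) by (auto simp: r_def)
  hence r0: "0 < r" using lower_spectral_radius_ext_power(2)[OF cS(2), of l] by linarith
  have "eventually (\<lambda>n. \<exists>P\<in>products n T. vol l P \<le> r ^ n) sequentially"
    using lower_spectral_radius_approx[OF cS(2) r(1)]
    by (rule eventually_mono) (use products_mono[OF ST] in blast)
  from small_product_in_perturbation[OF bT b(1) l \<mu>(1) steer r0 r(2) this]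
  obtain n X where X: "1 \<le> n" "X \<in> products n T" "op_norm X \<le> \<mu> ^ n" by blast
  have Tne: "T \<noteq> {}" using cS(2) ST by auto
  have "lower_spectral_radius T ^ n \<le> \<mu> ^ n"
    using lower_spectral_radius_le(1)[OF Tne X(1,2)] X(3) by simp
  hence "lower_spectral_radius T \<le> \<mu>"
    using X(1) \<mu>(1) lower_spectral_radius_le(2)[OF Tne X(1,2)] by (subst (asm) power_mono_iff) auto
  moreover have "T \<noteq> S" unfolding T_def by (rule closed_nbhd_neq[OF S \<theta>(1)])
  ultimately show ?thesis using TGL dist by blast
qed

lemma min_domination_index:
  fixes S :: "(real^'n^'n) set"
  shows "1 \<le> min_domination_index S" "min_domination_index S \<le> CARD('n)" "dominated (min_domination_index S) S"
    and "1 \<le> k \<Longrightarrow> k < min_domination_index S \<Longrightarrow> \<not> dominated k S"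
proof -
  let ?K = "{k \<in> {1..CARD('n)}. dominated k S}"
  have "CARD('n) \<in> ?K" by (auto simp: dominated_def Suc_le_eq)
  hence K: "finite ?K" "?K \<noteq> {}" by auto
  have "min_domination_index S \<in> ?K" unfolding min_domination_index_def by (rule Min_in[OF K])
  thus m: "1 \<le> min_domination_index S" "min_domination_index S \<le> CARD('n)" "dominated (min_domination_index S) S" by auto
  show "\<not> dominated k S" if "1 \<le> k" "k < min_domination_index S"
  proof
    assume "dominated k S"
    hence "k \<in> ?K" using that m by simp
    hence "min_domination_index S \<le> k" unfolding min_domination_index_def by (rule Min_le[OF K(1)])
    thus False using that by simp
  qed
qed

theorem theorem3:
  fixes S :: "(real^'n^'n) set"
  assumes "S \<in> compact_GL"
  shows "Liminf (atin compact_GL.mtopology S) (\<lambda>T. ereal (lower_spectral_radius T)) =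
    ereal (root (min_domination_index S)
      (lower_spectral_radius (ext_power (min_domination_index S) ` S)))"
proof -
  define l where "l = min_domination_index S"
  define r where "r = lower_spectral_radius (ext_power l ` S)"
  have l: "1 \<le> l" "l \<le> CARD('n)" "dominated l S" "\<And>k. 1 \<le> k \<Longrightarrow> k < l \<Longrightarrow> \<not> dominated k S"
    unfolding l_def using min_domination_index(1-3)[of S] min_domination_index(4)[of _ S] by auto
  have Sne: "S \<noteq> {}" using assms by (auto simp: compact_GL_def)
  have r: "0 \<le> r" unfolding r_def by (rule lower_spectral_radius_ext_power(2)[OF Sne])
  have ev: "eventually Q (atin compact_GL.mtopology S) \<longleftrightarrow>
      (\<exists>\<delta>>0. \<forall>T\<in>compact_GL. T \<noteq> S \<longrightarrow> GL_dist S T < \<delta> \<longrightarrow> Q T)" for Q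
  proof -
    have "eventually Q (atin compact_GL.mtopology S) \<longleftrightarrow>
        (\<exists>\<delta>>0. \<forall>T. T \<in> compact_GL \<and> 0 < GL_dist T S \<and> GL_dist T S < \<delta> \<longrightarrow> Q T)"
      using assms compact_GL.eventually_atin_metric[of Q S] by simp
    also have "\<dots> \<longleftrightarrow> (\<exists>\<delta>>0. \<forall>T\<in>compact_GL. T \<noteq> S \<longrightarrow> GL_dist S T < \<delta> \<longrightarrow> Q T)"
    proof (intro ex_cong1 conj_cong refl)
      have "0 < GL_dist T S \<longleftrightarrow> T \<noteq> S" if "T \<in> compact_GL" for T
        using compact_GL.zero[OF that assms] compact_GL.nonneg[of T S] by linarith
      thus "(\<forall>T. T \<in> compact_GL \<and> 0 < GL_dist T S \<and> GL_dist T S < \<delta> \<longrightarrow> Q T) \<longleftrightarrow>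
          (\<forall>T\<in>compact_GL. T \<noteq> S \<longrightarrow> GL_dist S T < \<delta> \<longrightarrow> Q T)" for \<delta>
        by (auto simp: compact_GL.commute[of S])
    qed
    finally show ?thesis .
  qed
  let ?f = "\<lambda>T. ereal (lower_spectral_radius T)"
  have "Liminf (atin compact_GL.mtopology S) ?f = ereal (root l r)"
  proof (rule antisym)
    show "ereal (root l r) \<le> Liminf (atin compact_GL.mtopology S) ?f"
      unfolding le_Liminf_iff
    proof (intro allI impI)
      fix y assume "y < ereal (root l r)"
      then obtain z where z: "y < ereal z" "z < root l r" using ereal_dense2 by (metis ereal_less_eq(3) less_ereal.simps(1) not_le)
      show "eventually (\<lambda>T. y < ?f T) (atin compact_GL.mtopology S)"
      proof (cases "0 \<le> z")
        case True
        have "z ^ l < root l r ^ l" using z(2) True l(1) by (intro power_strict_mono) auto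
        hence "z ^ l < r" using r l(1) by simp
        then obtain \<delta> where \<delta>: "\<delta> > 0" "\<And>T. T \<in> compact_GL \<Longrightarrow> near \<delta> S T \<Longrightarrow> z \<le> lower_spectral_radius T"
          using lower_spectral_radius_lower_semicontinuous[OF assms l(1-3) True] by (auto simp: r_def)
        have "y < ?f T" if "T \<in> compact_GL" "GL_dist S T < \<delta>" for T
        proof -
          have "z \<le> lower_spectral_radius T" using that by (intro \<delta>(2) near_GL_dist assms) auto
          hence "ereal z \<le> ?f T" by simp
          with z(1) show ?thesis by (rule less_le_trans)
        qed
        thus ?thesis unfolding ev using \<delta>(1) by blast
      next
        case False
        have "y < ?f T" if "T \<in> compact_GL" for T
        proof -
          have Tne: "T \<noteq> {}" using that by (auto simp: compact_GL_def)
          obtain P where "P \<in> products 1 T" using products_nonempty[OF Tne, of 1] by blast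
          hence "0 \<le> lower_spectral_radius T" by (rule lower_spectral_radius_le(2)[OF Tne order_refl])
          hence "ereal z \<le> ?f T" using False by simp
          with z(1) show ?thesis by (rule less_le_trans)
        qed
        thus ?thesis unfolding ev using zero_less_one by blast
      qed
    qed
    show "Liminf (atin compact_GL.mtopology S) ?f \<le> ereal (root l r)"
    proof (rule ccontr)
      assume "\<not> ?thesis"
      then obtain \<mu> where \<mu>: "root l r < \<mu>" "ereal \<mu> < Liminf (atin compact_GL.mtopology S) ?f"
        using ereal_dense2 by (metis ereal_less_eq(3) less_ereal.simps(1) not_le)
      have r0: "0 \<le> root l r" using r by (simp add: real_root_ge_zero)
      hence \<mu>0: "0 < \<mu>" using \<mu>(1) by linarith
      have "root l r ^ l < \<mu> ^ l" using \<mu>(1) r0 l(1) by (intro power_strict_mono) auto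
      hence lt: "r < \<mu> ^ l" using r l(1) by simp
      have "eventually (\<lambda>T. ereal \<mu> < ?f T) (atin compact_GL.mtopology S)" by (rule less_LiminfD[OF \<mu>(2)])
      then obtain \<delta> where \<delta>: "\<delta> > 0" "\<And>T. T \<in> compact_GL \<Longrightarrow> T \<noteq> S \<Longrightarrow> GL_dist S T < \<delta> \<Longrightarrow> \<mu> < lower_spectral_radius T"
        unfolding ev by auto
      obtain T where "T \<in> compact_GL" "T \<noteq> S" "GL_dist S T < \<delta>" "lower_spectral_radius T \<le> \<mu>"
        using small_radius_nearby[OF assms l(1,2,4) \<mu>0 lt[unfolded r_def] \<delta>(1)] by blast
      thus False using \<delta>(2) by fastforce
    qed
  qed
  thus ?thesis by (simp add: l_def r_def)
qed

end
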